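(* Let $\Omega\subset\mathbb{R}^n$ be a bounded extension domain for $W^{s,p}$ and let $q\in(1,\infty)\cap(\tfrac{n}{sp},\infty)$. Let $\bar B(0,1)=\{V\in L^q(\Omega)\colon\|V\|_{L^q(\Omega)}\le1\}$ and $\partial B(0,1)=\{V\in L^q(\Omega)\colon\|V\|_{L^q(\Omega)}=1\}$. Let $V^*\in\bar B(0,1)$ be the unique potential satisfying $$\lambda(V^* )=\max\{\lambda(V)\colon V\in\bar B(0,1)\}.$$ Then $V^*$ is nonnegative, $V^*\in\partial B(0,1)$, and $$\int_\Omega W(x)|u^*|^p\,dx=0\quad\text{for all }W\in T_{V^*}(\partial B(0,1)),$$ where $u^*$ is the positive eigenfunction associated to $\lambda(V^* )$ normalized by $\|u^*\|_p=1$.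
   Context: Fix $n\ge 1$, $0<s<1<p<\infty$. For an open set $\Omega\subset\mathbb{R}^n$, $W^{s,p}(\Omega)$ is the space of $u\in L^p(\Omega)$ with $[u]_{s,p;\Omega}:=\left(\iint_{\Omega\times\Omega}\frac{|u(x)-u(y)|^p}{|x-y|^{n+sp}}\,dx\,dy\right)^{1/p}<\infty$, normed by $\|u\|_{s,p;\Omega}=(\|u\|_{L^p(\Omega)}^p+[u]_{s,p;\Omega}^p)^{1/p}$. When $\Omega=\mathbb{R}^n$ the set is omitted: $[u]_{s,p}$, $\|u\|_{s,p}$, $\|u\|_p$. An open set $\Omega$ is an extension domain for $W^{s,p}$ if there is $C=C(n,s,p,\Omega)>0$ such that every $u\in W^{s,p}(\Omega)$ has an extension $\tilde u\in W^{s,p}(\mathbb{R}^n)$ with $\tilde u=u$ on $\Omega$ and $\|\tilde u\|_{s,p}\le C\|u\|_{s,p;\Omega}$. $\widetilde W^{s,p}(\Omega)$ is the space of all $u\in W^{s,p}(\Omega)$ whose extension by zero outside $\Omega$ belongs to $W^{s,p}(\mathbb{R}^n)$, normed by the $W^{s,p}(\mathbb{R}^n)$ norm of the zero extension; such $u$ are always identified with their zero extension to $\mathbb{R}^n$. For $u,v\in W^{s,p}(\mathbb{R}^n)$ put $\mathcal{H}(u,v)=\frac12\iint_{\mathbb{R}^n\times\mathbb{R}^n}\frac{|u(x)-u(y)|^{p-2}(u(x)-u(y))(v(x)-v(y))}{|x-y|^{n+sp}}\,dx\,dy$. For $V\in L^q(\Omega)$, a number $\lambda\in\mathbb{R}$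 is an eigenvalue (for the potential $V$) if there is a nontrivial $u\in\widetilde W^{s,p}(\Omega)$ (an associated eigenfunction) with $\mathcal{H}(u,v)+\int_\Omega V|u|^{p-2}uv\,dx=\lambda\int_{\mathbb{R}^n}|u|^{p-2}uv\,dx$ for all $v\in\widetilde W^{s,p}(\Omega)$. $\lambda(V)=\inf\{\frac12[u]_{s,p}^p+\int_\Omega V|u|^p\,dx\colon u\in\widetilde W^{s,p}(\Omega),\ \|u\|_p=1\}$. It is an eigenvalue and has a unique positive eigenfunction with $\|u\|_p=1$. There is exactly one maximizer of $\lambda$ on $\bar B(0,1)$. For $V\in\partial B(0,1)$, the tangent space is $T_V(\partial B(0,1))=\{W\in L^q(\Omega)\colon\int_\Omega|V|^{q-2}VW\,dx=0\}$. *)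

theory Defs
  imports "HOL-Analysis.Analysis"
begin

text \<open>
  The space \<open>\<real>\<^sup>n\<close> is an arbitrary Euclidean space \<open>'a\<close>, with \<open>n = DIM('a) \<ge> 1\<close>.
  Elements of function spaces are represented by total Lebesgue measurable functions on \<open>'a\<close>;
  for spaces over \<open>\<Omega>\<close> only the values on \<open>\<Omega>\<close> matter, and functions that agree almost
  everywhere represent the same element.
\<close>

definition Lp :: "real \<Rightarrow> 'a::euclidean_space set \<Rightarrow> ('a \<Rightarrow> real) set" where
  "Lp p \<Omega> = {u \<in> borel_measurable (lebesgue_on \<Omega>).
               integrable (lebesgue_on \<Omega>) (\<lambda>x. \<bar>u x\<bar> powr p)}"

definition Lp_norm :: "real \<Rightarrow> 'a::euclidean_space set \<Rightarrow> ('a \<Rightarrow> real) \<Rightarrow> real" where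
  "Lp_norm p \<Omega> u = (LINT x|lebesgue_on \<Omega>. \<bar>u x\<bar> powr p) powr (1 / p)"

text \<open>
  Double integrals are taken with respect to Lebesgue measure on the product space \<open>'a \<times> 'a\<close>.
  The value of the quotients on the (null) diagonal is \<open>0\<close>.
\<close>

definition gagliardo_quotient ::
    "real \<Rightarrow> real \<Rightarrow> ('a::euclidean_space \<Rightarrow> real) \<Rightarrow> 'a \<times> 'a \<Rightarrow> real" where
  "gagliardo_quotient s p u =
     (\<lambda>(x, y). \<bar>u x - u y\<bar> powr p / norm (x - y) powr (real DIM('a) + s * p))"

definition gagliardo :: "real \<Rightarrow> real \<Rightarrow> 'a::euclidean_space set \<Rightarrow> ('a \<Rightarrow> real) \<Rightarrow> real" where
  "gagliardo s p \<Omega> u =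
     (LINT z|lebesgue_on (\<Omega> \<times> \<Omega>). gagliardo_quotient s p u z) powr (1 / p)"

definition Wsp :: "real \<Rightarrow> real \<Rightarrow> 'a::euclidean_space set \<Rightarrow> ('a \<Rightarrow> real) set" where
  "Wsp s p \<Omega> = {u \<in> Lp p \<Omega>. integrable (lebesgue_on (\<Omega> \<times> \<Omega>)) (gagliardo_quotient s p u)}"

definition Wsp_norm :: "real \<Rightarrow> real \<Rightarrow> 'a::euclidean_space set \<Rightarrow> ('a \<Rightarrow> real) \<Rightarrow> real" where
  "Wsp_norm s p \<Omega> u = (Lp_norm p \<Omega> u powr p + gagliardo s p \<Omega> u powr p) powr (1 / p)"

definition extension_domain :: "real \<Rightarrow> real \<Rightarrow> 'a::euclidean_space set \<Rightarrow> bool" where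
  "extension_domain s p \<Omega> \<longleftrightarrow> open \<Omega> \<and>
     (\<exists>C>0. \<forall>u\<in>Wsp s p \<Omega>. \<exists>u'\<in>Wsp s p UNIV.
        (AE x in lebesgue_on \<Omega>. u' x = u x) \<and>
        Wsp_norm s p UNIV u' \<le> C * Wsp_norm s p \<Omega> u)"

text \<open>
  Elements of \<open>W_tilde s p \<Omega>\<close> are identified with their extensions by zero, so they are
  represented by functions on the whole space that vanish outside \<open>\<Omega>\<close>.
\<close>

definition W_tilde :: "real \<Rightarrow> real \<Rightarrow> 'a::euclidean_space set \<Rightarrow> ('a \<Rightarrow> real) set" where
  "W_tilde s p \<Omega> = {u. (\<forall>x. x \<notin> \<Omega> \<longrightarrow> u x = 0) \<and> u \<in> Wsp s p \<Omega> \<and> u \<in> Wsp s p UNIV}"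

definition energy_form ::
    "real \<Rightarrow> real \<Rightarrow> ('a::euclidean_space \<Rightarrow> real) \<Rightarrow> ('a \<Rightarrow> real) \<Rightarrow> real" where
  "energy_form s p u v = 1 / 2 *
     (LINT (x, y)|lebesgue. \<bar>u x - u y\<bar> powr (p - 2) * (u x - u y) * (v x - v y) /
        norm (x - y) powr (real DIM('a) + s * p))"

definition eigenfunction ::
    "real \<Rightarrow> real \<Rightarrow> 'a::euclidean_space set \<Rightarrow> ('a \<Rightarrow> real) \<Rightarrow> real \<Rightarrow> ('a \<Rightarrow> real) \<Rightarrow> bool" where
  "eigenfunction s p \<Omega> V l u \<longleftrightarrow>
     u \<in> W_tilde s p \<Omega> \<and> \<not> (AE x in lebesgue. u x = 0) \<and>
     (\<forall>v\<in>W_tilde s p \<Omega>.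
        energy_form s p u v + (LINT x|lebesgue_on \<Omega>. V x * \<bar>u x\<bar> powr (p - 2) * u x * v x)
        = l * (LINT x|lebesgue. \<bar>u x\<bar> powr (p - 2) * u x * v x))"

text \<open>
  For \<open>V\<close> in \<open>Lp q \<Omega>\<close> with \<open>q > 1\<close> and \<open>q > n / (s p)\<close>, the integrals below exist and the
  infimum is over a set that is bounded below, by the fractional Sobolev embedding; the set is
  nonempty if \<open>\<Omega>\<close> is open and nonempty.
\<close>

definition first_eigenvalue ::
    "real \<Rightarrow> real \<Rightarrow> 'a::euclidean_space set \<Rightarrow> ('a \<Rightarrow> real) \<Rightarrow> real" where
  "first_eigenvalue s p \<Omega> V =
     Inf {1 / 2 * gagliardo s p UNIV u powr p + (LINT x|lebesgue_on \<Omega>. V x * \<bar>u x\<bar> powr p) |u.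
            u \<in> W_tilde s p \<Omega> \<and> Lp_norm p UNIV u = 1}"

definition Lp_unit_cball :: "real \<Rightarrow> 'a::euclidean_space set \<Rightarrow> ('a \<Rightarrow> real) set" where
  "Lp_unit_cball q \<Omega> = {V \<in> Lp q \<Omega>. Lp_norm q \<Omega> V \<le> 1}"

definition Lp_unit_sphere :: "real \<Rightarrow> 'a::euclidean_space set \<Rightarrow> ('a \<Rightarrow> real) set" where
  "Lp_unit_sphere q \<Omega> = {V \<in> Lp q \<Omega>. Lp_norm q \<Omega> V = 1}"

definition sphere_tangent ::
    "real \<Rightarrow> 'a::euclidean_space set \<Rightarrow> ('a \<Rightarrow> real) \<Rightarrow> ('a \<Rightarrow> real) set" where
  "sphere_tangent q \<Omega> V =
     {W \<in> Lp q \<Omega>. (LINT x|lebesgue_on \<Omega>. \<bar>V x\<bar> powr (q - 2) * V x * W x) = 0}"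

end

theory Submission
  imports Defs
begin

text \<open>
  Write \<open>r = q / (q - 1)\<close> for the exponent conjugate to \<open>q\<close> and pass from \<open>u\<close> to the density
  \<open>w = |u|\<^sup>p\<close>.  The constraint \<open>\<parallel>u\<parallel>\<^sub>p = 1\<close> becomes \<open>\<integral> w = 1\<close>, the potential term \<open>\<integral> V w\<close> is bilinear,
  and half the Gagliardo integral, \<open>en w\<close>, is convex in \<open>w\<close> (\<open>hidden_convexity\<close>).  So the maximum of
  the first eigenvalue over the unit ball of \<open>L\<^sup>q\<close> is a max-min of \<open>J V w = en w + \<integral> V w\<close>, which is
  affine in \<open>V\<close> and convex in \<open>w\<close>, and it is solved through its dual: minimize
  \<open>Phi w = en w + \<parallel>w\<parallel>\<^sub>r\<close>, the maximum of \<open>J V w\<close> over \<open>V\<close> in the ball.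

  A minimizer \<open>w\<close> exists (\<open>Phi_minimizer_exists\<close>): convexity alone yields an almost everywhere
  convergent minimizing sequence (\<open>convex_sets_AE_convergent\<close>), Fatou's lemma gives lower
  semicontinuity, and the \<open>L\<^sup>r\<close> bound with \<open>r > 1\<close> on the bounded set \<open>\<Omega>\<close> preserves the constraint, so
  no compact embedding is needed.  The first-order condition at \<open>w\<close> says that the potential
  \<open>V\<^sub>0 = \<parallel>w\<parallel>\<^sub>r powr (1 - r) * w powr (r - 1)\<close>, which has norm \<open>1\<close>, satisfies \<open>J V\<^sub>0 z \<ge> Phi w\<close> for all
  densities \<open>z\<close> (\<open>Phi_le_J_dual_potential\<close>).  Hence a maximizer \<open>V\<^sup>*\<close> has first eigenvalue at least
  \<open>Phi w\<close>; as that eigenvalue is at most \<open>J V\<^sup>* w\<close>, there is equality in Hoelder's inequality for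
  \<open>\<integral> V\<^sup>* w \<le> \<parallel>w\<parallel>\<^sub>r\<close>, which forces \<open>V\<^sup>* = V\<^sub>0\<close> almost everywhere (\<open>maximizing_potential\<close>).  This gives the sign
  and the norm of \<open>V\<^sup>*\<close>, and \<open>V\<^sup>* powr (q - 1)\<close> is a positive multiple of \<open>w\<close>.

  Both \<open>w\<close> and the density of a positive normalized first eigenfunction \<open>u\<^sup>*\<close> minimize \<open>J V\<^sup>*\<close>.
  By the equality case of the hidden convexity at their midpoint the two are equal
  (\<open>J_minimizer_unique\<close>), so orthogonality to \<open>V\<^sup>* powr (q - 1)\<close> is orthogonality to \<open>|u\<^sup>*|\<^sup>p\<close>.

  The first eigenvalue is an infimum of real numbers, so the argument also needs that \<open>J V\<close> is
  bounded below and that there are admissible functions.  The former follows from the subcritical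
  embedding \<open>\<parallel>w\<parallel>\<^sub>r \<le> C (\<integral> w + [u]\<^sup>p)\<close>, proved by averaging over balls and bootstrapping the exponent
  (\<open>subcritical_embedding\<close>); the latter from a bump function (\<open>bump_energy_finite\<close>).
\<close>

section \<open>Hidden convexity of the Gagliardo integrand\<close>

lemma Young_equality:
  fixes p q a b :: real
  assumes "p > 1" "q > 1" "1/p + 1/q = 1" "a \<ge> 0" "b \<ge> 0"
    and eq: "a * b = a powr p / p + b powr q / q"
  shows "a powr p = b powr q"
proof (cases "a = 0 \<or> b = 0")
  case True
  moreover have "0 \<le> a powr p / p" "0 \<le> b powr q / q" using assms by auto
  ultimately have "a powr p / p = 0" "b powr q / q = 0" using eq by auto
  then show ?thesis using assms by auto
next
  case False
  then have ab: "a > 0" "b > 0" using assms by auto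
  define x where "x = a powr p"
  define y where "y = b powr q"
  define m where m: "m = x / p + y / q"
  have xy: "x > 0" "y > 0" using ab by (auto simp: x_def y_def)
  have m0: "m > 0" using xy assms by (simp add: m add_pos_pos)
  have lnm: "ln m = ln x / p + ln y / q"
    using ab eq assms(1,2) by (simp add: m x_def y_def ln_mult_pos ln_powr flip: eq)
  define X where "X = x / m"
  define Y where "Y = y / m"
  have XY: "X > 0" "Y > 0" using xy m0 by (auto simp: X_def Y_def)
  have l1: "ln X \<le> X - 1" "ln Y \<le> Y - 1" using XY ln_le_minus_one by auto
  have "ln X / p + ln Y / q = ln x / p + ln y / q - (1/p + 1/q) * ln m"
    using xy m0 by (simp add: X_def Y_def ln_div diff_divide_distrib distrib_right)
  then have s1: "ln X / p + ln Y / q = 0" using lnm assms by simp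
  have "X / p + Y / q = (x / p + y / q) / m"
      by (simp add: X_def Y_def add_divide_distrib mult.commute)
  also have "\<dots> = m / m" by (simp only: m)
  finally have "X / p + Y / q = m / m" .
  then have s2: "(X - 1) / p + (Y - 1) / q = 0"
    using m0 assms(3) by (simp add: diff_divide_distrib)
  have "ln X / p \<le> (X - 1) / p" "ln Y / q \<le> (Y - 1) / q"
    using l1 assms(1,2) by (auto intro!: divide_right_mono)
  then have "ln X / p = (X - 1) / p" "ln Y / q = (Y - 1) / q" using s1 s2 by linarith+
  then have "ln X = X - 1" "ln Y = Y - 1" using assms(1,2) by auto
  then have "X = 1" "Y = 1" using ln_eq_minus_one XY by auto
  then show ?thesis using m0 by (simp add: X_def Y_def x_def y_def)
qed

text \<open>Bernoulli's inequality is Young's inequality with second factor \<open>1\<close>; this form also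
  identifies the case of equality.\<close>

lemma Bernoulli_powr:
  fixes p t :: real
  assumes "p > 1" "t \<ge> 0"
  shows "1 + p * (t - 1) \<le> t powr p"
    and "1 + p * (t - 1) = t powr p \<Longrightarrow> t = 1"
proof -
  define q where "q = p / (p - 1)"
  have q: "q > 1" "1/p + 1/q = 1" using assms by (auto simp: q_def field_simps)
  have iq: "1 / q = 1 - 1 / p" using q by simp
  have "t * 1 \<le> t powr p / p + 1 powr q / q"
    by (rule Youngs_inequality) (use assms q in auto)
  then have "p * t \<le> p * (t powr p / p + (1 - 1/p))" using assms iq by simp
  also have "\<dots> = t powr p + p - 1" using assms by (simp add: distrib_left right_diff_distrib)
  finally show "1 + p * (t - 1) \<le> t powr p" by (simp add: algebra_simps)
  assume eq: "1 + p * (t - 1) = t powr p"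
  have "t * 1 = t powr p / p + 1 powr q / q"
    using assms by (simp add: iq flip: eq) (simp add: field_simps)
  then have "t powr p = 1 powr q" by (intro Young_equality) (use assms q in auto)
  then show "t = 1" using assms by (smt (verit) powr_one_eq_one powr_less_mono2)
qed

lemma powr_strict_convex:
  fixes p x y \<alpha> \<beta> :: real
  assumes "p > 1" "x \<ge> 0" "y \<ge> 0" "\<alpha> > 0" "\<beta> > 0" "\<alpha> + \<beta> = 1"
  shows "(\<alpha> * x + \<beta> * y) powr p \<le> \<alpha> * x powr p + \<beta> * y powr p"
    and "(\<alpha> * x + \<beta> * y) powr p = \<alpha> * x powr p + \<beta> * y powr p \<Longrightarrow> x = y"
proof -
  define m where "m = \<alpha> * x + \<beta> * y"
  have m0: "m \<ge> 0" using assms by (simp add: m_def)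
  have zero: "x = 0 \<and> y = 0" if "m = 0"
    using that assms by (smt (verit) m_def mult_nonneg_nonneg mult_eq_0_iff)
  define d where "d t = (t / m) powr p - (1 + p * (t / m - 1))" for t
  have d0: "d x \<ge> 0" "d y \<ge> 0" if "m > 0"
    using that Bernoulli_powr(1)[OF assms(1)] assms by (auto simp: d_def)
  have key: "\<alpha> * x powr p + \<beta> * y powr p - m powr p = m powr p * (\<alpha> * d x + \<beta> * d y)" if "m > 0"
  proof -
    have "\<alpha> * (x/m) + \<beta> * (y/m)
        = m / m" by (simp only: m_def add_divide_distrib times_divide_eq_right)
    then have "\<alpha> * (x/m) + \<beta> * (y/m) = 1" using that by (simp only: divide_self)
    moreover have "\<alpha> * (1 + p * (x/m - 1)) + \<beta> * (1 + p * (y/m - 1))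
       = (\<alpha> + \<beta>) + p * ((\<alpha> * (x/m) + \<beta> * (y/m)) - (\<alpha> + \<beta>))"
      by (simp add: algebra_simps)
    ultimately have "\<alpha> * d x + \<beta> * d y = \<alpha> * (x/m) powr p + \<beta> * (y/m) powr p - 1"
      unfolding d_def using assms(6) by (simp add: right_diff_distrib)
    then show ?thesis using that assms by (simp add: powr_divide field_simps)
  qed
  show "(\<alpha> * x + \<beta> * y) powr p \<le> \<alpha> * x powr p + \<beta> * y powr p"
  proof (cases "m = 0")
    case True then show ?thesis using zero by simp
  next
    case False
    then have "m > 0" using m0 by simp
    have "m powr p * (\<alpha> * d x + \<beta> * d y) \<ge> 0"
      using d0[OF \<open>m > 0\<close>] assms by (auto intro!: mult_nonneg_nonneg add_nonneg_nonneg)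
    then show ?thesis using key[OF \<open>m > 0\<close>] by (simp add: m_def)
  qed
  assume eq: "(\<alpha> * x + \<beta> * y) powr p = \<alpha> * x powr p + \<beta> * y powr p"
  show "x = y"
  proof (cases "m = 0")
    case True then show ?thesis using zero by simp
  next
    case False
    then have mp: "m > 0" using m0 by simp
    have "\<alpha> * d x + \<beta> * d y = 0" using key[OF mp] eq mp
      by (smt (verit) m_def mult_eq_0_iff powr_gt_zero)
    moreover have "\<alpha> * d x \<ge> 0" "\<beta> * d y \<ge> 0" using d0[OF mp] assms by auto
    ultimately have "\<alpha> * d x = 0" "\<beta> * d y = 0" by linarith+
    then have "d x = 0" "d y = 0" using assms by auto
    then have "x / m = 1" "y / m = 1"
      using Bernoulli_powr(2)[OF assms(1), of "x/m"] Bernoulli_powr(2)[OF assms(1), of "y/m"]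
          assms mp
      by (auto simp: d_def)
    then show ?thesis using mp by simp
  qed
qed

text \<open>The \<open>\<ell>\<^sup>p\<close> norm of \<open>(x, y)\<close> on the two-point space with masses \<open>\<alpha>\<close> and \<open>\<beta>\<close>,
  for \<open>x, y \<ge> 0\<close>.\<close>

definition lp_mean :: "real \<Rightarrow> real \<Rightarrow> real \<Rightarrow> real \<Rightarrow> real \<Rightarrow> real" where
  "lp_mean p \<alpha> \<beta> x y = (\<alpha> * x powr p + \<beta> * y powr p) powr (1 / p)"

lemma lp_mean_nonneg: "lp_mean p \<alpha> \<beta> x y \<ge> 0"
  by (simp add: lp_mean_def)

lemma lp_mean_powr:
  assumes "p > 1" "\<alpha> \<ge> 0" "\<beta> \<ge> 0"
  shows "lp_mean p \<alpha> \<beta> x y powr p = \<alpha> * x powr p + \<beta> * y powr p"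
  using assms by (simp add: lp_mean_def powr_powr)

lemma lp_mean_eq_0:
  assumes "p > 1" "\<alpha> > 0" "\<beta> > 0" "x \<ge> 0" "y \<ge> 0" "lp_mean p \<alpha> \<beta> x y = 0"
  shows "x = 0" "y = 0"
proof -
  have "\<alpha> * x powr p + \<beta> * y powr p = 0"
    using assms lp_mean_powr[of p \<alpha> \<beta> x y] by simp
  moreover have "\<alpha> * x powr p \<ge> 0" "\<beta> * y powr p \<ge> 0" using assms by auto
  ultimately have "\<alpha> * x powr p = 0" "\<beta> * y powr p = 0" by linarith+
  then show "x = 0" "y = 0" using assms by auto
qed

text \<open>Minkowski's inequality: \<open>(x + x') / (P + Q)\<close> is a convex combination of \<open>x / P\<close> and
  \<open>x' / Q\<close>, where \<open>P\<close> and \<open>Q\<close> are the two norms.\<close>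

lemma lp_mean_Minkowski:
  fixes p \<alpha> \<beta> x y x' y' :: real
  assumes p: "p > 1" and w: "\<alpha> > 0" "\<beta> > 0" "\<alpha> + \<beta> = 1"
    and nn: "x \<ge> 0" "y \<ge> 0" "x' \<ge> 0" "y' \<ge> 0"
  shows "lp_mean p \<alpha> \<beta> (x + x') (y + y') \<le> lp_mean p \<alpha> \<beta> x y + lp_mean p \<alpha> \<beta> x' y'"
    and "lp_mean p \<alpha> \<beta> (x + x') (y + y') = lp_mean p \<alpha> \<beta> x y + lp_mean p \<alpha> \<beta> x' y'
          \<Longrightarrow> x * y' = y * x'"
proof -
  define P Q where "P = lp_mean p \<alpha> \<beta> x y" and "Q = lp_mean p \<alpha> \<beta> x' y'"
  define R where "R = lp_mean p \<alpha> \<beta> (x + x') (y + y')"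
  have "R \<le> P + Q \<and> (R = P + Q \<longrightarrow> x * y' = y * x')"
  proof (cases "P = 0 \<or> Q = 0")
    case True
    then show ?thesis
      using lp_mean_eq_0[OF p w(1,2) nn(1,2)] lp_mean_eq_0[OF p w(1,2) nn(3,4)]
        lp_mean_nonneg[of p \<alpha> \<beta>]
      unfolding P_def Q_def R_def by (auto simp: add_nonneg_nonneg)
  next
    case False
    then have PQ: "P > 0" "Q > 0"
      using lp_mean_nonneg[of p \<alpha> \<beta>] unfolding P_def Q_def by (smt (verit))+
    define a b where "a = P / (P + Q)" and "b = Q / (P + Q)"
    have ab: "a > 0" "b > 0" "a + b = 1"
      using PQ by (auto simp: a_def b_def simp flip: add_divide_distrib)
    have id: "z + z' = (P + Q) * (a * (z/P) + b * (z'/Q))" for z z'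
      proof -
      have "(P + Q) * (a * (z/P)) = z" "(P + Q) * (b * (z'/Q)) = z'"
        using PQ by (auto simp: a_def b_def)
      then show ?thesis by (simp add: distrib_left)
    qed
    have cx: "(z + z') powr p \<le> (P+Q) powr p * (a * (z/P) powr p + b * (z'/Q) powr p)"
      and cxe: "(z + z') powr p = (P+Q) powr p * (a * (z/P) powr p + b * (z'/Q) powr p)
        \<Longrightarrow> z / P = z' / Q"
      if "z \<ge> 0" "z' \<ge> 0" for z z'
    proof -
      have e: "(z + z') powr p = (P+Q) powr p * (a * (z/P) + b * (z'/Q)) powr p"
        using PQ ab that by (subst id) (rule powr_mult)
      show "(z + z') powr p \<le> (P+Q) powr p * (a * (z/P) powr p + b * (z'/Q) powr p)"
        unfolding e by (intro mult_left_mono powr_strict_convex(1)) (use p ab that PQ in auto)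
      assume "(z + z') powr p = (P+Q) powr p * (a * (z/P) powr p + b * (z'/Q) powr p)"
      then show "z / P = z' / Q" unfolding e
        using powr_strict_convex(2)[OF p, of "z/P" "z'/Q" a b] ab that PQ by auto
    qed
    have tot: "\<alpha> * ((P+Q) powr p * (a * (x/P) powr p + b * (x'/Q) powr p))
         + \<beta> * ((P+Q) powr p * (a * (y/P) powr p + b * (y'/Q) powr p)) = (P+Q) powr p"
    proof -
      have "\<alpha> * (x/P) powr p + \<beta> * (y/P) powr p = (\<alpha> * x powr p + \<beta> * y powr p) / P powr p"
        using nn PQ by (simp add: powr_divide add_divide_distrib)
      then have 1: "\<alpha> * (x/P) powr p + \<beta> * (y/P) powr p = 1"
        using lp_mean_powr[OF p, of \<alpha> \<beta> x y] w PQ by (smt (verit) P_def divide_self powr_gt_zero)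
      have "\<alpha> * (x'/Q) powr p + \<beta> * (y'/Q) powr p = (\<alpha> * x' powr p + \<beta> * y' powr p) / Q powr p"
        using nn PQ by (simp add: powr_divide add_divide_distrib)
      then have 2: "\<alpha> * (x'/Q) powr p + \<beta> * (y'/Q) powr p = 1"
        using lp_mean_powr[OF p, of \<alpha> \<beta> x' y'] w PQ by (smt (verit) Q_def divide_self powr_gt_zero)
      have "\<alpha> * ((P+Q) powr p * (a * (x/P) powr p + b * (x'/Q) powr p))
         + \<beta> * ((P+Q) powr p * (a * (y/P) powr p + b * (y'/Q) powr p))
        = (P+Q) powr p * (a * (\<alpha> * (x/P) powr p + \<beta> * (y/P) powr p)
            + b * (\<alpha> * (x'/Q) powr p + \<beta> * (y'/Q) powr p))"
        by (simp add: algebra_simps)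
      then show ?thesis using 1 2 ab by simp
    qed
    have Rp: "R powr p = \<alpha> * (x + x') powr p + \<beta> * (y + y') powr p"
      unfolding R_def using lp_mean_powr p w by auto
    have i: "\<alpha> * (x + x') powr p \<le> \<alpha> * ((P+Q) powr p * (a * (x/P) powr p + b * (x'/Q) powr p))"
      "\<beta> * (y + y') powr p \<le> \<beta> * ((P+Q) powr p * (a * (y/P) powr p + b * (y'/Q) powr p))"
      using cx nn w by (auto intro!: mult_left_mono)
    then have "R powr p \<le> (P+Q) powr p" using Rp tot by linarith
    then have "R \<le> P + Q"
      using p PQ by (smt (verit) powr_less_mono2)
    moreover have "x * y' = y * x'" if "R = P + Q"
    proof -
      have "\<alpha> * (x + x') powr p = \<alpha> * ((P+Q) powr p * (a * (x/P) powr p + b * (x'/Q) powr p))"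
        "\<beta> * (y + y') powr p = \<beta> * ((P+Q) powr p * (a * (y/P) powr p + b * (y'/Q) powr p))"
        using i tot Rp that by (smt (verit))+
      then have "x / P = x' / Q" "y / P = y' / Q" using cxe nn w by auto
      then have "x = P * x' / Q" "y = P * y' / Q" using PQ by (auto simp: field_simps)
      then show ?thesis by simp
    qed
    ultimately show ?thesis by blast
  qed
  then show "lp_mean p \<alpha> \<beta> (x + x') (y + y') \<le> lp_mean p \<alpha> \<beta> x y + lp_mean p \<alpha> \<beta> x' y'"
    "lp_mean p \<alpha> \<beta> (x + x') (y + y') = lp_mean p \<alpha> \<beta> x y + lp_mean p \<alpha> \<beta> x' y'
          \<Longrightarrow> x * y' = y * x'"
    unfolding P_def Q_def R_def by auto
qed

lemma lp_mean_mono: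
  assumes p: "p > 1" and w: "\<alpha> > 0" "\<beta> > 0"
    and "0 \<le> x" "x \<le> x'" "0 \<le> y" "y \<le> y'"
  shows "lp_mean p \<alpha> \<beta> x y \<le> lp_mean p \<alpha> \<beta> x' y'"
    and "lp_mean p \<alpha> \<beta> x y = lp_mean p \<alpha> \<beta> x' y' \<Longrightarrow> x = x' \<and> y = y'"
proof -
  have "x powr p \<le> x' powr p" "y powr p \<le> y' powr p" using assms by (auto intro!: powr_mono2)
  then have m': "\<alpha> * x powr p \<le> \<alpha> * x' powr p" "\<beta> * y powr p \<le> \<beta> * y' powr p" using w by auto
  then show "lp_mean p \<alpha> \<beta> x y \<le> lp_mean p \<alpha> \<beta> x' y'"
    unfolding lp_mean_def using p w add_mono[OF m'] by (intro powr_mono2) auto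
  assume "lp_mean p \<alpha> \<beta> x y = lp_mean p \<alpha> \<beta> x' y'"
  then have "lp_mean p \<alpha> \<beta> x y powr p = lp_mean p \<alpha> \<beta> x' y' powr p" by simp
  then have "\<alpha> * x powr p + \<beta> * y powr p = \<alpha> * x' powr p + \<beta> * y' powr p"
    using lp_mean_powr[OF p] w by (simp add: less_imp_le)
  then have "\<alpha> * x powr p = \<alpha> * x' powr p" "\<beta> * y powr p = \<beta> * y' powr p" using m' by linarith+
  then have "x powr p = x' powr p" "y powr p = y' powr p" using w by auto
  then show "x = x' \<and> y = y'" using assms by (smt (verit) powr_less_mono2)
qed

text \<open>Hidden convexity: along the path \<open>(\<alpha> * u powr p + \<beta> * v powr p) powr (1 / p)\<close> the integrand of
  the Gagliardo seminorm is convex.  This is the reverse triangle inequality for the \<open>\<ell>\<^sup>p\<close> norms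
  of \<open>(a, c)\<close> and \<open>(b, d)\<close>, combined with the monotonicity of that norm, and equality forces
  these two vectors to be parallel.\<close>

lemma hidden_convexity:
  fixes p \<alpha> \<beta> a b c d :: real
  assumes p: "p > 1" and w: "\<alpha> > 0" "\<beta> > 0" "\<alpha> + \<beta> = 1"
    and nn: "a \<ge> 0" "b \<ge> 0" "c \<ge> 0" "d \<ge> 0"
  shows "\<bar>lp_mean p \<alpha> \<beta> a c - lp_mean p \<alpha> \<beta> b d\<bar> powr p
           \<le> \<alpha> * \<bar>a - b\<bar> powr p + \<beta> * \<bar>c - d\<bar> powr p"
    and "\<bar>lp_mean p \<alpha> \<beta> a c - lp_mean p \<alpha> \<beta> b d\<bar> powr p
           = \<alpha> * \<bar>a - b\<bar> powr p + \<beta> * \<bar>c - d\<bar> powr p \<Longrightarrow> a * d = b * c"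
proof -
  let ?F = "lp_mean p \<alpha> \<beta>"
  have main: "\<bar>?F a c - ?F b d\<bar> powr p \<le> \<alpha> * \<bar>a - b\<bar> powr p + \<beta> * \<bar>c - d\<bar> powr p \<and>
     (\<bar>?F a c - ?F b d\<bar> powr p = \<alpha> * \<bar>a - b\<bar> powr p + \<beta> * \<bar>c - d\<bar> powr p \<longrightarrow> a * d = b * c)"
    if nn: "a \<ge> 0" "b \<ge> 0" "c \<ge> 0" "d \<ge> 0" and ge: "?F b d \<le> ?F a c" for a b c d
  proof -
    let ?x = "\<bar>a - b\<bar>" and ?y = "\<bar>c - d\<bar>"
    have 1: "?F a c \<le> ?F (b + ?x) (d + ?y)"
      and 1: "?F a c = ?F (b + ?x) (d + ?y) \<Longrightarrow> a = b + ?x \<and> c = d + ?y"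
      using lp_mean_mono[OF p w(1,2), of a "b + ?x" c "d + ?y"] nn by auto
    have 2: "?F (b + ?x) (d + ?y) \<le> ?F b d + ?F ?x ?y"
      and 2: "?F (b + ?x) (d + ?y) = ?F b d + ?F ?x ?y \<Longrightarrow> b * ?y = d * ?x"
      using lp_mean_Minkowski[OF p w, of b d ?x ?y] nn by auto
    have le: "\<bar>?F a c - ?F b d\<bar> \<le> ?F ?x ?y" using \<open>?F a c \<le> _\<close> \<open>?F (b + ?x) (d + ?y) \<le> _\<close> ge by simp
    have Fp: "?F ?x ?y powr p = \<alpha> * ?x powr p + \<beta> * ?y powr p" using lp_mean_powr p w by auto
    have "\<bar>?F a c - ?F b d\<bar> powr p \<le> ?F ?x ?y powr p"
      using le p by (intro powr_mono2) auto
    moreover have "a * d = b * c" if "\<bar>?F a c - ?F b d\<bar> powr p = ?F ?x ?y powr p"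
    proof -
      have "\<bar>?F a c - ?F b d\<bar> = ?F ?x ?y"
        using that le p lp_mean_nonneg by (smt (verit) powr_less_mono2)
      then have "?F a c = ?F (b + ?x) (d + ?y)" "?F (b + ?x) (d + ?y) = ?F b d + ?F ?x ?y"
        using \<open>?F a c \<le> _\<close> \<open>?F (b + ?x) (d + ?y) \<le> _\<close> ge by linarith+
      then have "a = b + ?x \<and> c = d + ?y" "b * ?y = d * ?x" using 1 2 by auto
      then have "b * (c - d) = d * (a - b)" by auto
      then show ?thesis by (simp add: algebra_simps)
    qed
    ultimately show ?thesis unfolding Fp by blast
  qed
  have "\<bar>?F a c - ?F b d\<bar> powr p \<le> \<alpha> * \<bar>a - b\<bar> powr p + \<beta> * \<bar>c - d\<bar> powr p \<and>
     (\<bar>?F a c - ?F b d\<bar> powr p = \<alpha> * \<bar>a - b\<bar> powr p + \<beta> * \<bar>c - d\<bar> powr p \<longrightarrow> a * d = b * c)"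
  proof (cases "?F b d \<le> ?F a c")
    case True then show ?thesis using main nn by blast
  next
    case False
    then show ?thesis using main[of b a d c] nn by (auto simp: abs_minus_commute)
  qed
  then show "\<bar>?F a c - ?F b d\<bar> powr p \<le> \<alpha> * \<bar>a - b\<bar> powr p + \<beta> * \<bar>c - d\<bar> powr p"
    "\<bar>?F a c - ?F b d\<bar> powr p = \<alpha> * \<bar>a - b\<bar> powr p + \<beta> * \<bar>c - d\<bar> powr p \<Longrightarrow> a * d = b * c"
    by auto
qed

section \<open>The subcritical fractional Sobolev embedding\<close>

text \<open>The Borel functions \<open>u\<close> on the whole space whose \<open>p\<close>-th power integral
  \<open>\<integral> |u|\<^sup>p\<close> and whose Gagliardo double integral are both at most \<open>T\<close>.\<close>

definition energy_ball :: "real \<Rightarrow> real \<Rightarrow> real \<Rightarrow> ('a::euclidean_space \<Rightarrow> real) set" where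
  "energy_ball s p T = {u \<in> borel_measurable borel.
     (\<integral>\<^sup>+x. ennreal (\<bar>u x\<bar> powr p) \<partial>lborel) \<le> ennreal T \<and>
     (\<integral>\<^sup>+x. \<integral>\<^sup>+y. ennreal (gagliardo_quotient s p u (x, y)) \<partial>lborel \<partial>lborel) \<le> ennreal T}"

lemma borel_measurable_gagliardo_quotient [measurable]:
  assumes [measurable]: "u \<in> borel_measurable borel"
  shows "gagliardo_quotient s p u \<in> borel_measurable (borel \<Otimes>\<^sub>M borel)"
  unfolding gagliardo_quotient_def by measurable

lemma gagliardo_quotient_nonneg: "gagliardo_quotient s p u z \<ge> 0"
  by (cases z) (simp add: gagliardo_quotient_def)

lemma le_add_powr_scaled:
  fixes w l r :: real
  assumes "w \<ge> 0" "l > 0" "r \<ge> 1"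
  shows "w \<le> l + l powr (1 - r) * w powr r"
proof (cases "w \<le> l")
  case True
  have "l powr (1 - r) * w powr r \<ge> 0" by simp
  then show ?thesis using True by linarith
next
  case False
  then have "l powr (r - 1) \<le> w powr (r - 1)" using assms by (intro powr_mono2) auto
  then have "l powr (1 - r) * (l powr (r - 1) * w) \<le> l powr (1 - r) * (w powr (r - 1) * w)"
    using assms by (intro mult_left_mono mult_right_mono) auto
  moreover have "l powr (1 - r) * (l powr (r - 1) * w) = w"
    using assms False by (simp flip: mult.assoc powr_add)
  moreover have "w powr (r - 1) * w = w powr r"
    using assms False powr_mult_base[of w "r - 1"] by (simp add: mult.commute)
  ultimately show ?thesis using assms by simp
qed

lemma abs_powr_le_split:
  fixes a b p :: real
  assumes "p > 0"
  shows "\<bar>a\<bar> powr p \<le> 2 powr p * (\<bar>a - b\<bar> powr p + \<bar>b\<bar> powr p)"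
proof -
  define M where "M = max \<bar>a - b\<bar> \<bar>b\<bar>"
  have "\<bar>a - b\<bar> \<le> M" "\<bar>b\<bar> \<le> M" by (auto simp: M_def)
  then have "\<bar>a\<bar> \<le> 2 * M" by linarith
  then have "\<bar>a\<bar> powr p \<le> (2 * M) powr p" using assms by (intro powr_mono2) auto
  also have "\<dots> = 2 powr p * M powr p" by (simp add: powr_mult)
  also have "\<dots> \<le> 2 powr p * (\<bar>a - b\<bar> powr p + \<bar>b\<bar> powr p)"
    by (intro mult_left_mono) (auto simp: M_def max_def)
  finally show ?thesis .
qed

text \<open>Here \<open>S\<close> bounds \<open>\<integral> w\<^sup>r\<close> for \<open>w = |u|\<^sup>p\<close>.  Averaging \<open>w x \<le> 2\<^sup>p (|u x - u y|\<^sup>p + w y)\<close>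
  over \<open>y\<close> in a ball of radius \<open>h\<close> bounds \<open>w x\<close> by a multiple of \<open>h powr (s * p)\<close> times the partial
  Gagliardo integral at \<open>x\<close>, plus a multiple of the mean of \<open>w\<close> over the ball, which is small
  if \<open>h\<close> is large.  Choosing \<open>h\<close> in terms of \<open>w x\<close> gives the claim.\<close>

lemma embedding_pointwise:
  fixes u :: "'a::euclidean_space \<Rightarrow> real" and s p r S :: real
  defines "n \<equiv> real DIM('a)"
  defines "c1 \<equiv> 2 powr p * (2 powr (- p - 2)) powr (1 - r)" and "\<omega> \<equiv> unit_ball_vol (real DIM('a))"
  assumes u [measurable]: "u \<in> borel_measurable borel"
    and "0 < s" "1 < p" "1 \<le> r" "S > 0"
    and S: "(\<integral>\<^sup>+y. ennreal (\<bar>u y\<bar> powr (p * r)) \<partial>lborel) \<le> ennreal S"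
  shows "ennreal ((\<bar>u x\<bar> powr p) powr (1 + r * (s * p / n)))
    \<le> ennreal (2 powr (p + 1) / \<omega> * (4 * c1 / \<omega>) powr (s * p / n) * S powr (s * p / n))
       * (\<integral>\<^sup>+y. ennreal (gagliardo_quotient s p u (x, y)) \<partial>lborel)"
    (is "_ \<le> ennreal ?K * ?g")
proof -
  define w where "w = \<bar>u x\<bar> powr p"
  have n0: "n > 0" by (simp add: n_def)
  have om: "\<omega> > 0" by (simp add: \<omega>_def)
  have c1: "c1 > 0" by (simp add: c1_def)
  have K0: "?K > 0" using om c1 \<open>S > 0\<close> by simp
  consider "w = 0" | "?g = \<infinity>" | "w > 0" "?g < \<infinity>"
    by (metis infinity_ennreal_def less_top order_le_less powr_ge_zero w_def)
  then show ?thesis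
  proof cases
    case 1 then show ?thesis by (simp add: w_def)
  next
    case 2
    then show ?thesis using om c1 \<open>S > 0\<close> by (simp add: ennreal_mult_top)
  next
    case 3
    define G where "G = enn2real ?g"
    have G: "?g = ennreal G" "G \<ge> 0" using 3 by (auto simp: G_def)
    \<comment> \<open>The radius \<open>h\<close> is chosen so that the last of the three terms below equals \<open>w V / 4\<close>.\<close>
    define V where "V = 4 * c1 * w powr (- r) * S"
    define h where "h = (V / \<omega>) powr (1 / n)"
    \<comment> \<open>With this threshold the middle term equals \<open>w V / 4\<close> as well.\<close>
    define l where "l = 2 powr (- p - 2) * w"
    have V0: "V > 0" using c1 3 \<open>S > 0\<close> by (simp add: V_def)
    have h0: "h > 0" using V0 om by (simp add: h_def)
    have l0: "l > 0" using 3 by (simp add: l_def)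
    have "h ^ DIM('a) = h powr n" using h0 by (simp add: n_def powr_realpow)
    also have "\<dots> = V / \<omega>" using V0 om n0 by (simp add: h_def powr_powr)
    finally have hn: "h ^ DIM('a) = V / \<omega>" .
    have emB: "emeasure lborel (ball x h) = ennreal V"
      using h0 hn om by (simp add: emeasure_ball flip: \<omega>_def)
    let ?B = "ball x h"
    have pt: "ennreal w * indicator ?B y
        \<le> ennreal (2 powr p * h powr (n + s * p)) * ennreal (gagliardo_quotient s p u (x, y))
         + ennreal (2 powr p * l) * indicator ?B y
         + ennreal (2 powr p * l powr (1 - r)) * ennreal (\<bar>u y\<bar> powr (p * r))" for y
    proof (cases "y \<in> ?B")
      case True
      have "\<bar>u x - u y\<bar> powr p \<le> h powr (n + s * p) * gagliardo_quotient s p u (x, y)"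
      proof (cases "y = x")
        case True then show ?thesis by (simp add: gagliardo_quotient_def)
      next
        case False
        have "norm (x - y) powr (n + s * p) \<le> h powr (n + s * p)"
          using \<open>y \<in> ?B\<close> n0 assms by (intro powr_mono2) (auto simp: dist_norm)
        then have "\<bar>u x - u y\<bar> powr p * (norm (x - y) powr (n + s * p))
            \<le> \<bar>u x - u y\<bar> powr p * h powr (n + s * p)"
          by (intro mult_left_mono) auto
        then show ?thesis using False unfolding gagliardo_quotient_def n_def
          by (simp add: field_simps)
      qed
      moreover have "\<bar>u y\<bar> powr p \<le> l + l powr (1 - r) * \<bar>u y\<bar> powr (p * r)"
        using le_add_powr_scaled[of "\<bar>u y\<bar> powr p" l r] l0 assms by (simp add: powr_powr)
      ultimately have "2 powr p * (\<bar>u x - u y\<bar> powr p + \<bar>u y\<bar> powr p)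
          \<le> 2 powr p * (h powr (n + s * p) * gagliardo_quotient s p u (x, y)
              + (l + l powr (1 - r) * \<bar>u y\<bar> powr (p * r)))"
        by (intro mult_left_mono add_mono) auto
      then have "w \<le> 2 powr p * h powr (n + s * p) * gagliardo_quotient s p u (x, y)
           + 2 powr p * l + 2 powr p * l powr (1 - r) * \<bar>u y\<bar> powr (p * r)"
        using abs_powr_le_split[of p "u x" "u y"] assms by (simp add: w_def algebra_simps)
      then show ?thesis using True l0
        by (simp add: gagliardo_quotient_nonneg flip: ennreal_mult ennreal_plus)
    qed auto
    have "ennreal (w * V) = (\<integral>\<^sup>+y. ennreal w * indicator ?B y \<partial>lborel)"
      using 3 V0 by (simp add: nn_integral_cmult_indicator emB ennreal_mult)
    also have "\<dots>
        \<le> (\<integral>\<^sup>+y. ennreal (2 powr p * h powr (n + s * p)) * ennreal (gagliardo_quotient s p u (x, y))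
         + ennreal (2 powr p * l) * indicator ?B y
         + ennreal (2 powr p * l powr (1 - r)) * ennreal (\<bar>u y\<bar> powr (p * r)) \<partial>lborel)"
      by (intro nn_integral_mono pt)
    also have "\<dots> = ennreal (2 powr p * h powr (n + s * p)) * ?g
         + ennreal (2 powr p * l) * emeasure lborel ?B
         + ennreal (2 powr p * l powr (1 - r)) * (\<integral>\<^sup>+y. ennreal (\<bar>u y\<bar> powr (p * r)) \<partial>lborel)"
    proof -
      have [measurable]: "(\<lambda>y. ennreal (gagliardo_quotient s p u (x, y))) \<in> borel_measurable borel"
        by measurable
      have m: "(\<integral>\<^sup>+y. a * f y + b * indicator ?B y + c * g y \<partial>lborel)
        = a * (\<integral>\<^sup>+y. f y \<partial>lborel) + b * emeasure lborel ?B + c * (\<integral>\<^sup>+y. g y \<partial>lborel)"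
        if "f \<in> borel_measurable borel" "g \<in> borel_measurable borel"
        for a b c :: ennreal and f g :: "'a \<Rightarrow> ennreal"
      proof -
        note that [measurable]
        have [measurable]: "?B \<in> sets borel" by simp
        have "(\<integral>\<^sup>+y. a * f y + b * indicator ?B y + c * g y \<partial>lborel)
            = (\<integral>\<^sup>+y. a * f y + b * indicator ?B y \<partial>lborel) + (\<integral>\<^sup>+y. c * g y \<partial>lborel)"
          by (rule nn_integral_add) measurable
        also have "(\<integral>\<^sup>+y. a * f y + b * indicator ?B y \<partial>lborel)
            = (\<integral>\<^sup>+y. a * f y \<partial>lborel) + (\<integral>\<^sup>+y. b * indicator ?B y \<partial>lborel)"
          by (rule nn_integral_add) measurable
        also have "(\<integral>\<^sup>+y. a * f y \<partial>lborel) = a * (\<integral>\<^sup>+y. f y \<partial>lborel)"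
          by (rule nn_integral_cmult) measurable
        also have "(\<integral>\<^sup>+y. c * g y \<partial>lborel) = c * (\<integral>\<^sup>+y. g y \<partial>lborel)"
          by (rule nn_integral_cmult) measurable
        also have "(\<integral>\<^sup>+y. b * indicator ?B y \<partial>lborel) = b * emeasure lborel ?B"
          by (rule nn_integral_cmult_indicator) simp
        finally show ?thesis .
      qed
      show ?thesis by (rule m) measurable
    qed
    also have "\<dots> \<le> ennreal (2 powr p * h powr (n + s * p)) * ennreal G
         + ennreal (2 powr p * l) * ennreal V + ennreal (2 powr p * l powr (1 - r)) * ennreal S"
      unfolding G emB by (intro add_mono mult_left_mono S) auto
    also have "\<dots> = ennreal (2 powr p * h powr (n + s * p) * G + 2 powr p * l * V
        + 2 powr p * l powr (1 - r) * S)"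
      using G l0 V0 \<open>S > 0\<close> by (simp add: ennreal_mult ennreal_plus)
    finally have "w * V
        \<le> 2 powr p * h powr (n + s * p) * G + 2 powr p * l * V + 2 powr p * l powr (1 - r) * S"
      using G l0 V0 \<open>S > 0\<close> by (subst (asm) ennreal_le_iff) (auto intro!: add_nonneg_nonneg)
    moreover have "2 powr p * l * V = w * V / 4"
    proof -
      have "2 powr p * 2 powr (- p - 2)
          = (1/4::real)" by (simp flip: powr_add add: powr_minus divide_simps)
      then show ?thesis by (simp add: l_def)
    qed
    moreover have "2 powr p * l powr (1 - r) * S = w * V / 4"
    proof -
      have "w * w powr (- r) = w powr (1 - r)" using 3 powr_mult_base[of w "-r"] by simp
      then show ?thesis by (simp add: l_def V_def c1_def powr_mult mult_ac)
    qed
    ultimately have "w * V / 2 \<le> 2 powr p * h powr (n + s * p) * G" by linarith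
    also have "\<dots> = 2 powr p * (V / \<omega>) * h powr (s * p) * G"
      using h0 hn by (simp add: powr_add n_def powr_realpow)
    finally have "V * w \<le> V * (2 powr (p + 1) / \<omega> * h powr (s * p) * G)"
      by (simp add: powr_add field_simps)
    then have w1: "w \<le> 2 powr (p + 1) / \<omega> * h powr (s * p) * G"
      using mult_le_cancel_left_pos[OF V0] by blast
    have "h powr (s * p) = (V / \<omega>) powr (s * p / n)" by (simp add: h_def powr_powr)
    also have "\<dots> = ((4 * c1 / \<omega>) * S * w powr (- r)) powr (s * p / n)"
      by (simp add: V_def mult_ac)
    also have "\<dots>
        = (4 * c1 / \<omega>) powr (s * p / n) * S powr (s * p / n) * w powr (- (r * (s * p / n)))"
      by (simp only: powr_mult powr_powr mult_minus_left)
    finally have hsp: "h powr (s * p)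
        = (4 * c1 / \<omega>) powr (s * p / n) * S powr (s * p / n) * w powr (- (r * (s * p / n)))" .
    have "w powr (1 + r * (s * p / n)) = w * w powr (r * (s * p / n))"
      using 3 by (simp add: powr_add)
    also have "\<dots> \<le> (2 powr (p + 1) / \<omega> * h powr (s * p) * G) * w powr (r * (s * p / n))"
      using w1 by (intro mult_right_mono) auto
    also have "\<dots> = ?K * G * (w powr (- (r * (s * p / n))) * w powr (r * (s * p / n)))"
      unfolding hsp by (simp only: mult_ac)
    also have "\<dots> = ?K * G" using 3 by (simp flip: powr_add)
    finally have "w powr (1 + r * (s * p / n)) \<le> ?K * G" .
    then have "ennreal (w powr (1 + r * (s * p / n))) \<le> ennreal (?K * G)" by (rule ennreal_leI)
    also have "\<dots> = ennreal ?K * ?g" unfolding G(1) using K0 G(2) by (intro ennreal_mult) auto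
    finally show ?thesis by (simp only: w_def)
  qed
qed

text \<open>A bound for the integral of \<open>|u| powr (p * r)\<close> improves itself: the exponent \<open>r\<close> can be replaced
  by \<open>1 + r * (s * p / n)\<close>, where \<open>n\<close> is the dimension.  The fixed point of this map is
  \<open>n / (n - s * p)\<close>, the critical value, if \<open>s * p < n\<close>; otherwise the iterates are unbounded.\<close>

lemma embedding_step:
  fixes s p r :: real
  assumes sp: "0 < s" "1 < p" "1 \<le> r"
    and IH: "\<exists>C>0. \<forall>T>0. \<forall>u\<in>(energy_ball s p T :: ('a::euclidean_space \<Rightarrow> real) set). (\<integral>\<^sup>+x.
        ennreal (\<bar>u x\<bar> powr (p * r)) \<partial>lborel) \<le> ennreal (C * T powr r)"
  shows "\<exists>C>0. \<forall>T>0. \<forall>u\<in>(energy_ball s p T :: ('a \<Rightarrow> real) set). (\<integral>\<^sup>+x. ennreal (\<bar>u x\<bar> powr (p * (1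
      + r * (s * p / real DIM('a))))) \<partial>lborel)
     \<le> ennreal (C * T powr (1 + r * (s * p / real DIM('a))))"
proof -
  define a where "a = s * p / real DIM('a)"
  define \<omega> where "\<omega> = unit_ball_vol (real DIM('a))"
  define c1 where "c1 = 2 powr p * (2 powr (- p - 2)) powr (1 - r)"
  define K where "K = 2 powr (p + 1) / \<omega> * (4 * c1 / \<omega>) powr a"
  have "\<omega> > 0" "c1 > 0" by (auto simp: \<omega>_def c1_def)
  then have K0: "K > 0" by (simp add: K_def)
  obtain C where C: "C > 0" "\<And>T u. T > 0 \<Longrightarrow> u \<in> (energy_ball s p T :: ('a \<Rightarrow> real) set) \<Longrightarrow>
      (\<integral>\<^sup>+x. ennreal (\<bar>u x\<bar> powr (p * r)) \<partial>lborel) \<le> ennreal (C * T powr r)"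
    using IH by auto
  show ?thesis
  proof (intro exI[of _ "K * C powr a"] conjI allI impI ballI)
    show "K * C powr a > 0" using K0 C by simp
    fix T :: real and u :: "'a \<Rightarrow> real" assume T: "T > 0" and u: "u \<in> energy_ball s p T"
    define S where "S = C * T powr r"
    have S0: "S > 0" using T C by (simp add: S_def)
    have um [measurable]: "u \<in> borel_measurable borel" using u by (simp add: energy_ball_def)
    have "(\<integral>\<^sup>+x. ennreal (\<bar>u x\<bar> powr (p * (1 + r * a))) \<partial>lborel)
       = (\<integral>\<^sup>+x. ennreal ((\<bar>u x\<bar> powr p) powr (1 + r * a)) \<partial>lborel)"
      by (simp add: powr_powr)
    also have "\<dots>
        \<le> (\<integral>\<^sup>+x. ennreal (K * S powr a) * (\<integral>\<^sup>+y. ennreal (gagliardo_quotient s p u (x, y))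
        \<partial>lborel) \<partial>lborel)"
      using embedding_pointwise[OF um sp S0 C(2)[OF T u, folded S_def]]
      unfolding K_def a_def \<omega>_def c1_def by (intro nn_integral_mono) simp
    also have "\<dots>
        = ennreal (K * S powr a) * (\<integral>\<^sup>+x. (\<integral>\<^sup>+y. ennreal (gagliardo_quotient s p u (x, y))
        \<partial>lborel) \<partial>lborel)"
      by (intro nn_integral_cmult) measurable
    also have "\<dots> \<le> ennreal (K * S powr a) * ennreal T"
      using u by (intro mult_left_mono) (auto simp: energy_ball_def)
    also have "\<dots> = ennreal (K * S powr a * T)" using K0 T by (simp add: ennreal_mult)
    also have "K * S powr a * T = K * C powr a * T powr (1 + r * a)"
      using C T by (simp add: S_def powr_mult powr_powr powr_add)
    finally show "(\<integral>\<^sup>+x. ennreal (\<bar>u x\<bar> powr (p * (1 + r * (s * p / real DIM('a))))) \<partial>lborel)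
      \<le> ennreal (K * C powr a * T powr (1 + r * (s * p / real DIM('a))))" by (simp add: a_def)
  qed
qed

lemma embedding_downward:
  fixes s p r r' :: real
  assumes sp: "1 < p" "1 \<le> r'" "r' \<le> r"
    and IH: "\<exists>C>0. \<forall>T>0. \<forall>u\<in>(energy_ball s p T :: ('a::euclidean_space \<Rightarrow> real) set). (\<integral>\<^sup>+x.
        ennreal (\<bar>u x\<bar> powr (p * r)) \<partial>lborel) \<le> ennreal (C * T powr r)"
  shows "\<exists>C>0. \<forall>T>0. \<forall>u\<in>(energy_ball s p T :: ('a \<Rightarrow> real) set). (\<integral>\<^sup>+x. ennreal (\<bar>u x\<bar> powr (p *
      r')) \<partial>lborel) \<le> ennreal (C * T powr r')"
proof -
  obtain C where C: "C > 0" "\<And>T u. T > 0 \<Longrightarrow> u \<in> (energy_ball s p T :: ('a \<Rightarrow> real) set) \<Longrightarrow>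
      (\<integral>\<^sup>+x. ennreal (\<bar>u x\<bar> powr (p * r)) \<partial>lborel) \<le> ennreal (C * T powr r)"
    using IH by auto
  show ?thesis
  proof (intro exI[of _ "1 + C"] conjI allI impI ballI)
    show "1 + C > 0" using C by simp
    fix T :: real and u :: "'a \<Rightarrow> real" assume T: "T > 0" and u: "u \<in> energy_ball s p T"
    have um [measurable]: "u \<in> borel_measurable borel" using u by (simp add: energy_ball_def)
    have pt: "\<bar>u x\<bar> powr (p * r')
        \<le> T powr (r' - 1) * \<bar>u x\<bar> powr p + T powr (r' - r) * \<bar>u x\<bar> powr (p * r)" for x
    proof -
      define w where "w = \<bar>u x\<bar> powr p"
      have "w powr r' \<le> T powr (r' - 1) * w + T powr (r' - r) * w powr r"
      proof (cases "w \<le> T")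
        case True
        have "w powr r' = w powr (r' - 1) * w"
          using powr_mult_base[of w "r' - 1"] by (simp add: w_def mult.commute)
        also have "\<dots> \<le> T powr (r' - 1) * w"
          using True sp by (intro mult_right_mono powr_mono2) (auto simp: w_def)
        finally have 1: "w powr r' \<le> T powr (r' - 1) * w" .
        have "0 \<le> T powr (r' - r) * w powr r" by simp
        then show ?thesis using 1 by linarith
      next
        case False
        then have "w powr r' = w powr (r' - r) * w powr r" using T by (simp flip: powr_add)
        also have "\<dots> \<le> T powr (r' - r) * w powr r"
          using False T sp by (intro mult_right_mono powr_mono2') auto
        finally have 1: "w powr r' \<le> T powr (r' - r) * w powr r" .
        have "0 \<le> T powr (r' - 1) * w" by (simp add: w_def)
        then show ?thesis using 1 by linarith
      qed
      then show ?thesis by (simp add: w_def powr_powr)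
    qed
    have "(\<integral>\<^sup>+x. ennreal (\<bar>u x\<bar> powr (p * r')) \<partial>lborel)
       \<le> (\<integral>\<^sup>+x. ennreal (T powr (r' - 1)) * ennreal (\<bar>u x\<bar> powr p)
           + ennreal (T powr (r' - r)) * ennreal (\<bar>u x\<bar> powr (p * r)) \<partial>lborel)"
      using pt by (intro nn_integral_mono) (simp flip: ennreal_mult ennreal_plus)
    also have "\<dots> = ennreal (T powr (r' - 1)) * (\<integral>\<^sup>+x. ennreal (\<bar>u x\<bar> powr p) \<partial>lborel)
        + ennreal (T powr (r' - r)) * (\<integral>\<^sup>+x. ennreal (\<bar>u x\<bar> powr (p * r)) \<partial>lborel)"
      by (simp add: nn_integral_add nn_integral_cmult)
    also have "\<dots>
        \<le> ennreal (T powr (r' - 1)) * ennreal T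
        + ennreal (T powr (r' - r)) * ennreal (C * T powr r)"
      using u C(2)[OF T u] by (intro add_mono mult_left_mono) (auto simp: energy_ball_def)
    also have "\<dots> = ennreal (T powr (r' - 1) * T + T powr (r' - r) * (C * T powr r))"
      using T C by (simp add: ennreal_mult)
    also have "T powr (r' - 1) * T + T powr (r' - r) * (C * T powr r) = (1 + C) * T powr r'"
      using T by (simp add: powr_diff field_simps)
    finally show "(\<integral>\<^sup>+x. ennreal (\<bar>u x\<bar> powr (p * r')) \<partial>lborel) \<le> ennreal ((1 + C) * T powr r')" .
  qed
qed

text \<open>The subcritical fractional Sobolev embedding, for the exponent conjugate to \<open>q\<close>.  Finitely
  many improvement steps starting from the exponent \<open>1\<close> suffice.\<close>

lemma subcritical_embedding:
  fixes s p q :: real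
  assumes sp: "0 < s" "1 < p" "1 < q" "real DIM('a::euclidean_space) / (s * p) < q"
  shows "\<exists>C>0. \<forall>T>0. \<forall>u\<in>(energy_ball s p T :: ('a \<Rightarrow> real) set).
    (\<integral>\<^sup>+x. ennreal (\<bar>u x\<bar> powr (p * (q / (q - 1)))) \<partial>lborel) \<le> ennreal (C * T powr (q / (q - 1)))"
proof -
  define a where "a = s * p / real DIM('a)"
  define r where "r = q / (q - 1)"
  define R where "R = rec_nat 1 (\<lambda>_ t. 1 + t * a)"
  have R0: "R 0 = 1" and RS: "R (Suc k) = 1 + R k * a" for k by (simp_all add: R_def)
  have a0: "a > 0" using sp by (simp add: a_def)
  have r1: "r > 1" using sp by (simp add: r_def)
  have R1: "R k \<ge> 1" for k
  proof (induction k)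
    case (Suc k)
    then have "R k * a \<ge> 0" using a0 by simp
    then show ?case by (simp add: RS)
  qed (simp add: R0)
  define P where "P t \<longleftrightarrow> (\<exists>C>0. \<forall>T>0. \<forall>u\<in>(energy_ball s p T :: ('a \<Rightarrow> real) set).
    (\<integral>\<^sup>+x. ennreal (\<bar>u x\<bar> powr (p * t)) \<partial>lborel) \<le> ennreal (C * T powr t))" for t :: real
  have PR: "P (R k)" for k
  proof (induction k)
    case 0
    show ?case unfolding P_def R0 by (intro exI[of _ 1]) (auto simp: energy_ball_def)
  next
    case (Suc k)
    then show ?case unfolding P_def RS a_def
      by (intro embedding_step sp R1)
  qed
  \<comment> \<open>The exponents \<open>R k\<close> grow by at least \<open>\<delta>\<close> as long as they stay below \<open>r\<close>.\<close>
  define \<delta> where "\<delta> = 1 - max 0 (1 - a) * r"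
  have "1 < a * q" using sp by (simp add: a_def field_simps)
  then have "q - 1 > (1 - a) * q" by (simp add: algebra_simps)
  then have d0: "\<delta> > 0" using sp by (simp add: \<delta>_def r_def max_def)
  have grow: "R k \<ge> 1 + real k * \<delta> \<or> (\<exists>j. R j \<ge> r)" for k
  proof (induction k)
    case (Suc k)
    show ?case
    proof (cases "\<exists>j. R j \<ge> r")
      case False
      then have le: "R k < r" "1 + real k * \<delta> \<le> R k" using Suc by (meson not_le)+
      have "(1 - a) * R k \<le> max 0 (1 - a) * r"
        using le R1[of k] by (intro mult_mono) auto
      then have "R (Suc k) \<ge> R k + \<delta>" by (simp add: RS \<delta>_def algebra_simps)
      then show ?thesis using le by (simp add: algebra_simps)
    next
      case True
      then show ?thesis by blast
    qed
  qed (simp add: R0)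
  obtain k :: nat where "real k * \<delta> > r" using reals_Archimedean3[OF d0] by auto
  then obtain j where "R j \<ge> r" using grow[of k] by (smt (verit))
  then have "P r" using embedding_downward[of p r "R j" s, where 'a='a] PR[of j] sp r1
    unfolding P_def by simp
  then show ?thesis by (simp add: P_def r_def)
qed

section \<open>Almost everywhere convergence from convexity\<close>

lemma nn_integral_bounded_AE_summable:
  fixes d :: "nat \<Rightarrow> 'a \<Rightarrow> real"
  assumes [measurable]: "\<And>i. d i \<in> borel_measurable M"
    and b: "\<And>i. (\<integral>\<^sup>+x. ennreal \<bar>d i x\<bar> \<partial>M) \<le> ennreal (c i)" and c: "summable c" "\<And>i. c i \<ge> 0"
  shows "AE x in M. summable (\<lambda>i. d i x)"
proof -
  have "(\<integral>\<^sup>+x. (\<Sum>i. ennreal \<bar>d i x\<bar>) \<partial>M) = (\<Sum>i. \<integral>\<^sup>+x. ennreal \<bar>d i x\<bar> \<partial>M)"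
    by (rule nn_integral_suminf) measurable
  also have "\<dots> \<le> (\<Sum>i. ennreal (c i))" by (intro suminf_le b) auto
  also have "\<dots> < \<infinity>" using c by (simp add: suminf_ennreal2)
  finally have "AE x in M. (\<Sum>i. ennreal \<bar>d i x\<bar>) \<noteq> \<infinity>"
    by (intro nn_integral_PInf_AE) auto
  then show ?thesis
  proof (rule AE_mp, intro AE_I2 impI)
    fix x assume "(\<Sum>i. ennreal \<bar>d i x\<bar>) \<noteq> \<infinity>"
    then have "summable (\<lambda>i. \<bar>d i x\<bar>)"
      by (intro summable_suminf_not_top) auto
    then show "summable (\<lambda>i. d i x)" by (rule summable_rabs_cancel)
  qed
qed

text \<open>Uniform convexity of \<open>t \<mapsto> 1 / (1 + t)\<close> on the half line, measured in the metric of its own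
  values.\<close>

lemma inverse_deficit:
  fixes a b :: real
  assumes "a \<ge> 0" "b \<ge> 0"
  shows "(1 / (1 + a) - 1 / (1 + b))\<^sup>2
      \<le> 4 * ((1 / (1 + a) + 1 / (1 + b)) / 2 - 1 / (1 + (a + b) / 2))"
proof -
  define A B where "A = 1 + a" and "B = 1 + b"
  have AB: "A \<ge> 1" "B \<ge> 1" using assms by (auto simp: A_def B_def)
  have m: "1 + (a + b) / 2 = (A + B) / 2" by (simp add: A_def B_def field_simps)
  have l: "(1 / A - 1 / B)\<^sup>2 = (A - B)\<^sup>2 / (A * B * (A * B))"
    using AB by (simp add: power2_eq_square field_simps)
  have r: "4 * ((1 / A + 1 / B) / 2 - 1 / ((A + B) / 2)) = (A - B)\<^sup>2 * 2 / (A * B * (A + B))"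
  proof -
    have "A + B > 0" using AB by linarith
    then show ?thesis using AB
      by (simp add: divide_simps) (simp add: power2_eq_square algebra_simps)
  qed
  have "0 \<le> (A - 1) * (B - 1)" using AB by (intro mult_nonneg_nonneg) auto
  moreover have "A * B \<ge> 1" using AB mult_mono[of 1 A 1 B] by simp
  ultimately have "A + B \<le> 2 * (A * B)" by (simp add: algebra_simps)
  then have "A * B * (A + B) \<le> A * B * (A * B) * 2" using AB by (simp add: mult_left_mono)
  then have "(A - B)\<^sup>2 * 2 / (A * B * (A * B) * 2) \<le> (A - B)\<^sup>2 * 2 / (A * B * (A + B))"
    using AB by (intro divide_left_mono) (auto intro!: mult_pos_pos add_pos_pos)
  then show ?thesis unfolding m r l A_def[symmetric] B_def[symmetric]
    using l r by simp
qed

text \<open>A compactness principle for decreasing families of convex sets of nonnegative functions,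
  in the spirit of Komlos.  It replaces a compact embedding: nearly minimizing the strictly convex
  functional \<open>\<integral> 1 / (1 + f)\<close> over \<open>K k\<close> makes \<open>1 / (1 + f)\<close> a Cauchy sequence in \<open>L\<^sup>2\<close>, and the
  bound on \<open>\<integral> f\<close> keeps the limit of \<open>1 / (1 + f)\<close> positive almost everywhere.\<close>

lemma convex_sets_AE_convergent:
  fixes M :: "'a measure" and K :: "nat \<Rightarrow> ('a \<Rightarrow> real) set" and B :: real
  assumes fin: "finite_measure M"
    and ne: "\<And>k. K k \<noteq> {}" and dec: "\<And>j k. j \<le> k \<Longrightarrow> K k \<subseteq> K j"
    and mid: "\<And>k f g. f \<in> K k \<Longrightarrow> g \<in> K k \<Longrightarrow> (\<lambda>x. (f x + g x) / 2) \<in> K k"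
    and meas: "\<And>k f. f \<in> K k \<Longrightarrow> f \<in> borel_measurable M"
    and nonneg: "\<And>k f x. f \<in> K k \<Longrightarrow> f x \<ge> 0"
    and bound: "\<And>k f. f \<in> K k \<Longrightarrow> (\<integral>\<^sup>+x. ennreal (f x) \<partial>M) \<le> ennreal B"
  obtains f w where "\<And>k. f k \<in> K k" "w \<in> borel_measurable M" "\<And>x. w x \<ge> (0::real)"
    "AE x in M. (\<lambda>k. f k x) \<longlonglongrightarrow> w x"
proof -
  interpret finite_measure M by fact
  define \<phi> where "\<phi> f = (\<integral>x. 1 / (1 + f x) \<partial>M)" for f :: "'a \<Rightarrow> real"
  define \<mu> where "\<mu> = measure M (space M)"
  have b1: "0 \<le> 1 / (1 + f x)" "1 / (1 + f x) \<le> 1" if "f \<in> K k" for f k x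
    using nonneg[OF that, of x] by auto
  have int: "integrable M (\<lambda>x. 1 / (1 + f x))" if "f \<in> K k" for f k
  proof (rule integrable_const_bound[where B=1])
    show "AE x in M. norm (1 / (1 + f x)) \<le> 1" using b1[OF that] by auto
    show "(\<lambda>x. 1 / (1 + f x)) \<in> borel_measurable M" using meas[OF that] by measurable
  qed
  have \<phi>0: "\<phi> f \<ge> 0" if "f \<in> K k" for f k
    unfolding \<phi>_def using b1[OF that] by (intro integral_nonneg_AE) auto
  have \<phi>1: "\<phi> f \<le> \<mu>" if "f \<in> K k" for f k
  proof -
    have "\<phi> f \<le> (\<integral>x. 1 \<partial>M)" unfolding \<phi>_def using b1[OF that] int[OF that]
      by (intro integral_mono) auto
    then show ?thesis by (simp add: \<mu>_def)
  qed
  define I where "I k = (INF f\<in>K k. \<phi> f)" for k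
  have bdd: "bdd_below (\<phi> ` K k)" for k using \<phi>0 by (intro bdd_belowI[of _ 0]) auto
  have I_le: "I k \<le> \<phi> f" if "f \<in> K k" for f k
    unfolding I_def by (rule cINF_lower[OF bdd that])
  have I_mu: "I k \<le> \<mu>" for k using ne[of k] I_le \<phi>1 by (meson ex_in_conv order_trans)
  have I_mono: "incseq I" unfolding incseq_def I_def
    using dec ne bdd by (intro allI impI cINF_superset_mono) auto
  obtain L where L: "I \<longlonglongrightarrow> L" "\<And>i. I i \<le> L"
    using incseq_convergent[OF I_mono, of \<mu>] I_mu by auto
  have "\<exists>f\<in>K k. \<phi> f < I k + 1 / (real k + 1)" for k
  proof -
    have "Inf (\<phi> ` K k) < I k + 1 / (real k + 1)" by (simp add: I_def)
    then show ?thesis using ne bdd by (subst (asm) cInf_less_iff) auto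
  qed
  then obtain g where g: "\<And>k. g k \<in> K k" "\<And>k. \<phi> (g k) < I k + 1 / (real k + 1)" by metis
  define \<eta> where "\<eta> j = 2 * (L - I j) + 4 * (1 / (real j + 1))" for j
  have d: "(\<integral>x. (1 / (1 + g j x) - 1 / (1 + g k x))\<^sup>2 \<partial>M) \<le> \<eta> j"
    and dint: "integrable M (\<lambda>x. (1 / (1 + g j x) - 1 / (1 + g k x))\<^sup>2)" if "j \<le> k" for j k
  proof -
    have gk: "g k \<in> K j" using g dec that by blast
    let ?m = "\<lambda>x. (g j x + g k x) / 2"
    have m: "?m \<in> K j" using mid g gk by blast
    let ?r = "\<lambda>x. 4 * ((1 / (1 + g j x) + 1 / (1 + g k x)) / 2 - 1 / (1 + ?m x))"
    have le: "(1 / (1 + g j x) - 1 / (1 + g k x))\<^sup>2 \<le> ?r x" for x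
      by (rule inverse_deficit) (use nonneg g in auto)
    have lin: "integrable M (\<lambda>x. 4 * ((a x + b x) / 2 - c x)) \<and>
        (\<integral>x. 4 * ((a x + b x) / 2 - c x) \<partial>M)
            = 4 * ((integral\<^sup>L M a + integral\<^sup>L M b) / 2 - integral\<^sup>L M c)"
      if "integrable M a" "integrable M b" "integrable M c" for a b c :: "'a \<Rightarrow> real"
      using that by simp
    note lin = lin[OF int[OF g(1)[of j]] int[OF gk] int[OF m]]
    have ri: "integrable M ?r" using lin by blast
    show di: "integrable M (\<lambda>x. (1 / (1 + g j x) - 1 / (1 + g k x))\<^sup>2)"
    proof (rule Bochner_Integration.integrable_bound[OF ri])
      show "(\<lambda>x. (1 / (1 + g j x) - 1 / (1 + g k x))\<^sup>2) \<in> borel_measurable M"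
        using meas[OF g(1)[of j]] meas[OF g(1)[of k]] by measurable
      show "AE x in M. norm ((1 / (1 + g j x) - 1 / (1 + g k x))\<^sup>2) \<le> norm (?r x)"
        using le by (intro AE_I2) (smt (verit) real_norm_def zero_le_power2)
    qed
    have "(\<integral>x. (1 / (1 + g j x) - 1 / (1 + g k x))\<^sup>2 \<partial>M) \<le> (\<integral>x. ?r x \<partial>M)"
      by (rule integral_mono[OF di ri le])
    also have "\<dots> = 4 * ((\<phi> (g j) + \<phi> (g k)) / 2 - \<phi> ?m)"
      using lin unfolding \<phi>_def by blast
    also have "\<dots> \<le> 4 * ((I j + 1 / (real j + 1) + (L + 1 / (real j + 1))) / 2 - I j)"
    proof -
      have "1 / (real k + 1) \<le> 1 / (real j + 1)" using that by (simp add: frac_le)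
      then have "\<phi> (g k) \<le> L + 1 / (real j + 1)" using g(2)[of k] L(2)[of k] by linarith
      then have "(\<phi> (g j) + \<phi> (g k)) / 2 - \<phi> ?m
          \<le> (I j + 1 / (real j + 1) + (L + 1 / (real j + 1))) / 2 - I j"
      proof -
        have "(b + a) / 2 - m \<le> (i + e + (l + e)) / 2 - i" if "a \<le> l + e" "i \<le> m" "b < i + e"
          for a b m i l e :: real using that by (simp add: field_simps)
        then show ?thesis using \<open>\<phi> (g k) \<le> L + 1 / (real j + 1)\<close> I_le[OF m] g(2)[of j] by blast
      qed
      then show ?thesis by (rule mult_left_mono) simp
    qed
    also have "\<dots> = \<eta> j" by (simp add: \<eta>_def)
    finally show "(\<integral>x. (1 / (1 + g j x) - 1 / (1 + g k x))\<^sup>2 \<partial>M) \<le> \<eta> j" .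
  qed
  have "(\<lambda>j. 1 / (real j + 1)) \<longlonglongrightarrow> 0"
    using LIMSEQ_inverse_real_of_nat by (simp add: inverse_eq_divide add.commute)
  then have "\<eta> \<longlonglongrightarrow> 2 * (L - L) + 4 * 0" unfolding \<eta>_def
    by (intro tendsto_intros L(1))
  then have "\<eta> \<longlonglongrightarrow> 0" by simp
  then have "\<exists>N. \<forall>j\<ge>N. \<eta> j \<le> (1/4) ^ i" for i
    using order_tendstoD(2)[of \<eta> 0 sequentially "(1/4) ^ i"]
    by (auto simp: eventually_sequentially intro: less_imp_le)
  then obtain N where N: "\<And>i j. j \<ge> N i \<Longrightarrow> \<eta> j \<le> (1/4) ^ i" by metis
  \<comment> \<open>A choice of \<open>\<sigma>\<close> that is monotone and dominates both \<open>N\<close> and the identity.\<close>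
  define \<sigma> where "\<sigma> i = i + (\<Sum>m\<le>i. N m)" for i
  have \<sigma>: "\<sigma> i \<ge> i" "\<sigma> i \<ge> N i" "\<sigma> i \<le> \<sigma> (Suc i)" for i
    using member_le_sum[of i "{..i}" N] by (auto simp: \<sigma>_def)
  define f where "f i = g (\<sigma> i)" for i
  have fK: "f i \<in> K i" for i using g \<sigma> dec unfolding f_def by blast
  define h where "h i x = 1 / (1 + f i x)" for i x
  have hm [measurable]: "h i \<in> borel_measurable M" for i
    using meas[OF fK[of i]] unfolding h_def by measurable
  have fm [measurable]: "f i \<in> borel_measurable M" for i using meas[OF fK] .
  have "AE x in M. summable (\<lambda>i. h (Suc i) x - h i x)"
  proof (rule nn_integral_bounded_AE_summable)
    show "summable (\<lambda>i. (1 + \<mu>) * (1/2) ^ i)" by (intro summable_mult summable_geometric) simp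
    show "(1 + \<mu>) * (1/2) ^ i \<ge> 0" for i by (simp add: \<mu>_def)
    fix i
    let ?d = "\<lambda>x. h i x - h (Suc i) x"
    have i1: "integrable M (\<lambda>x. (?d x)\<^sup>2)" "(\<integral>x. (?d x)\<^sup>2 \<partial>M) \<le> (1/4) ^ i"
      using dint[OF \<sigma>(3)[of i]] d[OF \<sigma>(3)[of i]] N[OF \<sigma>(2)[of i]] by (auto simp: h_def f_def)
    have pt: "\<bar>h (Suc i) x - h i x\<bar> \<le> 2 ^ i * (?d x)\<^sup>2 + (1/2) ^ i" for x
    proof -
      define y where "y = \<bar>?d x\<bar>"
      have "0 \<le> (2 ^ i * y - 1)\<^sup>2" by simp
      then have "2 * (2 ^ i * y) \<le> 2 ^ i * (2 ^ i * y\<^sup>2) + 1"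
        by (simp add: power2_eq_square algebra_simps)
      moreover have "2 ^ i * y \<ge> 0" by (simp add: y_def)
      ultimately have "2 ^ i * y \<le> 2 ^ i * (2 ^ i * y\<^sup>2 + (1/2) ^ i)"
        by (simp add: distrib_left flip: power_mult_distrib)
      then have "y \<le> 2 ^ i * y\<^sup>2 + (1/2) ^ i" by simp
      then show ?thesis by (simp add: y_def abs_minus_commute)
    qed
    have "(\<integral>\<^sup>+x. ennreal \<bar>h (Suc i) x - h i x\<bar> \<partial>M)
        \<le> (\<integral>\<^sup>+x. ennreal (2 ^ i * (?d x)\<^sup>2 + (1/2) ^ i) \<partial>M)"
      using pt by (intro nn_integral_mono ennreal_leI)
    also have "\<dots> = ennreal (\<integral>x. 2 ^ i * (?d x)\<^sup>2 + (1/2) ^ i \<partial>M)"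
      using i1 by (intro nn_integral_eq_integral) auto
    also have "(\<integral>x. 2 ^ i * (?d x)\<^sup>2 + (1/2) ^ i \<partial>M) = 2 ^ i * (\<integral>x. (?d x)\<^sup>2 \<partial>M) + \<mu> * (1/2) ^ i"
      using i1 by (simp add: \<mu>_def)
    also have "ennreal \<dots> \<le> ennreal (2 ^ i * (1/4) ^ i + \<mu> * (1/2) ^ i)"
      using i1 by (intro ennreal_leI add_mono mult_left_mono) (auto simp: \<mu>_def)
    also have "(2::real) ^ i * (1/4) ^ i = (1/2) ^ i" by (simp flip: power_mult_distrib)
    finally show "(\<integral>\<^sup>+x. ennreal \<bar>h (Suc i) x - h i x\<bar> \<partial>M) \<le> ennreal ((1 + \<mu>) * (1/2) ^ i)"
      by (simp add: algebra_simps)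
  qed measurable
  then have hc: "AE x in M. convergent (\<lambda>i. h i x)"
  proof (rule AE_mp, intro AE_I2 impI)
    fix x assume "summable (\<lambda>i. h (Suc i) x - h i x)"
    then have "convergent (\<lambda>n. \<Sum>i<n. h (Suc i) x - h i x)" by (simp add: summable_iff_convergent)
    then have "convergent (\<lambda>n. h n x - h 0 x)"
      by (simp add: sum_lessThan_telescope[of "\<lambda>i. h i x"])
    then have "convergent (\<lambda>n. (h n x - h 0 x) + h 0 x)"
      by (rule convergent_add[OF _ convergent_const])
    then show "convergent (\<lambda>i. h i x)" by simp
  qed
  have "(\<integral>\<^sup>+x. liminf (\<lambda>i. ennreal (f i x)) \<partial>M) \<le> liminf (\<lambda>i. \<integral>\<^sup>+x. ennreal (f i x) \<partial>M)"
    by (rule nn_integral_liminf) measurable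
  also have "\<dots> \<le> liminf (\<lambda>i. ennreal B)" using bound[OF fK] by (intro Liminf_mono) auto
  also have "\<dots> < \<infinity>" by (simp add: Liminf_const)
  finally have lf: "AE x in M. liminf (\<lambda>i. ennreal (f i x)) \<noteq> \<infinity>"
    by (intro nn_integral_PInf_AE) auto
  define w where "w x = max 0 (lim (\<lambda>i. f i x))" for x
  have conv: "AE x in M. (\<lambda>k. f k x) \<longlonglongrightarrow> w x"
    using hc lf
  proof eventually_elim
    case (elim x)
    obtain l where l: "(\<lambda>i. h i x) \<longlonglongrightarrow> l" using elim(1) by (auto simp: convergent_def)
    have fx: "f i x \<ge> 0" for i using nonneg[OF fK] .
    have hx: "h i x > 0" for i using fx[of i] by (simp add: h_def)
    have fh: "f i x = 1 / h i x - 1" for i using fx[of i] by (simp add: h_def)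
    have "l \<noteq> 0"
    proof
      assume "l = 0"
      then have "filterlim (\<lambda>i. h i x) (at_right 0) sequentially"
        using l hx less_imp_neq[OF hx] by (auto simp: filterlim_at intro!: always_eventually)
      then have "filterlim (\<lambda>i. inverse (h i x)) at_top sequentially"
        by (rule filterlim_compose[OF filterlim_inverse_at_top_right])
      then have "filterlim (\<lambda>i. - 1 + inverse (h i x)) at_top sequentially"
        by (intro filterlim_tendsto_add_at_top[OF tendsto_const])
      then have "filterlim (\<lambda>i. f i x) at_top sequentially" by (simp add: fh inverse_eq_divide)
      then have "(\<lambda>i. ennreal (f i x)) \<longlonglongrightarrow> top" by (simp add: ennreal_tendsto_top_eq_at_top)
      then have "liminf (\<lambda>i. ennreal (f i x)) = top" by (intro lim_imp_Liminf) auto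
      then show False using elim(2) by simp
    qed
    then have "(\<lambda>i. f i x) \<longlonglongrightarrow> 1 / l - 1" unfolding fh by (intro tendsto_intros l)
    moreover from this have "1 / l - 1 \<ge> 0" using fx by (intro LIMSEQ_le_const) auto
    ultimately show ?case by (simp add: w_def limI max_absorb2)
  qed
  have wm: "w \<in> borel_measurable M" unfolding w_def by measurable
  show ?thesis by (rule that[OF fK wm _ conv]) (simp add: w_def)
qed

section \<open>Finite energy of a bump function\<close>

text \<open>A function dominated by multiples of indicators of balls of radii \<open>R j\<close> is integrable if the
  multiples, weighted with the volumes of the balls, are summable.\<close>

lemma nn_integral_dyadic_bound:
  fixes f :: "'a::euclidean_space \<Rightarrow> ennreal" and c :: "nat \<Rightarrow> real"
  assumes le: "\<And>z. f z \<le> (\<Sum>j. ennreal (c j / R j ^ DIM('a)) * indicator (cball 0 (R j)) z)"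
    and c: "summable c" "\<And>j. c j \<ge> 0" and R: "\<And>j. R j > 0"
  shows "(\<integral>\<^sup>+z. f z \<partial>lborel) < \<infinity>"
proof -
  define \<omega> where "\<omega> = unit_ball_vol (real DIM('a))"
  have "(\<integral>\<^sup>+z. f z \<partial>lborel)
      \<le> (\<integral>\<^sup>+z. (\<Sum>j. ennreal (c j / R j ^ DIM('a)) * indicator (cball (0::'a) (R j)) z) \<partial>lborel)"
    by (rule nn_integral_mono) (rule le)
  also have "\<dots>
      = (\<Sum>j. \<integral>\<^sup>+z. ennreal (c j / R j ^ DIM('a)) * indicator (cball (0::'a) (R j)) z \<partial>lborel)"
  proof (rule nn_integral_suminf)
    fix j
    have [measurable]: "cball (0::'a) (R j) \<in> sets borel" by simp
    show "(\<lambda>z. ennreal (c j / R j ^ DIM('a)) * indicator (cball (0::'a) (R j)) z)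
        \<in> borel_measurable lborel"
      by measurable
  qed
  also have "\<dots> = (\<Sum>j. ennreal (c j * \<omega>))"
  proof (intro suminf_cong)
    fix j
    have "(\<integral>\<^sup>+z. ennreal (c j / R j ^ DIM('a)) * indicator (cball (0::'a) (R j)) z \<partial>lborel)
        = ennreal (c j / R j ^ DIM('a)) * emeasure lborel (cball (0::'a) (R j))"
      by (rule nn_integral_cmult_indicator) simp
    also have "\<dots> = ennreal (c j / R j ^ DIM('a)) * ennreal (\<omega> * R j ^ DIM('a))"
      using R[of j] by (simp add: emeasure_cball \<omega>_def)
    also have "\<dots> = ennreal (c j / R j ^ DIM('a) * (\<omega> * R j ^ DIM('a)))"
      using c(2)[of j] R[of j] by (intro ennreal_mult[symmetric]) (auto simp: \<omega>_def)
    also have "c j / R j ^ DIM('a) * (\<omega> * R j ^ DIM('a)) = c j * \<omega>"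
      using R[of j] by simp
    finally show "(\<integral>\<^sup>+z. ennreal (c j / R j ^ DIM('a)) * indicator (cball (0::'a) (R j)) z
        \<partial>lborel) = ennreal (c j * \<omega>)" .
  qed
  also have "\<dots> < \<infinity>"
    using c summable_mult2[OF c(1), of \<omega>] by (simp add: suminf_ennreal2 \<omega>_def)
  finally show ?thesis .
qed

lemma dyadic_scale:
  fixes t :: real
  assumes "t \<ge> 1"
  shows "\<exists>j::nat. 2 ^ j \<le> t \<and> t \<le> 2 ^ (j + 1)"
proof -
  define j where "j = nat \<lfloor>log 2 t\<rfloor>"
  have "log 2 t \<ge> 0" using assms by simp
  then have "real j \<le> log 2 t" "log 2 t \<le> real (j + 1)" by (auto simp: j_def) linarith
  then have "2 powr real j \<le> t" "t \<le> 2 powr real (j + 1)"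
    using assms by (auto simp: le_log_iff log_le_iff)
  then show ?thesis by (auto simp: powr_realpow simp del: of_nat_Suc of_nat_add)
qed

lemma two_power_powr: "((2::real) ^ j) powr e = (2 powr e) ^ j"
proof -
  have "((2::real) ^ j) powr e = 2 powr (real j * e)" by (simp add: powr_powr flip: powr_realpow)
  also have "\<dots> = (2 powr e) powr real j" by (simp add: powr_powr mult.commute)
  finally show ?thesis by (simp add: powr_realpow)
qed

lemma half_power_powr: "((1/2::real) ^ j) powr e = (2 powr (- e)) ^ j"
proof -
  have "(1/2::real) ^ j = inverse (2 ^ j)" by (simp add: power_one_over inverse_eq_divide)
  then have "((1/2::real) ^ j) powr e = inverse ((2 ^ j) powr e)" by (simp add: inverse_powr)
  then show ?thesis by (simp add: two_power_powr powr_minus power_inverse)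
qed

lemma term_le_suminf_ennreal:
  fixes f :: "nat \<Rightarrow> ennreal"
  shows "f j \<le> (\<Sum>i. f i)"
  using sum_le_suminf[of f "{j}"] by simp

text \<open>The kernel that dominates the Gagliardo quotient of a bounded Lipschitz function: the first
  factor makes it integrable at the origin, as \<open>s < 1\<close>, and \<open>s > 0\<close> makes it integrable at
  infinity.\<close>

lemma nn_integral_kernel_finite:
  fixes s p :: real
  assumes sp: "0 < s" "s < 1" "1 < p"
  shows "(\<integral>\<^sup>+z. ennreal (min 1 (norm (z :: 'a::euclidean_space)) powr p / norm z powr (real
      DIM('a) + s * p)) \<partial>lborel) < \<infinity>"
proof -
  define n where "n = real DIM('a)"
  have n0: "n > 0" by (simp add: n_def)
  define b where "b = p - s * p"
  have b0: "b > 0" using sp by (simp add: b_def)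
  have spp: "s * p > 0" using sp by simp
  have gs: "summable (\<lambda>j. C * (2 powr (- e)) ^ j)" if "e > 0" for e C :: real
  proof -
    have "2 powr (- e) < (1::real)" using that by (subst powr_less_one) auto
    then show ?thesis by (intro summable_mult summable_geometric) auto
  qed
  define k :: "'a \<Rightarrow> ennreal" where "k z = ennreal (min 1 (norm z) powr p / norm z powr (n
      + s * p))" for z
  have km [measurable]: "k \<in> borel_measurable borel" unfolding k_def by measurable
  have [measurable]: "cball (0::'a) 1 \<in> sets borel" by simp
  define k1 where "k1 z = k z * indicator (cball 0 1) z" for z
  define k2 where "k2 z = k z * indicator (- cball 0 1) z" for z
  have dy_near: "k1 z
      \<le> (\<Sum>j. ennreal (2 ^ DIM('a) * (2 powr (- b)) ^ j / ((1/2) ^ j) ^ DIM('a)) * indicator (cball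
      0 ((1/2) ^ j)) z)" for z :: 'a
  proof (cases "z \<in> cball 0 1 \<and> z \<noteq> 0")
    case False
    then have "k1 z = 0"
      by (cases "z = 0") (auto simp: k1_def k_def)
    then show ?thesis by simp
  next
    case True
    then have z: "norm z \<le> 1" "norm z > 0" by auto
    then have "1 / norm z \<ge> 1" by simp
    from dyadic_scale[OF this] obtain j where j: "2 ^ j \<le> 1 / norm z" "1 / norm z
        \<le> 2 ^ (j + 1)" by auto
    have j1: "norm z \<le> (1/2) ^ j" using j(1) z by (simp add: field_simps power_divide)
    have e: "min 1 (norm z) powr p / norm z powr (n + s * p) = norm z powr b * (1 / norm z) powr n"
    proof -
      have "norm z powr p = norm z powr b * norm z powr (s * p)"
        using z by (simp add: b_def flip: powr_add)
      then show ?thesis using z by (simp add: powr_add powr_divide)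
    qed
    have "norm z powr b \<le> ((1/2) ^ j) powr b" using j1 z b0 by (intro powr_mono2) auto
    also have "((1/2) ^ j) powr b = (2 powr (- b)) ^ j"
      by (rule half_power_powr)
    finally have 1: "norm z powr b \<le> (2 powr (- b)) ^ j" .
    have "(1 / norm z) powr n \<le> (2 ^ (j + 1)) powr n" using j(2) z n0 by (intro powr_mono2) auto
    also have "\<dots> = 2 ^ DIM('a) / ((1/2) ^ j) ^ DIM('a)"
      by (simp add: n_def powr_realpow power_mult_distrib power_divide)
    finally have 2: "(1 / norm z) powr n \<le> 2 ^ DIM('a) / ((1/2) ^ j) ^ DIM('a)" .
    have "k1 z \<le> ennreal (2 ^ DIM('a) * (2 powr (- b)) ^ j / ((1/2) ^ j) ^ DIM('a)) * indicator
        (cball 0 ((1/2) ^ j)) z"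
      using True j1 mult_mono[OF 1 2] unfolding k1_def k_def e by (simp add: mult_ac ennreal_leI)
    also have "\<dots>
        \<le> (\<Sum>j. ennreal (2 ^ DIM('a) * (2 powr (- b)) ^ j / ((1/2) ^ j) ^ DIM('a)) * indicator
        (cball 0 ((1/2) ^ j)) z)"
      by (rule term_le_suminf_ennreal)
    finally show ?thesis .
  qed
  have near: "(\<integral>\<^sup>+z. k1 z \<partial>lborel) < \<infinity>"
    by (rule nn_integral_dyadic_bound[where c = "\<lambda>j. 2 ^ DIM('a) * (2 powr (- b)) ^ j" and R
        = "\<lambda>j. (1/2) ^ j"]) (use dy_near in blast, rule gs[OF b0], auto)
  have dy_far: "k2 z \<le> (\<Sum>j. ennreal (2 ^ DIM('a) * (2 powr (- (s * p))) ^ j / (2 ^ (j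
      + 1)) ^ DIM('a)) * indicator (cball 0 (2 ^ (j + 1))) z)" for z :: 'a
  proof (cases "z \<in> cball 0 1")
    case True
    then have "k2 z = 0" by (simp add: k2_def)
    then show ?thesis by simp
  next
    case False
    then have z: "norm z > 1" by auto
    then have "norm z \<noteq> 0" and "norm z \<ge> 1" by auto
    from dyadic_scale[OF this(2)] obtain j where j: "2 ^ j \<le> norm z" "norm z \<le> 2 ^ (j + 1)" by auto
    have "(2 ^ j) powr (n + s * p) \<le> norm z powr (n + s * p)"
      using j(1) n0 spp by (intro powr_mono2) auto
    then have "1 / norm z powr (n + s * p) \<le> 1 / (2 ^ j) powr (n + s * p)"
      using \<open>norm z \<noteq> 0\<close> by (intro divide_left_mono mult_pos_pos) auto
    also have "\<dots> = 2 ^ DIM('a) * (2 powr (- (s * p))) ^ j / (2 ^ (j + 1)) ^ DIM('a)"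
    proof -
      have "((2::real) ^ j) powr (n + s * p) = (2 ^ j) ^ DIM('a) * (2 powr (s * p)) ^ j"
        by (simp add: powr_add n_def powr_realpow two_power_powr mult.commute flip: power_mult)
      then show ?thesis
        by (simp add: powr_minus power_mult_distrib field_simps)
    qed
    finally have "1 / norm z powr (n + s * p)
        \<le> 2 ^ DIM('a) * (2 powr (- (s * p))) ^ j / (2 ^ (j + 1)) ^ DIM('a)" .
    then have "k2 z \<le> ennreal (2 ^ DIM('a) * (2 powr (- (s * p))) ^ j / (2 ^ (j
        + 1)) ^ DIM('a)) * indicator (cball 0 (2 ^ (j + 1))) z"
      using False j(2) z unfolding k2_def k_def by (simp add: min_absorb1 ennreal_leI)
    also have "\<dots> \<le> (\<Sum>j. ennreal (2 ^ DIM('a) * (2 powr (- (s * p))) ^ j / (2 ^ (j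
        + 1)) ^ DIM('a)) * indicator (cball 0 (2 ^ (j + 1))) z)"
      by (rule term_le_suminf_ennreal)
    finally show ?thesis .
  qed
  have far: "(\<integral>\<^sup>+z. k2 z \<partial>lborel) < \<infinity>"
    by (rule nn_integral_dyadic_bound[where c = "\<lambda>j. 2 ^ DIM('a) * (2 powr (- (s * p))) ^ j" and R
        = "\<lambda>j. 2 ^ (j + 1)"]) (use dy_far in blast, rule gs[OF spp], auto)
  have "(\<integral>\<^sup>+z. k z \<partial>lborel) = (\<integral>\<^sup>+z. k1 z + k2 z \<partial>lborel)"
    by (intro nn_integral_cong) (auto simp: indicator_def k1_def k2_def)
  also have "\<dots> = (\<integral>\<^sup>+z. k1 z \<partial>lborel) + (\<integral>\<^sup>+z. k2 z \<partial>lborel)"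
    unfolding k1_def k2_def by (intro nn_integral_add) measurable
  also have "\<dots> < \<infinity>" using near far by simp
  finally show ?thesis by (simp add: k_def n_def)
qed

text \<open>A cone-shaped bump has finite energy; its rescalings show that the constraint set of the
  variational problem is nonempty.\<close>

lemma bump_energy_finite:
  fixes x0 :: "'a::euclidean_space" and s p \<rho> :: real
  defines "u \<equiv> \<lambda>x. max 0 (\<rho> - dist x x0)"
  assumes sp: "0 < s" "s < 1" "1 < p" and \<rho>: "0 < \<rho>" "\<rho> \<le> 1"
  shows "(\<integral>\<^sup>+x. \<integral>\<^sup>+y. ennreal (gagliardo_quotient s p u (x, y)) \<partial>lborel \<partial>lborel) < \<infinity>"
proof -
  define k :: "'a \<Rightarrow> ennreal" where "k z
      = ennreal (min 1 (norm z) powr p / norm z powr (real DIM('a) + s * p))" for z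
  define B where "B = ball x0 \<rho>"
  have Bm [measurable]: "B \<in> sets borel" by (simp add: B_def)
  have km [measurable]: "k \<in> borel_measurable borel" unfolding k_def by measurable
  have kf: "(\<integral>\<^sup>+z. k z \<partial>lborel) < \<infinity>" unfolding k_def using sp by (rule nn_integral_kernel_finite)
  have kt: "(\<integral>\<^sup>+y. k (x - y) \<partial>lborel) = (\<integral>\<^sup>+z. k z \<partial>lborel)" for x
  proof -
    have "(\<integral>\<^sup>+z. k z \<partial>lborel) = (\<integral>\<^sup>+z. k z \<partial>(distr lborel borel ((+) (- x))))"
      by (simp add: lborel_distr_plus)
    also have "\<dots> = (\<integral>\<^sup>+y. k (- x + y) \<partial>lborel)" by (rule nn_integral_distr) auto
    also have "\<dots> = (\<integral>\<^sup>+y. k (x - y) \<partial>lborel)"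
      by (simp add: k_def norm_minus_commute)
    finally show ?thesis by simp
  qed
  have pt: "ennreal (gagliardo_quotient s p u (x, y))
      \<le> indicator B x * k (x - y) + indicator B y * k (x - y)" for x y
  proof (cases "x \<in> B \<or> y \<in> B")
    case True
    have "\<bar>u x - u y\<bar> \<le> \<bar>dist x x0 - dist y x0\<bar>" unfolding u_def by linarith
    also have "\<dots> \<le> dist x y" by (metis abs_dist_diff_le dist_commute)
    finally have "\<bar>u x - u y\<bar> \<le> dist x y" .
    moreover have "\<bar>u x - u y\<bar> \<le> 1"
      using \<rho> unfolding u_def by (smt (verit) zero_le_dist)
    ultimately have "\<bar>u x - u y\<bar> powr p \<le> min 1 (norm (x - y)) powr p"
      using sp by (intro powr_mono2) (auto simp: dist_norm)
    then have "ennreal (gagliardo_quotient s p u (x, y)) \<le> k (x - y)"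
      unfolding gagliardo_quotient_def k_def by (auto intro!: ennreal_leI divide_right_mono)
    moreover have "k (x - y) \<le> indicator B x * k (x - y) + indicator B y * k (x - y)"
      using True by (auto simp: indicator_def)
    ultimately show ?thesis by (rule order_trans)
  next
    case False
    then have "u x = 0" "u y = 0" by (auto simp: u_def B_def dist_commute)
    then show ?thesis by (simp add: gagliardo_quotient_def)
  qed
  have "(\<integral>\<^sup>+x. \<integral>\<^sup>+y. ennreal (gagliardo_quotient s p u (x, y)) \<partial>lborel \<partial>lborel)
     \<le> (\<integral>\<^sup>+x. \<integral>\<^sup>+y. indicator B x * k (x - y) + indicator B y * k (x - y) \<partial>lborel \<partial>lborel)"
    by (intro nn_integral_mono pt)
  also have "\<dots> = (\<integral>\<^sup>+x. (\<integral>\<^sup>+y. indicator B x * k (x - y) \<partial>lborel)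
      + (\<integral>\<^sup>+y. indicator B y * k (x - y) \<partial>lborel) \<partial>lborel)"
    by (intro nn_integral_cong nn_integral_add) measurable
  also have "\<dots> = (\<integral>\<^sup>+x. \<integral>\<^sup>+y. indicator B x * k (x - y) \<partial>lborel \<partial>lborel)
      + (\<integral>\<^sup>+x. \<integral>\<^sup>+y. indicator B y * k (x - y) \<partial>lborel \<partial>lborel)"
    by (intro nn_integral_add) measurable
  also have "(\<integral>\<^sup>+x. \<integral>\<^sup>+y. indicator B x * k (x - y) \<partial>lborel \<partial>lborel)
      = (\<integral>\<^sup>+z. k z \<partial>lborel) * emeasure lborel B"
  proof -
    have "(\<integral>\<^sup>+y. indicator B x * k (x - y) \<partial>lborel) = (\<integral>\<^sup>+z. k z \<partial>lborel) * indicator B x" for x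
      using kt[of x] by (simp add: nn_integral_cmult mult.commute)
    then show ?thesis by (simp add: nn_integral_cmult_indicator)
  qed
  also have "(\<integral>\<^sup>+x. \<integral>\<^sup>+y. indicator B y * k (x - y) \<partial>lborel \<partial>lborel)
      = (\<integral>\<^sup>+z. k z \<partial>lborel) * emeasure lborel B"
  proof -
    have "(\<integral>\<^sup>+x. \<integral>\<^sup>+y. indicator B y * k (x - y) \<partial>lborel \<partial>lborel)
        = (\<integral>\<^sup>+y. \<integral>\<^sup>+x. indicator B y * k (x - y) \<partial>lborel \<partial>lborel)"
      by (rule lborel_pair.Fubini') measurable
    also have "(\<integral>\<^sup>+x. indicator B y * k (x - y) \<partial>lborel) = (\<integral>\<^sup>+z. k z \<partial>lborel) * indicator B y"
        for y
    proof -
      have "(\<integral>\<^sup>+x. indicator B y * k (x - y) \<partial>lborel) = (\<integral>\<^sup>+x. indicator B y * k (y - x) \<partial>lborel)"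
        by (simp add: k_def norm_minus_commute)
      then show ?thesis using kt[of y] by (simp add: nn_integral_cmult mult.commute)
    qed
    then have "(\<integral>\<^sup>+y. \<integral>\<^sup>+x. indicator B y * k (x - y) \<partial>lborel \<partial>lborel)
        = (\<integral>\<^sup>+z. k z \<partial>lborel) * emeasure lborel B"
      by (simp add: nn_integral_cmult_indicator)
    finally show ?thesis .
  qed
  also have "(\<integral>\<^sup>+z. k z \<partial>lborel) * emeasure lborel B + (\<integral>\<^sup>+z. k z \<partial>lborel) * emeasure lborel B < \<infinity>"
    using kf \<rho> by (simp add: B_def emeasure_ball ennreal_mult_less_top)
  finally show ?thesis .
qed

section \<open>The energy on Lebesgue measurable functions\<close>

lemma null_sets_cylinder:
  fixes N :: "'a::euclidean_space set"
  assumes N: "N \<in> null_sets lborel"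
  shows "N \<times> (UNIV :: 'b::euclidean_space set) \<in> null_sets lborel"
    and "(UNIV :: 'b set) \<times> N \<in> null_sets lborel"
proof -
  have [measurable]: "N \<in> sets borel" using N by auto
  have "emeasure (lborel \<Otimes>\<^sub>M lborel) (N \<times> (UNIV :: 'b set)) = 0"
    "emeasure (lborel \<Otimes>\<^sub>M lborel) ((UNIV :: 'b set) \<times> N) = 0"
    using N by (simp_all add: lborel.emeasure_pair_measure_Times null_setsD1)
  moreover have "N \<times> (UNIV :: 'b set) \<in> sets borel" "(UNIV :: 'b set) \<times> N \<in> sets borel"
    by (simp_all flip: borel_prod)
  ultimately show "N \<times> (UNIV :: 'b set) \<in> null_sets lborel" "(UNIV :: 'b set) \<times> N
      \<in> null_sets lborel"
    by (auto simp: null_sets_def lborel_prod)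
qed

lemma AE_lebesgue_fst_snd:
  fixes P :: "'a::euclidean_space \<Rightarrow> bool"
  assumes "AE x in lebesgue. P x"
  shows "AE z in (lebesgue :: ('a \<times> 'a) measure). P (fst z) \<and> P (snd z)"
proof -
  have "AE x in lborel. P x" using assms by (simp add: AE_completion_iff)
  then obtain N where N: "N \<in> null_sets lborel" "{x. \<not> P x} \<subseteq> N"
    by (auto elim!: AE_E simp: null_sets_def)
  have "AE z in (lborel :: ('a \<times> 'a) measure). z \<notin> N \<times> UNIV"
      "AE z in (lborel :: ('a \<times> 'a) measure). z \<notin> UNIV \<times> N"
    using null_sets_cylinder[OF N(1), where 'b='a] by (auto intro: AE_not_in)
  then have "AE z in (lborel :: ('a \<times> 'a) measure). P (fst z) \<and> P (snd z)"
    by eventually_elim (use N(2) in \<open>auto simp: mem_Times_iff\<close>)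
  then show ?thesis by (rule AE_completion)
qed

lemma measurable_fst_snd_lebesgue [measurable]:
  "fst \<in> measurable (lebesgue :: ('a::euclidean_space \<times> 'b::euclidean_space) measure) lebesgue"
  "snd \<in> measurable (lebesgue :: ('a::euclidean_space \<times> 'b::euclidean_space) measure) lebesgue"
proof -
  have m: "fst \<in> measurable (lebesgue :: ('a \<times> 'b) measure) lborel"
      "snd \<in> measurable (lebesgue :: ('a \<times> 'b) measure) lborel"
    by (auto intro!: measurable_completion borel_measurable_continuous_onI continuous_intros)
  have 1: "null_sets lborel \<subseteq> null_sets (distr (lebesgue :: ('a \<times> 'b) measure) lborel fst)"
  proof
    fix N :: "'a set" assume N: "N \<in> null_sets lborel"
    have "fst -` N \<inter> UNIV = N \<times> (UNIV :: 'b set)" by auto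
    then show "N \<in> null_sets (distr (lebesgue :: ('a \<times> 'b) measure) lborel fst)"
      using N null_sets_cylinder(1)[OF N, where 'b='b] m
      by (auto simp: null_sets_def emeasure_distr)
  qed
  have 2: "null_sets lborel \<subseteq> null_sets (distr (lebesgue :: ('a \<times> 'b) measure) lborel snd)"
  proof
    fix N :: "'b set" assume N: "N \<in> null_sets lborel"
    have "snd -` N \<inter> UNIV = (UNIV :: 'a set) \<times> N" by auto
    then show "N \<in> null_sets (distr (lebesgue :: ('a \<times> 'b) measure) lborel snd)"
      using N null_sets_cylinder(2)[OF N, where 'b='a] m
      by (auto simp: null_sets_def emeasure_distr)
  qed
  show "fst \<in> measurable (lebesgue :: ('a \<times> 'b) measure) lebesgue"
    by (rule completion.measurable_completion2[OF m(1) 1])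
  show "snd \<in> measurable (lebesgue :: ('a \<times> 'b) measure) lebesgue"
    by (rule completion.measurable_completion2[OF m(2) 2])
qed

lemma gagliardo_quotient_alt:
  "gagliardo_quotient s p u = (\<lambda>z::'a::euclidean_space \<times> 'a. \<bar>u (fst z) - u (snd z)\<bar> powr p /
     norm (fst z - snd z) powr (real DIM('a) + s * p))"
  by (auto simp: gagliardo_quotient_def)

lemma borel_measurable_gagliardo_quotient_lebesgue [measurable]:
  fixes u :: "'a::euclidean_space \<Rightarrow> real"
  assumes [measurable]: "u \<in> borel_measurable lebesgue"
  shows "gagliardo_quotient s p u \<in> borel_measurable lebesgue"
proof -
  have [measurable]: "(\<lambda>z::'a \<times> 'a. norm (fst z - snd z)) \<in> borel_measurable lebesgue"
    by (auto intro!: measurable_completion borel_measurable_continuous_onI continuous_intros)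
  show ?thesis unfolding gagliardo_quotient_alt by measurable
qed

text \<open>The Gagliardo double integral \<open>[u]\<^sup>p\<close> over the whole space, as an extended nonnegative
  number.\<close>

definition energy :: "real \<Rightarrow> real \<Rightarrow> ('a::euclidean_space \<Rightarrow> real) \<Rightarrow> ennreal" where
  "energy s p u = (\<integral>\<^sup>+z. ennreal (gagliardo_quotient s p u z) \<partial>lebesgue)"

lemma energy_cong_AE:
  fixes u v :: "'a::euclidean_space \<Rightarrow> real"
  assumes "AE x in lebesgue. u x = v x"
  shows "energy s p u = energy s p v"
  unfolding energy_def
proof (rule nn_integral_cong_AE)
  show "AE z in lebesgue. ennreal (gagliardo_quotient s p u z)
      = ennreal (gagliardo_quotient s p v z)"
    using AE_lebesgue_fst_snd[OF assms] by eventually_elim (simp add: gagliardo_quotient_alt)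
qed

text \<open>Tonelli's theorem is applied to Borel functions only; a Lebesgue measurable function is first
  replaced by a Borel version, which does not change its energy.\<close>

lemma energy_iterated:
  fixes u :: "'a::euclidean_space \<Rightarrow> real"
  assumes [measurable]: "u \<in> borel_measurable borel"
  shows "energy s p u = (\<integral>\<^sup>+x. \<integral>\<^sup>+y. ennreal (gagliardo_quotient s p u (x, y)) \<partial>lborel \<partial>lborel)"
proof -
  have "energy s p u = (\<integral>\<^sup>+z. ennreal (gagliardo_quotient s p u z) \<partial>(lborel \<Otimes>\<^sub>M lborel))"
    by (simp add: energy_def nn_integral_completion lborel_prod)
  also have "\<dots> = (\<integral>\<^sup>+x. \<integral>\<^sup>+y. ennreal (gagliardo_quotient s p u (x, y)) \<partial>lborel \<partial>lborel)"
    by (rule lborel.nn_integral_fst[symmetric]) measurable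
  finally show ?thesis .
qed

lemma lebesgue_ex_borel_version:
  fixes u :: "'a::euclidean_space \<Rightarrow> real"
  assumes "u \<in> borel_measurable lebesgue"
  obtains u' where "u' \<in> borel_measurable borel" "AE x in lebesgue. u x = u' x"
  using completion_ex_borel_measurable_real[OF assms] AE_completion by auto

lemma integrable_iff_nn_integral_finite:
  fixes f :: "'a \<Rightarrow> real"
  assumes "\<And>x. f x \<ge> 0" "f \<in> borel_measurable M"
  shows "integrable M f \<longleftrightarrow> (\<integral>\<^sup>+x. ennreal (f x) \<partial>M) < \<infinity>"
  using assms by (simp add: integrable_iff_bounded)

lemma W_tilde_iff:
  fixes u :: "'a::euclidean_space \<Rightarrow> real"
  assumes "open \<Omega>"
  shows "u \<in> W_tilde s p \<Omega> \<longleftrightarrow> (\<forall>x. x \<notin> \<Omega> \<longrightarrow> u x = 0) \<and> u \<in> borel_measurable lebesgue \<and>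
    (\<integral>\<^sup>+x. ennreal (\<bar>u x\<bar> powr p) \<partial>lebesgue) < \<infinity> \<and> energy s p u < \<infinity>"
proof -
  have Om: "\<Omega> \<in> sets lebesgue" using assms by (simp add: borel_open)
  have "open (\<Omega> \<times> \<Omega>)" using assms by (simp add: open_Times)
  then have Om2: "\<Omega> \<times> \<Omega> \<in> sets lebesgue" by (simp add: borel_open)
  have U: "u \<in> Wsp s p UNIV \<longleftrightarrow> u \<in> borel_measurable lebesgue \<and>
    (\<integral>\<^sup>+x. ennreal (\<bar>u x\<bar> powr p) \<partial>lebesgue) < \<infinity> \<and> energy s p u < \<infinity>"
  proof (cases "u \<in> borel_measurable lebesgue")
    case True
    note [measurable] = True
    have "(\<lambda>x. \<bar>u x\<bar> powr p) \<in> borel_measurable lebesgue" by measurable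
    then show ?thesis using True
      by (simp add: Wsp_def Lp_def lebesgue_on_UNIV_eq integrable_iff_nn_integral_finite
          gagliardo_quotient_nonneg energy_def)
  qed (simp add: Wsp_def Lp_def lebesgue_on_UNIV_eq)
  have "u \<in> Wsp s p \<Omega>" if "u \<in> Wsp s p UNIV"
  proof -
    have m: "u \<in> borel_measurable lebesgue" and i1: "integrable lebesgue (\<lambda>x. \<bar>u x\<bar> powr p)"
      and i2: "integrable lebesgue (gagliardo_quotient s p u)"
      using that by (auto simp: Wsp_def Lp_def lebesgue_on_UNIV_eq)
    show ?thesis using Om Om2 m integrable_mult_indicator[OF Om i1] integrable_mult_indicator[OF
        Om2 i2]
      unfolding Wsp_def Lp_def by (simp add: integrable_restrict_space measurable_restrict_space1)
  qed
  then show ?thesis unfolding W_tilde_def using U by auto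
qed

lemma gagliardo_powr:
  fixes u :: "'a::euclidean_space \<Rightarrow> real"
  assumes "p > 0" "u \<in> borel_measurable lebesgue"
  shows "gagliardo s p UNIV u powr p = enn2real (energy s p u)"
  using assms
  by (simp add: gagliardo_def powr_powr lebesgue_on_UNIV_eq integral_eq_nn_integral
      gagliardo_quotient_nonneg energy_def)

lemma Lp_norm_eq_1_iff:
  assumes "p > 0"
  shows "Lp_norm p \<Omega> u = 1 \<longleftrightarrow> (LINT x|lebesgue_on \<Omega>. \<bar>u x\<bar> powr p) = 1"
proof -
  define I where "I = (LINT x|lebesgue_on \<Omega>. \<bar>u x\<bar> powr p)"
  have "I \<ge> 0" by (simp add: I_def)
  then have "I powr (1 / p) = 1 \<longleftrightarrow> I = 1"
    using assms powr_eq_one_iff_gen[of I "1 / p"] by (cases "I = 0"; cases "I = 1") auto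
  then show ?thesis by (simp add: Lp_norm_def I_def)
qed

lemma subcritical_embedding_lebesgue:
  fixes s p q :: real
  assumes sp: "0 < s" "1 < p" "1 < q" "real DIM('a::euclidean_space) / (s * p) < q"
  obtains C where "C > 0" "\<And>u T. u \<in> borel_measurable lebesgue \<Longrightarrow> T > 0 \<Longrightarrow>
    (\<integral>\<^sup>+x. ennreal (\<bar>u x\<bar> powr p) \<partial>lebesgue) \<le> ennreal T \<Longrightarrow> energy s p (u :: 'a \<Rightarrow> real) \<le> ennreal T \<Longrightarrow>
    (\<integral>\<^sup>+x. ennreal (\<bar>u x\<bar> powr (p * (q / (q - 1)))) \<partial>lebesgue) \<le> ennreal (C * T powr (q / (q - 1)))"
proof -
  obtain C where C: "C > 0" "\<And>T u. T > 0 \<Longrightarrow> u \<in> (energy_ball s p T :: ('a \<Rightarrow> real) set) \<Longrightarrow>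
    (\<integral>\<^sup>+x. ennreal (\<bar>u x\<bar> powr (p * (q / (q - 1)))) \<partial>lborel) \<le> ennreal (C * T powr (q / (q - 1)))"
    using subcritical_embedding[OF sp] by auto
  show ?thesis
  proof (rule that[OF C(1)])
    fix u :: "'a \<Rightarrow> real" and T :: real
    assume um: "u \<in> borel_measurable lebesgue" and T: "T > 0"
      and b: "(\<integral>\<^sup>+x. ennreal (\<bar>u x\<bar> powr p) \<partial>lebesgue) \<le> ennreal T" "energy s p u \<le> ennreal T"
    obtain u' where u': "u' \<in> borel_measurable borel" "AE x in lebesgue. u x = u' x"
      using lebesgue_ex_borel_version[OF um] .
    have e: "(\<integral>\<^sup>+x. ennreal (\<bar>u x\<bar> powr a) \<partial>lebesgue) = (\<integral>\<^sup>+x. ennreal (\<bar>u' x\<bar> powr a) \<partial>lborel)"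
        for a
    proof -
      have "(\<integral>\<^sup>+x. ennreal (\<bar>u x\<bar> powr a) \<partial>lebesgue) = (\<integral>\<^sup>+x. ennreal (\<bar>u' x\<bar> powr a) \<partial>lebesgue)"
        using u'(2) by (intro nn_integral_cong_AE) auto
      then show ?thesis by (simp add: nn_integral_completion)
    qed
    have "u' \<in> energy_ball s p T"
      using b u' energy_cong_AE[OF u'(2), of s p] energy_iterated[OF u'(1), of s p]
      by (simp add: energy_ball_def e)
    then show "(\<integral>\<^sup>+x. ennreal (\<bar>u x\<bar> powr (p * (q / (q - 1)))) \<partial>lebesgue)
        \<le> ennreal (C * T powr (q / (q - 1)))"
      using C(2)[OF T] e by simp
  qed
qed

lemma W_tilde_scale:
  assumes "open \<Omega>" "u \<in> W_tilde s p \<Omega>" "p > 0"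
  shows "(\<lambda>x. c * u x) \<in> W_tilde s p \<Omega>"
proof -
  have u: "u \<in> borel_measurable lebesgue" "\<forall>x. x \<notin> \<Omega> \<longrightarrow> u x = 0"
    "(\<integral>\<^sup>+x. ennreal (\<bar>u x\<bar> powr p) \<partial>lebesgue) < \<infinity>" "energy s p u < \<infinity>"
    using assms by (auto simp: W_tilde_iff)
  note [measurable] = u(1)
  have "gagliardo_quotient s p (\<lambda>x. c * u x) z = \<bar>c\<bar> powr p * gagliardo_quotient s p u z" for z
    by (simp add: gagliardo_quotient_alt abs_mult powr_mult flip: right_diff_distrib)
  then have "energy s p (\<lambda>x. c * u x) = ennreal (\<bar>c\<bar> powr p) * energy s p u"
    unfolding energy_def by (simp add: ennreal_mult gagliardo_quotient_nonneg nn_integral_cmult)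
  moreover have "(\<integral>\<^sup>+x. ennreal (\<bar>c * u x\<bar> powr p) \<partial>lebesgue)
      = ennreal (\<bar>c\<bar> powr p) * (\<integral>\<^sup>+x. ennreal (\<bar>u x\<bar> powr p) \<partial>lebesgue)"
    by (simp add: abs_mult powr_mult ennreal_mult nn_integral_cmult)
  ultimately show ?thesis using u by (simp add: W_tilde_iff[OF assms(1)] ennreal_mult_less_top)
qed

lemma W_tilde_normalized_exists:
  fixes \<Omega> :: "'a::euclidean_space set"
  assumes "open \<Omega>" "\<Omega> \<noteq> {}" and sp: "0 < s" "s < 1" "1 < p"
  obtains u where "u \<in> W_tilde s p \<Omega>" "(LINT x|lebesgue. \<bar>u x\<bar> powr p) = 1"
proof -
  obtain x0 e where e: "x0 \<in> \<Omega>" "e > 0" "ball x0 e \<subseteq> \<Omega>"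
    using assms(1,2) open_contains_ball by (metis ex_in_conv)
  define \<rho> where "\<rho> = min 1 e"
  define u where "u x = max 0 (\<rho> - dist x x0)" for x
  have \<rho>: "0 < \<rho>" "\<rho> \<le> 1" "ball x0 \<rho> \<subseteq> \<Omega>" using e by (auto simp: \<rho>_def)
  have um [measurable]: "u \<in> borel_measurable borel" unfolding u_def by measurable
  have E: "energy s p u < \<infinity>"
    using bump_energy_finite[OF sp \<rho>(1,2), of x0] by (simp add: energy_iterated[OF um] flip: u_def)
  have zero: "u x = 0" if "x \<notin> ball x0 \<rho>" for x using that by (simp add: u_def dist_commute)
  have u1: "0 \<le> u x" "u x \<le> 1" for x using \<rho> zero_le_dist[of x x0]
      by (auto simp: u_def simp del: zero_le_dist)
  have L: "(\<integral>\<^sup>+x. ennreal (\<bar>u x\<bar> powr p) \<partial>lborel) < \<infinity>"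
  proof -
    have "(\<integral>\<^sup>+x. ennreal (\<bar>u x\<bar> powr p) \<partial>lborel) \<le> (\<integral>\<^sup>+x. indicator (ball x0 \<rho>) x \<partial>lborel)"
    proof (intro nn_integral_mono)
      fix x
      have "\<bar>u x\<bar> powr p \<le> 1 powr p" using u1 sp by (intro powr_mono2) auto
      then show "ennreal (\<bar>u x\<bar> powr p) \<le> indicator (ball x0 \<rho>) x"
        using zero[of x] by (auto simp: indicator_def)
    qed
    also have "\<dots> < \<infinity>" using \<rho> by (simp add: emeasure_ball)
    finally show ?thesis .
  qed
  have um': "u \<in> borel_measurable lebesgue" using um by (intro measurable_completion) simp
  have supp: "\<forall>x. x \<notin> \<Omega> \<longrightarrow> u x = 0" using zero \<rho>(3) by blast
  have uW: "u \<in> W_tilde s p \<Omega>"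
    using E L um' supp unfolding W_tilde_iff[OF assms(1)] by (simp add: nn_integral_completion)
  define I where "I = (LINT x|lebesgue. \<bar>u x\<bar> powr p)"
  have int: "integrable lebesgue (\<lambda>x. \<bar>u x\<bar> powr p)"
    using L by (subst integrable_iff_nn_integral_finite) (auto simp: nn_integral_completion
        intro!: measurable_completion)
  have "I \<noteq> 0"
  proof
    assume "I = 0"
    then have "AE x in lebesgue. \<bar>u x\<bar> powr p = 0"
      using integral_nonneg_eq_0_iff_AE[OF int] by (simp add: I_def)
    then have "AE x in lborel. x \<notin> ball x0 \<rho>"
      unfolding AE_completion_iff by eventually_elim (auto simp: u_def dist_commute)
    then have "ball x0 \<rho> \<in> null_sets lborel" by (subst (asm) AE_iff_null_sets[symmetric]) auto
    then show False using \<rho> unit_ball_vol_pos[of "real DIM('a)"]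
        by (auto simp: null_sets_def emeasure_ball)
  qed
  moreover have "I \<ge> 0" by (simp add: I_def)
  ultimately have I: "I > 0" by simp
  show ?thesis
  proof (rule that)
    show "(\<lambda>x. I powr (- 1 / p) * u x) \<in> W_tilde s p \<Omega>"
      by (rule W_tilde_scale[OF assms(1) uW]) (use sp in simp)
    have c: "(I powr (- 1 / p)) powr p = inverse I"
    proof -
      have "(I powr (- 1 / p)) powr p = I powr (- 1 / p * p)" by (rule powr_powr)
      also have "- 1 / p * p = - 1" using sp by simp
      finally show ?thesis using I by (simp add: powr_minus)
    qed
    have "(LINT x|lebesgue. \<bar>I powr (- 1 / p) * u x\<bar> powr p)
        = (LINT x|lebesgue. inverse I * \<bar>u x\<bar> powr p)"
      by (simp only: abs_mult powr_mult) (simp only: abs_of_nonneg[OF powr_ge_zero] c)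
    then show "(LINT x|lebesgue. \<bar>I powr (- 1 / p) * u x\<bar> powr p) = 1"
      using I by (simp flip: I_def)
  qed
qed

section \<open>The variational problem in terms of densities\<close>

lemma energy_abs_le: "energy s p (\<lambda>x. \<bar>u x\<bar>) \<le> energy s p u" if "p > 0"
  unfolding energy_def
proof (intro nn_integral_mono ennreal_leI)
  fix z :: "'a \<times> 'a"
  have "\<bar>\<bar>u (fst z)\<bar> - \<bar>u (snd z)\<bar>\<bar> powr p \<le> \<bar>u (fst z) - u (snd z)\<bar> powr p"
    using that by (intro powr_mono2 abs_triangle_ineq3) auto
  then show "gagliardo_quotient s p (\<lambda>x. \<bar>u x\<bar>) z \<le> gagliardo_quotient s p u z"
    unfolding gagliardo_quotient_alt by (rule divide_right_mono) simp
qed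

lemma gagliardo_quotient_lp_mean_le:
  assumes "1 < p" "\<alpha> > 0" "\<beta> > 0" "\<alpha> + \<beta> = 1" "\<And>x. u x \<ge> 0" "\<And>x. v x \<ge> 0"
  shows "gagliardo_quotient s p (\<lambda>x. lp_mean p \<alpha> \<beta> (u x) (v x)) z
     \<le> \<alpha> * gagliardo_quotient s p u z + \<beta> * gagliardo_quotient s p v z"
proof -
  let ?d = "norm (fst z - snd z) powr (real DIM('a) + s * p)"
  have "\<bar>lp_mean p \<alpha> \<beta> (u (fst z)) (v (fst z)) - lp_mean p \<alpha> \<beta> (u (snd z)) (v (snd z))\<bar> powr p / ?d
    \<le> (\<alpha> * \<bar>u (fst z) - u (snd z)\<bar> powr p + \<beta> * \<bar>v (fst z) - v (snd z)\<bar> powr p) / ?d"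
    by (intro divide_right_mono hidden_convexity(1)) (use assms in auto)
  then show ?thesis unfolding gagliardo_quotient_alt by (simp add: add_divide_distrib)
qed

lemma energy_lp_mean_le:
  fixes u v :: "'a::euclidean_space \<Rightarrow> real"
  assumes "1 < p" "\<alpha> > 0" "\<beta> > 0" "\<alpha> + \<beta> = 1" "\<And>x. u x \<ge> 0" "\<And>x. v x \<ge> 0"
    and [measurable]: "u \<in> borel_measurable lebesgue" "v \<in> borel_measurable lebesgue"
  shows "energy s p (\<lambda>x. lp_mean p \<alpha> \<beta> (u x) (v x))
      \<le> ennreal \<alpha> * energy s p u + ennreal \<beta> * energy s p v"
proof -
  have "energy s p (\<lambda>x. lp_mean p \<alpha> \<beta> (u x) (v x))
    \<le> (\<integral>\<^sup>+z. ennreal \<alpha> * ennreal (gagliardo_quotient s p u z)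
        + ennreal \<beta> * ennreal (gagliardo_quotient s p v z) \<partial>lebesgue)"
    unfolding energy_def
  proof (rule nn_integral_mono)
    fix z :: "'a \<times> 'a"
    have "ennreal (gagliardo_quotient s p (\<lambda>x. lp_mean p \<alpha> \<beta> (u x) (v x)) z)
      \<le> ennreal (\<alpha> * gagliardo_quotient s p u z + \<beta> * gagliardo_quotient s p v z)"
      by (intro ennreal_leI gagliardo_quotient_lp_mean_le) (use assms in auto)
    also have "\<dots> = ennreal \<alpha> * ennreal (gagliardo_quotient s p u z)
        + ennreal \<beta> * ennreal (gagliardo_quotient s p v z)"
      using assms(2,3) by (simp add: ennreal_plus ennreal_mult gagliardo_quotient_nonneg)
    finally show "ennreal (gagliardo_quotient s p (\<lambda>x. lp_mean p \<alpha> \<beta> (u x) (v x)) z)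
      \<le> ennreal \<alpha> * ennreal (gagliardo_quotient s p u z)
          + ennreal \<beta> * ennreal (gagliardo_quotient s p v z)" .
  qed
  also have "\<dots> = ennreal \<alpha> * energy s p u + ennreal \<beta> * energy s p v"
    unfolding energy_def by (simp add: nn_integral_add nn_integral_cmult)
  finally show ?thesis .
qed

lemma energy_liminf_le:
  fixes f :: "nat \<Rightarrow> 'a::euclidean_space \<Rightarrow> real"
  assumes p: "p > 0" and [measurable]: "\<And>k. f k \<in> borel_measurable lebesgue"
    and conv: "AE x in lebesgue. (\<lambda>k. f k x) \<longlonglongrightarrow> u x"
  shows "energy s p u \<le> liminf (\<lambda>k. energy s p (f k))"
proof -
  have "energy s p u = (\<integral>\<^sup>+z. liminf (\<lambda>k. ennreal (gagliardo_quotient s p (f k) z)) \<partial>lebesgue)"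
    unfolding energy_def
  proof (rule nn_integral_cong_AE)
    show "AE z in lebesgue. ennreal (gagliardo_quotient s p u z)
        = liminf (\<lambda>k. ennreal (gagliardo_quotient s p (f k) z))"
      using AE_lebesgue_fst_snd[OF conv]
    proof eventually_elim
      case (elim z)
      have "(\<lambda>k. \<bar>f k (fst z) - f k (snd z)\<bar>) \<longlonglongrightarrow> \<bar>u (fst z) - u (snd z)\<bar>"
        using elim by (intro tendsto_intros) auto
      then have "(\<lambda>k. \<bar>f k (fst z) - f k (snd z)\<bar> powr p) \<longlonglongrightarrow> \<bar>u (fst z) - u (snd z)\<bar> powr p"
        using p by (intro tendsto_powr') auto
      from tendsto_mult[OF this tendsto_const[of "inverse (norm (fst z - snd z) powr (real DIM('a)
          + s * p))"]]
      have "(\<lambda>k. gagliardo_quotient s p (f k) z) \<longlonglongrightarrow> gagliardo_quotient s p u z"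
        unfolding gagliardo_quotient_alt by (simp add: divide_inverse)
      then have "(\<lambda>k. ennreal (gagliardo_quotient s p (f k) z))
          \<longlonglongrightarrow> ennreal (gagliardo_quotient s p u z)"
        by (rule tendsto_ennrealI)
      then show ?case using lim_imp_Liminf[OF sequentially_bot] by metis
    qed
  qed
  also have "\<dots> \<le> liminf (\<lambda>k. energy s p (f k))"
    unfolding energy_def by (rule nn_integral_liminf) measurable
  finally show ?thesis .
qed

text \<open>The data of the problem, with \<open>r\<close> the exponent conjugate to \<open>q\<close>.\<close>

locale subcritical_problem =
  fixes s p q r :: real and \<Omega> :: "'a::euclidean_space set"
  assumes s: "0 < s" "s < 1" and p: "1 < p"
    and \<Omega>: "open \<Omega>" "bounded \<Omega>" "\<Omega> \<noteq> {}"
    and q: "1 < q" "real DIM('a) / (s * p) < q" and r_def: "r = q / (q - 1)"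
begin

lemma r: "1 < r" "1 / q + 1 / r = 1" "1 / r + 1 / q = 1"
  using q by (auto simp: r_def field_simps)

lemma \<Omega>_sets [measurable]: "\<Omega> \<in> sets lebesgue"
  using \<Omega> by (simp add: borel_open)

lemma finite_measure_\<Omega>: "finite_measure (lebesgue_on \<Omega>)"
  using \<Omega> by (intro finite_measure_lebesgue_on lmeasurable_open)

lemma nn_integral_\<Omega>:
  assumes "\<And>x. x \<notin> \<Omega> \<Longrightarrow> f x = 0"
  shows "(\<integral>\<^sup>+x. f x \<partial>lebesgue_on \<Omega>) = (\<integral>\<^sup>+x. f x \<partial>lebesgue)"
proof -
  have "(\<integral>\<^sup>+x. f x \<partial>lebesgue_on \<Omega>) = (\<integral>\<^sup>+x. f x * indicator \<Omega> x \<partial>lebesgue)"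
    by (rule nn_integral_restrict_space) simp
  also have "\<dots> = (\<integral>\<^sup>+x. f x \<partial>lebesgue)"
    using assms by (intro nn_integral_cong) (auto simp: indicator_def)
  finally show ?thesis .
qed

text \<open>The densities \<open>w = |u|\<^sup>p\<close> of the functions \<open>u \<ge> 0\<close> in \<open>W_tilde\<close> with \<open>\<parallel>u\<parallel>\<^sub>p = 1\<close>.  In terms of
  \<open>w\<close> the constraint is linear and all the functionals below are convex.\<close>

definition dens :: "('a \<Rightarrow> real) set" where
  "dens = {w. (\<forall>x. 0 \<le> w x) \<and> (\<forall>x. x \<notin> \<Omega> \<longrightarrow> w x = 0) \<and> w \<in> borel_measurable lebesgue \<and>
     (\<integral>\<^sup>+x. ennreal (w x) \<partial>lebesgue) = 1 \<and> energy s p (\<lambda>x. w x powr (1 / p)) < \<infinity>}"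

text \<open>Half of the Gagliardo double integral of the root \<open>u\<close> of \<open>w\<close>, and the \<open>r\<close>-th power of the
  \<open>L\<^sup>r\<close> norm of \<open>w\<close>.\<close>

definition en :: "('a \<Rightarrow> real) \<Rightarrow> real" where
  "en w = enn2real (energy s p (\<lambda>x. w x powr (1 / p))) / 2"

definition mass :: "('a \<Rightarrow> real) \<Rightarrow> real" where
  "mass w = (LINT x|lebesgue_on \<Omega>. w x powr r)"

text \<open>The functional whose infimum over \<open>dens\<close> is the first eigenvalue for the potential \<open>V\<close>; it is
  affine in \<open>V\<close> and convex in the density.\<close>

definition J :: "('a \<Rightarrow> real) \<Rightarrow> ('a \<Rightarrow> real) \<Rightarrow> real" where
  "J V w = en w + (LINT x|lebesgue_on \<Omega>. V x * w x)"

lemma densD: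
  assumes "w \<in> dens"
  shows "w x \<ge> 0" "x \<notin> \<Omega> \<Longrightarrow> w x = 0" "w \<in> borel_measurable lebesgue"
    "w \<in> borel_measurable (lebesgue_on \<Omega>)"
    "(\<integral>\<^sup>+x. ennreal (w x) \<partial>lebesgue) = 1" "energy s p (\<lambda>x. w x powr (1 / p)) < \<infinity>"
    "integrable (lebesgue_on \<Omega>) w" "(LINT x|lebesgue_on \<Omega>. w x) = 1"
    "energy s p (\<lambda>x. w x powr (1 / p)) = ennreal (2 * en w)" "en w \<ge> 0"
    "(\<integral>\<^sup>+x. ennreal (w x) \<partial>lebesgue_on \<Omega>) = 1"
proof -
  show w: "w x \<ge> 0" "x \<notin> \<Omega> \<Longrightarrow> w x = 0" "w \<in> borel_measurable lebesgue"
    "(\<integral>\<^sup>+x. ennreal (w x) \<partial>lebesgue) = 1" "energy s p (\<lambda>x. w x powr (1 / p)) < \<infinity>" for x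
    using assms by (auto simp: dens_def)
  show m: "w \<in> borel_measurable (lebesgue_on \<Omega>)" by (rule measurable_restrict_space1[OF w(3)])
  show n: "(\<integral>\<^sup>+x. ennreal (w x) \<partial>lebesgue_on \<Omega>) = 1" using w nn_integral_\<Omega> by simp
  then show "integrable (lebesgue_on \<Omega>) w"
    using w(1) m by (subst integrable_iff_nn_integral_finite) auto
  show "(LINT x|lebesgue_on \<Omega>. w x) = 1" using w(1) m n by (subst integral_eq_nn_integral) auto
  show "energy s p (\<lambda>x. w x powr (1 / p)) = ennreal (2 * en w)" using w(5) by (simp add: en_def)
  show "en w \<ge> 0" by (simp add: en_def)
qed

lemma dens_root:
  assumes w: "w \<in> dens"
  defines "u \<equiv> \<lambda>x. w x powr (1 / p)"
  shows "u \<in> W_tilde s p \<Omega>" "Lp_norm p UNIV u = 1" "gagliardo s p UNIV u powr p = 2 * en w"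
    "\<bar>u x\<bar> powr p = w x"
proof -
  note D = densD[OF w]
  note [measurable] = D(3)
  show e: "\<bar>u x\<bar> powr p = w x" for x using p D(1)[of x] by (simp add: u_def powr_powr)
  have um: "u \<in> borel_measurable lebesgue" unfolding u_def by measurable
  show "u \<in> W_tilde s p \<Omega>"
    using D um p unfolding W_tilde_iff[OF \<Omega>(1)] e by (simp add: u_def)
  show "Lp_norm p UNIV u = 1"
    using D p by (simp add: Lp_norm_eq_1_iff e lebesgue_on_UNIV_eq integral_eq_nn_integral)
  show "gagliardo s p UNIV u powr p = 2 * en w"
    using p um by (simp add: gagliardo_powr en_def u_def)
qed

lemma dens_of_W_tilde:
  assumes u: "u \<in> W_tilde s p \<Omega>" "Lp_norm p UNIV u = 1"
  shows "(\<lambda>x. \<bar>u x\<bar> powr p) \<in> dens" "en (\<lambda>x. \<bar>u x\<bar> powr p) \<le> gagliardo s p UNIV u powr p / 2"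
proof -
  have U: "\<And>x. x \<notin> \<Omega> \<Longrightarrow> u x = 0" "u \<in> borel_measurable lebesgue"
    "(\<integral>\<^sup>+x. ennreal (\<bar>u x\<bar> powr p) \<partial>lebesgue) < \<infinity>" "energy s p u < \<infinity>"
    using u(1) by (auto simp: W_tilde_iff[OF \<Omega>(1)])
  note [measurable] = U(2)
  have root: "(\<bar>u x\<bar> powr p) powr (1 / p) = \<bar>u x\<bar>" for x using p by (simp add: powr_powr)
  have e: "energy s p (\<lambda>x. (\<bar>u x\<bar> powr p) powr (1 / p)) \<le> energy s p u"
    unfolding root using p by (intro energy_abs_le) simp
  have "integrable lebesgue (\<lambda>x. \<bar>u x\<bar> powr p)"
    using U(3) by (subst integrable_iff_nn_integral_finite) auto
  then have "(\<integral>\<^sup>+x. ennreal (\<bar>u x\<bar> powr p) \<partial>lebesgue) = ennreal (LINT x|lebesgue. \<bar>u x\<bar> powr p)"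
    by (intro nn_integral_eq_integral) auto
  also have "\<dots> = 1" using u(2) p by (simp add: Lp_norm_eq_1_iff lebesgue_on_UNIV_eq)
  finally show "(\<lambda>x. \<bar>u x\<bar> powr p) \<in> dens" using U e by (auto simp: dens_def)
  show "en (\<lambda>x. \<bar>u x\<bar> powr p) \<le> gagliardo s p UNIV u powr p / 2"
    using e U p by (auto simp: en_def gagliardo_powr intro!: divide_right_mono enn2real_mono)
qed

lemma dens_nonempty: "dens \<noteq> {}"
proof -
  obtain u where u: "u \<in> W_tilde s p \<Omega>" "(LINT x|lebesgue. \<bar>u x\<bar> powr p) = 1"
    using W_tilde_normalized_exists[OF \<Omega>(1,3) s p] .
  then have "Lp_norm p UNIV u = 1" using p by (simp add: Lp_norm_eq_1_iff lebesgue_on_UNIV_eq)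
  then show ?thesis using dens_of_W_tilde[OF u(1)] by blast
qed

lemma dens_embedding:
  obtains C where "C > 0" "\<And>w. w \<in> dens \<Longrightarrow> integrable (lebesgue_on \<Omega>) (\<lambda>x. w x powr r)"
    "\<And>w. w \<in> dens \<Longrightarrow> mass w \<le> C * (1 + 2 * en w) powr r"
proof -
  obtain C where C: "C > 0" "\<And>u T. u \<in> borel_measurable lebesgue \<Longrightarrow> T > 0 \<Longrightarrow>
    (\<integral>\<^sup>+x. ennreal (\<bar>u x\<bar> powr p) \<partial>lebesgue) \<le> ennreal T \<Longrightarrow> energy s p (u :: 'a \<Rightarrow> real) \<le> ennreal T \<Longrightarrow>
    (\<integral>\<^sup>+x. ennreal (\<bar>u x\<bar> powr (p * r)) \<partial>lebesgue) \<le> ennreal (C * T powr r)"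
    using subcritical_embedding_lebesgue[OF s(1) p q] unfolding r_def by blast
  have main: "(\<integral>\<^sup>+x. ennreal (w x powr r) \<partial>lebesgue_on \<Omega>) \<le> ennreal (C * (1 + 2 * en w) powr r)"
    if w: "w \<in> dens" for w
  proof -
    note D = densD[OF w]
    note [measurable] = D(3)
    let ?u = "\<lambda>x. w x powr (1 / p)"
    have e: "\<bar>?u x\<bar> powr p = w x" "\<bar>?u x\<bar> powr (p * r) = w x powr r" for x
      using p D(1)[of x] by (auto simp: powr_powr)
    have "(\<integral>\<^sup>+x. ennreal (w x powr r) \<partial>lebesgue) \<le> ennreal (C * (1 + 2 * en w) powr r)"
      using C(2)[of ?u "1 + 2 * en w"] D unfolding e by simp
    then show ?thesis using D(2) nn_integral_\<Omega>[of "\<lambda>x. ennreal (w x powr r)"] by simp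
  qed
  have int: "integrable (lebesgue_on \<Omega>) (\<lambda>x. w x powr r)" if "w \<in> dens" for w
    using main[OF that] densD(4)[OF that]
    by (subst integrable_iff_nn_integral_finite) (auto intro: le_less_trans)
  show ?thesis
  proof (rule that[OF C(1) int])
    fix w assume w: "w \<in> dens"
    have "ennreal (mass w) \<le> ennreal (C * (1 + 2 * en w) powr r)"
      using main[OF w] unfolding mass_def
          by (subst nn_integral_eq_integral[OF int[OF w], symmetric]) auto
    then show "mass w \<le> C * (1 + 2 * en w) powr r" using C(1) by (subst (asm) ennreal_le_iff) auto
  qed
qed

lemma dens_powr_integrable: "w \<in> dens \<Longrightarrow> integrable (lebesgue_on \<Omega>) (\<lambda>x. w x powr r)"
  using dens_embedding by blast

lemma mass_pos:
  assumes w: "w \<in> dens"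
  shows "mass w > 0"
proof -
  have "mass w \<noteq> 0"
  proof
    assume "mass w = 0"
    then have "AE x in lebesgue_on \<Omega>. w x powr r = 0"
      unfolding mass_def using integral_nonneg_eq_0_iff_AE[OF dens_powr_integrable[OF w]] by simp
    then have "AE x in lebesgue_on \<Omega>. w x = 0" by eventually_elim simp
    then have "(LINT x|lebesgue_on \<Omega>. w x) = 0" by (rule integral_eq_zero_AE)
    then show False using densD(8)[OF w] by simp
  qed
  moreover have "mass w \<ge> 0" unfolding mass_def by simp
  ultimately show ?thesis by simp
qed

lemma Young_product_integrable:
  assumes "V \<in> Lp q \<Omega>" "w \<in> borel_measurable (lebesgue_on \<Omega>)" "\<And>x. w x \<ge> 0"
    "integrable (lebesgue_on \<Omega>) (\<lambda>x. w x powr r)"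
  shows "integrable (lebesgue_on \<Omega>) (\<lambda>x. V x * w x)"
proof (rule Bochner_Integration.integrable_bound)
  have V: "V \<in> borel_measurable (lebesgue_on \<Omega>)" "integrable (lebesgue_on \<Omega>) (\<lambda>x. \<bar>V x\<bar> powr q)"
    using assms by (auto simp: Lp_def)
  show "integrable (lebesgue_on \<Omega>) (\<lambda>x. \<bar>V x\<bar> powr q / q + w x powr r / r)"
    using V assms by simp
  show "(\<lambda>x. V x * w x) \<in> borel_measurable (lebesgue_on \<Omega>)" using V assms by measurable
  show "AE x in lebesgue_on \<Omega>. norm (V x * w x) \<le> norm (\<bar>V x\<bar> powr q / q + w x powr r / r)"
  proof (intro AE_I2)
    fix x
    have "\<bar>V x\<bar> * w x \<le> \<bar>V x\<bar> powr q / q + w x powr r / r"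
      using q r assms by (intro Youngs_inequality) auto
    then show "norm (V x * w x) \<le> norm (\<bar>V x\<bar> powr q / q + w x powr r / r)"
      using assms(3)[of x] by (simp add: abs_mult)
  qed
qed

lemma dens_product_integrable:
  "V \<in> Lp q \<Omega> \<Longrightarrow> w \<in> dens \<Longrightarrow> integrable (lebesgue_on \<Omega>) (\<lambda>x. V x * w x)"
  using Young_product_integrable densD dens_powr_integrable by blast

end

section \<open>Existence of a minimizer\<close>

lemma eventually_less_of_le_liminf:
  fixes a \<delta> :: real and b :: "nat \<Rightarrow> real"
  assumes "ennreal a \<le> liminf (\<lambda>k. ennreal (b k))" "\<delta> > 0" "\<And>k. b k \<ge> 0"
  shows "eventually (\<lambda>k. a - \<delta> < b k) sequentially"
proof (cases "a - \<delta> < 0")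
  case True
  then show ?thesis using assms(3) by (intro always_eventually allI) (meson less_le_trans)
next
  case False
  then have "ennreal (a - \<delta>) < ennreal a" using assms(2) by (intro ennreal_lessI) auto
  then have "eventually (\<lambda>k. ennreal (a - \<delta>) < ennreal (b k)) sequentially"
    using assms(1) by (intro less_LiminfD) (rule less_le_trans)
  then show ?thesis by (rule eventually_mono) (use False in \<open>auto simp: ennreal_less_iff\<close>)
qed

context subcritical_problem
begin

text \<open>On the unit sphere of \<open>L\<^sup>p\<close> the potential term is controlled by the energy: the part of \<open>V\<close>
  where \<open>|V|\<close> is large has small \<open>L\<^sup>q\<close> norm.\<close>

lemma J_bounded_below:
  assumes V: "V \<in> Lp q \<Omega>"
  shows "\<exists>c. \<forall>w\<in>dens. c \<le> J V w"
proof -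
  obtain C where C: "C > 0" "\<And>w. w \<in> dens \<Longrightarrow> mass w \<le> C * (1 + 2 * en w) powr r"
    using dens_embedding by metis
  define \<kappa> where "\<kappa> = 1 / (2 * (1 + C))"
  have \<kappa>: "\<kappa> > 0" using C by (simp add: \<kappa>_def)
  have Vm [measurable]: "V \<in> borel_measurable (lebesgue_on \<Omega>)"
    and Vi: "integrable (lebesgue_on \<Omega>) (\<lambda>x. \<bar>V x\<bar> powr q)"
    using V by (auto simp: Lp_def)
  define T where "T k x = (if \<bar>V x\<bar> > real k then \<bar>V x\<bar> powr q else 0)" for k x
  have Tm [measurable]: "T k \<in> borel_measurable (lebesgue_on \<Omega>)" for k
    unfolding T_def by measurable
  have Ti: "integrable (lebesgue_on \<Omega>) (T k)" for k
    by (rule Bochner_Integration.integrable_bound[OF Vi Tm]) (auto simp: T_def)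
  have "(\<lambda>k. LINT x|lebesgue_on \<Omega>. T k x) \<longlonglongrightarrow> (LINT x|lebesgue_on \<Omega>. 0)"
  proof (rule integral_dominated_convergence[OF _ Tm Vi])
    show "AE x in lebesgue_on \<Omega>. (\<lambda>k. T k x) \<longlonglongrightarrow> 0"
    proof (intro AE_I2)
      fix x
      obtain k0 where k0: "\<bar>V x\<bar> < real k0" using reals_Archimedean2 by blast
      have "eventually (\<lambda>k. T k x = 0) sequentially"
        using eventually_ge_at_top[of k0] by eventually_elim (use k0 in \<open>auto simp: T_def\<close>)
      then show "(\<lambda>k. T k x) \<longlonglongrightarrow> 0" by (rule tendsto_eventually)
    qed
  qed (auto simp: T_def)
  then have "eventually (\<lambda>k. (LINT x|lebesgue_on \<Omega>. T k x) < \<kappa> powr q) sequentially"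
    using \<kappa> by (intro order_tendstoD(2)[of _ "0::real"]) auto
  then obtain k where k: "(LINT x|lebesgue_on \<Omega>. T k x) < \<kappa> powr q"
    by (auto simp: eventually_sequentially)
  show ?thesis
  proof (intro exI ballI)
    fix w assume w: "w \<in> dens"
    note D = densD[OF w]
    define t where "t = 1 + 2 * en w"
    have t: "t > 0" using D(10) by (simp add: t_def)
    have wi: "integrable (lebesgue_on \<Omega>) (\<lambda>x. w x powr r)" by (rule dens_powr_integrable[OF w])
    let ?b = "\<lambda>x. real k * w x + \<kappa> * t * (T k x / \<kappa> powr q / q + w x powr r / t powr r / r)"
    have pt: "\<bar>V x * w x\<bar> \<le> ?b x" for x
    proof (cases "\<bar>V x\<bar> > real k")
      case True
      have "\<bar>V x\<bar> / \<kappa> * (w x / t) \<le> (\<bar>V x\<bar> / \<kappa>) powr q / q + (w x / t) powr r / r"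
        using q r D(1)[of x] \<kappa> t by (intro Youngs_inequality) auto
      also have "\<dots> = T k x / \<kappa> powr q / q + w x powr r / t powr r / r"
        using True by (simp add: T_def powr_divide)
      finally have "\<kappa> * t * (\<bar>V x\<bar> / \<kappa> * (w x / t))
          \<le> \<kappa> * t * (T k x / \<kappa> powr q / q + w x powr r / t powr r / r)"
        using \<kappa> t by (intro mult_left_mono) auto
      moreover have "\<kappa> * t * (\<bar>V x\<bar> / \<kappa> * (w x / t)) = \<bar>V x * w x\<bar>"
        using \<kappa> t D(1)[of x] by (simp add: abs_mult)
      ultimately show ?thesis using D(1)[of x] by (simp add: add_increasing)
    next
      case False
      then have "\<bar>V x * w x\<bar> \<le> real k * w x" using D(1)[of x]
          by (auto simp: abs_mult intro: mult_right_mono)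
      moreover have "0 \<le> \<kappa> * t * (T k x / \<kappa> powr q / q + w x powr r / t powr r / r)"
        using \<kappa> t q r by (intro mult_nonneg_nonneg add_nonneg_nonneg) (auto simp: T_def)
      ultimately show ?thesis by linarith
    qed
    have bi: "integrable (lebesgue_on \<Omega>) ?b"
      by (intro Bochner_Integration.integrable_add integrable_mult_right integrable_divide D(7) Ti
          wi)
    have "\<bar>LINT x|lebesgue_on \<Omega>. V x * w x\<bar> \<le> (LINT x|lebesgue_on \<Omega>. \<bar>V x * w x\<bar>)"
      by (rule integral_abs_bound)
    also have "\<dots> \<le> (LINT x|lebesgue_on \<Omega>. ?b x)"
      by (intro integral_mono bi pt integrable_abs dens_product_integrable V w)
    also have "\<dots>
        = real k * (LINT x|lebesgue_on \<Omega>. w x)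
        + \<kappa> * t * ((LINT x|lebesgue_on \<Omega>. T k x) / \<kappa> powr q / q + mass w / t powr r / r)"
      unfolding mass_def using D(7) Ti[of k] wi by simp
    also have "\<dots> \<le> real k + \<kappa> * t * (1 + C)"
    proof -
      have "(LINT x|lebesgue_on \<Omega>. T k x) / \<kappa> powr q / q \<le> 1 / 1"
        using k \<kappa> q by (intro frac_le) (auto simp: divide_simps)
      moreover have "mass w / t powr r / r \<le> C / 1"
        using C(2)[OF w] C(1) t r mass_pos[OF w] by (intro frac_le) (auto simp: t_def divide_simps)
      ultimately show ?thesis using \<kappa> t D(8) by (simp add: mult_left_mono)
    qed
    also have "\<kappa> * t * (1 + C) = 1 / 2 + en w"
      using C(1) by (simp add: \<kappa>_def t_def field_simps)
    finally show "- (real k + 1 / 2) \<le> J V w" by (simp add: J_def)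
  qed
qed

lemma J_le_energy_functional:
  assumes "u \<in> W_tilde s p \<Omega>" "Lp_norm p UNIV u = 1"
  shows "J V (\<lambda>x. \<bar>u x\<bar> powr p)
     \<le> 1 / 2 * gagliardo s p UNIV u powr p + (LINT x|lebesgue_on \<Omega>. V x * \<bar>u x\<bar> powr p)"
  using dens_of_W_tilde(2)[OF assms] by (simp add: J_def)

text \<open>The two lemmas that express the first eigenvalue as the infimum of \<open>J V\<close> over \<open>dens\<close>.  In the
  first one boundedness from below is essential, since an infimum of an unbounded set of reals
  has no meaning.\<close>

lemma first_eigenvalue_le:
  assumes V: "V \<in> Lp q \<Omega>" and w: "w \<in> dens"
  shows "first_eigenvalue s p \<Omega> V \<le> J V w"
  unfolding first_eigenvalue_def
proof (rule cInf_lower)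
  obtain c where c: "\<And>w. w \<in> dens \<Longrightarrow> c \<le> J V w" using J_bounded_below[OF V] by blast
  show "bdd_below {1 / 2 * gagliardo s p UNIV u powr p
      + (LINT x|lebesgue_on \<Omega>. V x * \<bar>u x\<bar> powr p) |u.
            u \<in> W_tilde s p \<Omega> \<and> Lp_norm p UNIV u = 1}"
    using c dens_of_W_tilde(1) J_le_energy_functional[of _ V]
    by (intro bdd_belowI[of _ c]) (auto, meson order_trans)
  show "J V w \<in> {1 / 2 * gagliardo s p UNIV u powr p
      + (LINT x|lebesgue_on \<Omega>. V x * \<bar>u x\<bar> powr p) |u.
            u \<in> W_tilde s p \<Omega> \<and> Lp_norm p UNIV u = 1}"
    unfolding mem_Collect_eq using dens_root[OF w]
    by (intro exI[of _ "\<lambda>x. w x powr (1 / p)"] conjI) (simp_all add: J_def)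
qed

lemma le_first_eigenvalue:
  assumes "\<And>w. w \<in> dens \<Longrightarrow> c \<le> J V w"
  shows "c \<le> first_eigenvalue s p \<Omega> V"
  unfolding first_eigenvalue_def
proof (rule cInf_greatest)
  obtain w where "w \<in> dens" using dens_nonempty by blast
  then show "{1 / 2 * gagliardo s p UNIV u powr p + (LINT x|lebesgue_on \<Omega>. V x * \<bar>u x\<bar> powr p) |u.
            u \<in> W_tilde s p \<Omega> \<and> Lp_norm p UNIV u = 1} \<noteq> {}"
    using dens_root by blast
next
  fix y assume "y \<in> {1 / 2 * gagliardo s p UNIV u powr p
      + (LINT x|lebesgue_on \<Omega>. V x * \<bar>u x\<bar> powr p) |u.
            u \<in> W_tilde s p \<Omega> \<and> Lp_norm p UNIV u = 1}"
  then obtain u where "u \<in> W_tilde s p \<Omega>" "Lp_norm p UNIV u = 1"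
    "y = 1 / 2 * gagliardo s p UNIV u powr p + (LINT x|lebesgue_on \<Omega>. V x * \<bar>u x\<bar> powr p)" by blast
  then show "c \<le> y"
    using assms[OF dens_of_W_tilde(1)] J_le_energy_functional[of u V] by (meson order_trans)
qed

lemma dens_convex:
  assumes w: "w \<in> dens" and z: "z \<in> dens" and ab: "\<alpha> > 0" "\<beta> > 0" "\<alpha> + \<beta> = 1"
  shows "(\<lambda>x. \<alpha> * w x + \<beta> * z x) \<in> dens"
    and "en (\<lambda>x. \<alpha> * w x + \<beta> * z x) \<le> \<alpha> * en w + \<beta> * en z"
proof -
  note D = densD[OF w] and D' = densD[OF z]
  note [measurable] = D(3) D'(3)
  let ?m = "\<lambda>x. \<alpha> * w x + \<beta> * z x"
  have m: "?m x powr (1 / p) = lp_mean p \<alpha> \<beta> (w x powr (1 / p)) (z x powr (1 / p))" for x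
    using p D(1)[of x] D'(1)[of x] by (simp add: lp_mean_def powr_powr)
  have "energy s p (\<lambda>x. ?m x powr (1 / p))
      \<le> ennreal \<alpha> * energy s p (\<lambda>x. w x powr (1 / p))
      + ennreal \<beta> * energy s p (\<lambda>x. z x powr (1 / p))"
    unfolding m by (rule energy_lp_mean_le[OF p ab]) auto
  also have "\<dots> = ennreal (2 * (\<alpha> * en w + \<beta> * en z))"
    using D(9,10) D'(9,10) ab by (simp add: algebra_simps flip: ennreal_mult ennreal_plus)
  finally have e: "energy s p (\<lambda>x. ?m x powr (1 / p)) \<le> ennreal (2 * (\<alpha> * en w + \<beta> * en z))" .
  have "(\<integral>\<^sup>+x. ennreal (?m x) \<partial>lebesgue)
      = (\<integral>\<^sup>+x. ennreal \<alpha> * ennreal (w x) + ennreal \<beta> * ennreal (z x) \<partial>lebesgue)"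
    using D(1) D'(1) ab by (intro nn_integral_cong) (simp add: ennreal_mult)
  also have "\<dots> = ennreal \<alpha> + ennreal \<beta>"
    by (simp add: nn_integral_add nn_integral_cmult D(5) D'(5))
  also have "\<dots> = 1" using ab by (simp flip: ennreal_plus)
  finally have "(\<integral>\<^sup>+x. ennreal (?m x) \<partial>lebesgue) = 1" .
  then show "?m \<in> dens"
    using e D(1,2) D'(1,2) ab unfolding dens_def by (auto intro: le_less_trans)
  have "enn2real (energy s p (\<lambda>x. ?m x powr (1 / p))) \<le> 2 * (\<alpha> * en w + \<beta> * en z)"
    using e D(10) D'(10) ab by (intro enn2real_leI) auto
  then show "en ?m \<le> \<alpha> * en w + \<beta> * en z" by (simp add: en_def)
qed

lemma mass_Minkowski:
  assumes w: "w \<in> dens" and z: "z \<in> dens" and ab: "\<alpha> > 0" "\<beta> > 0" "\<alpha> + \<beta> = 1"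
  shows "mass (\<lambda>x. \<alpha> * w x + \<beta> * z x) powr (1 / r)
      \<le> \<alpha> * mass w powr (1 / r) + \<beta> * mass z powr (1 / r)"
proof -
  note D = densD[OF w] and D' = densD[OF z]
  let ?m = "\<lambda>x. \<alpha> * w x + \<beta> * z x"
  define P Q where "P = mass w powr (1 / r)" and "Q = mass z powr (1 / r)"
  have PQ: "P > 0" "Q > 0" using mass_pos[OF w] mass_pos[OF z] by (auto simp: P_def Q_def)
  have Pr: "P powr r = mass w" "Q powr r = mass z"
    using r mass_pos[OF w] mass_pos[OF z] by (auto simp: P_def Q_def powr_powr)
  define R where "R = \<alpha> * P + \<beta> * Q"
  have R: "R > 0" using PQ ab by (simp add: R_def add_pos_pos)
  define a b where "a = \<alpha> * P / R" and "b = \<beta> * Q / R"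
  have "\<alpha> * P / R + \<beta> * Q / R = R / R" unfolding R_def by (rule add_divide_distrib[symmetric])
  then have ab': "a > 0" "b > 0" "a + b = 1" using PQ R ab by (auto simp: a_def b_def)
  have wi: "integrable (lebesgue_on \<Omega>) (\<lambda>x. w x powr r)"
      "integrable (lebesgue_on \<Omega>) (\<lambda>x. z x powr r)"
    "integrable (lebesgue_on \<Omega>) (\<lambda>x. ?m x powr r)"
    using dens_powr_integrable w z dens_convex(1)[OF w z ab] by auto
  have "mass ?m \<le> (LINT x|lebesgue_on \<Omega>. R powr r * (a * (w x powr r / P powr r)
      + b * (z x powr r / Q powr r)))"
    unfolding mass_def
  proof (rule integral_mono[OF wi(3)])
    show "integrable (lebesgue_on \<Omega>) (\<lambda>x. R powr r * (a * (w x powr r / P powr r)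
        + b * (z x powr r / Q powr r)))"
      by (intro integrable_mult_right Bochner_Integration.integrable_add integrable_divide wi)
    fix x
    have "?m x = R * (a * (w x / P) + b * (z x / Q))"
      using R PQ by (simp add: a_def b_def distrib_left)
    then have "?m x powr r = R powr r * (a * (w x / P) + b * (z x / Q)) powr r"
      by (simp add: powr_mult)
    also have "\<dots> \<le> R powr r * (a * (w x / P) powr r + b * (z x / Q) powr r)"
      using D(1)[of x] D'(1)[of x] PQ r(1) ab' by (intro mult_left_mono powr_strict_convex(1)) auto
    finally show "?m x powr r
        \<le> R powr r * (a * (w x powr r / P powr r) + b * (z x powr r / Q powr r))"
      by (simp add: powr_divide)
  qed
  also have "\<dots> = R powr r * (a * (mass w / P powr r) + b * (mass z / Q powr r))"
    unfolding mass_def using wi by simp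
  also have "\<dots> = R powr r" using Pr mass_pos[OF w] mass_pos[OF z] ab' by simp
  finally have "mass ?m powr (1 / r) \<le> (R powr r) powr (1 / r)"
    using r mass_pos[OF dens_convex(1)[OF w z ab]] by (intro powr_mono2) auto
  then show ?thesis using r R by (simp add: powr_powr R_def P_def Q_def)
qed

text \<open>For a fixed density this is the largest value of \<open>J V\<close> over the unit ball of \<open>L\<^sup>q\<close>.\<close>

definition Phi :: "('a \<Rightarrow> real) \<Rightarrow> real" where
  "Phi w = en w + mass w powr (1 / r)"

lemma Phi_convex:
  assumes "w \<in> dens" "z \<in> dens" "\<alpha> > 0" "\<beta> > 0" "\<alpha> + \<beta> = 1"
  shows "Phi (\<lambda>x. \<alpha> * w x + \<beta> * z x) \<le> \<alpha> * Phi w + \<beta> * Phi z"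
  using dens_convex(2)[OF assms] mass_Minkowski[OF assms] by (simp add: Phi_def algebra_simps)

lemma Phi_nonneg: "w \<in> dens \<Longrightarrow> Phi w \<ge> 0"
  by (simp add: Phi_def densD(10))

text \<open>The sublevel sets of the convex functional \<open>Phi\<close> provide almost everywhere convergent
  minimizing sequences; lower semicontinuity is then Fatou's lemma.\<close>

lemma Phi_minimizer_exists:
  obtains w where "w \<in> dens" "\<And>z. z \<in> dens \<Longrightarrow> Phi w \<le> Phi z"
proof -
  interpret M: finite_measure "lebesgue_on \<Omega>" by (rule finite_measure_\<Omega>)
  define m where "m = Inf (Phi ` dens)"
  have bdd: "bdd_below (Phi ` dens)" using Phi_nonneg by (intro bdd_belowI[of _ 0]) auto
  have m_le: "m \<le> Phi w" if "w \<in> dens" for w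
    unfolding m_def using that bdd by (intro cInf_lower) auto
  define K where "K k = {w \<in> dens. Phi w \<le> m + 1 / (real k + 1)}" for k
  have Kne: "K k \<noteq> {}" for k
  proof -
    have "Inf (Phi ` dens) < m + 1 / (real k + 1)" by (simp add: m_def)
    then obtain w where "w \<in> dens" "Phi w < m + 1 / (real k + 1)"
      using dens_nonempty bdd by (subst (asm) cInf_less_iff) auto
    then show ?thesis by (auto simp: K_def)
  qed
  have Kdec: "K k \<subseteq> K j" if "j \<le> k" for j k
  proof -
    have "1 / (real k + 1) \<le> 1 / (real j + 1)" using that by (simp add: frac_le)
    then show ?thesis by (auto simp: K_def)
  qed
  have Kmid: "(\<lambda>x. (f x + g x) / 2) \<in> K k" if "f \<in> K k" "g \<in> K k" for f g k
  proof -
    have e: "(\<lambda>x. (f x + g x) / 2) = (\<lambda>x. 1/2 * f x + 1/2 * g x)" by (auto simp: field_simps)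
    show ?thesis
      using dens_convex(1)[of f g "1/2" "1/2"] Phi_convex[of f g "1/2" "1/2"] that
      unfolding e by (simp add: K_def)
  qed
  obtain f w where f: "\<And>k. f k \<in> K k" and w: "w \<in> borel_measurable (lebesgue_on \<Omega>)" "\<And>x. w x \<ge> 0"
    and conv: "AE x in lebesgue_on \<Omega>. (\<lambda>k. f k x) \<longlonglongrightarrow> w x"
  proof (rule convex_sets_AE_convergent[of "lebesgue_on \<Omega>" K 1])
    show "f \<in> borel_measurable (lebesgue_on \<Omega>)" "0 \<le> f x" "(\<integral>\<^sup>+x. ennreal (f x) \<partial>lebesgue_on \<Omega>)
        \<le> ennreal 1"
      if "f \<in> K k" for f k x
      using that densD[of f] by (auto simp: K_def)
  qed (use Kne Kdec Kmid finite_measure_\<Omega> in auto)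
  have fd: "f k \<in> dens" and fP: "Phi (f k) \<le> m + 1 / (real k + 1)" for k
    using f[of k] by (auto simp: K_def)
  note fD = densD[OF fd]
  define w' where "w' x = (if x \<in> \<Omega> then w x else 0)" for x
  have w'm: "w' \<in> borel_measurable lebesgue"
    unfolding w'_def using w(1) by (subst borel_measurable_if) auto
  have w'0: "w' x \<ge> 0" "x \<notin> \<Omega> \<Longrightarrow> w' x = 0" for x using w by (auto simp: w'_def)
  have w'M [measurable]: "w' \<in> borel_measurable (lebesgue_on \<Omega>)"
      by (rule measurable_restrict_space1[OF w'm])
  have fM [measurable]: "f k \<in> borel_measurable (lebesgue_on \<Omega>)" for k by (rule fD(4))
  have convM: "AE x in lebesgue_on \<Omega>. (\<lambda>k. f k x) \<longlonglongrightarrow> w' x"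
    using conv AE_space by eventually_elim (simp add: w'_def)
  have convL: "AE x in lebesgue. (\<lambda>k. f k x) \<longlonglongrightarrow> w' x"
  proof -
    have "AE x in lebesgue. x \<in> \<Omega> \<longrightarrow> (\<lambda>k. f k x) \<longlonglongrightarrow> w' x"
      using convM by (simp add: AE_restrict_space_iff)
    then show ?thesis by eventually_elim (use fD(2) w'0(2) in fastforce)
  qed
  have fP1: "Phi (f k) \<le> m + 1" for k
    using fP[of k] by (smt (verit) divide_le_eq_1_pos of_nat_0_le_iff)
  define N where "N k = mass (f k) powr (1 / r)" for k
  have N0: "N k \<ge> 0" for k by (simp add: N_def)
  have Nr: "mass (f k) = N k powr r" for k
    using mass_pos[OF fd[of k]] r by (simp add: N_def powr_powr)
  have N1: "N k \<le> m + 1" for k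
    using fP1[of k] fD(10)[of k] by (simp add: Phi_def N_def)
  define S where "S = (m + 1) powr r"
  have S: "mass (f k) \<le> S" for k unfolding Nr S_def using N1 N0 r by (intro powr_mono2) auto

  \<comment> \<open>The bound in \<open>L\<^sup>r\<close> with \<open>r > 1\<close> prevents a loss of mass in the limit.\<close>
  have le1: "(\<integral>\<^sup>+x. ennreal (w' x) \<partial>lebesgue_on \<Omega>) \<le> 1"
  proof -
    have "(\<integral>\<^sup>+x. ennreal (w' x) \<partial>lebesgue_on \<Omega>)
        = (\<integral>\<^sup>+x. liminf (\<lambda>k. ennreal (f k x)) \<partial>lebesgue_on \<Omega>)"
    proof (rule nn_integral_cong_AE)
      show "AE x in lebesgue_on \<Omega>. ennreal (w' x) = liminf (\<lambda>k. ennreal (f k x))"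
        using convM by eventually_elim (metis lim_imp_Liminf sequentially_bot tendsto_ennrealI)
    qed
    also have "\<dots> \<le> liminf (\<lambda>k. \<integral>\<^sup>+x. ennreal (f k x) \<partial>lebesgue_on \<Omega>)"
      by (rule nn_integral_liminf) measurable
    also have "\<dots> = 1" by (simp add: fD(11) Liminf_const)
    finally show ?thesis .
  qed
  have wi: "integrable (lebesgue_on \<Omega>) w'"
    using le1 w'0(1) by (subst integrable_iff_nn_integral_finite) (auto intro: le_less_trans)
  have ge: "1 - A powr (1 - r) * S \<le> (LINT x|lebesgue_on \<Omega>. w' x)" if A: "A > 0" for A
  proof -
    have i1: "integrable (lebesgue_on \<Omega>) (\<lambda>x. min (g x) A)" if "g
        \<in> borel_measurable (lebesgue_on \<Omega>)" "\<And>x. g x \<ge> 0" for g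
      using that A by (intro M.integrable_const_bound[where B = A]) auto
    have "(\<lambda>k. LINT x|lebesgue_on \<Omega>. min (f k x) A) \<longlonglongrightarrow> (LINT x|lebesgue_on \<Omega>. min (w' x) A)"
    proof (rule integral_dominated_convergence[where w = "\<lambda>_. A"])
      show "AE x in lebesgue_on \<Omega>. (\<lambda>k. min (f k x) A) \<longlonglongrightarrow> min (w' x) A"
        using convM by eventually_elim (intro tendsto_intros)
      show "AE x in lebesgue_on \<Omega>. norm (min (f k x) A) \<le> A" for k
        using fD(1)[of k] A by (intro AE_I2) (auto simp: min_def)
    qed auto
    moreover have "1 - A powr (1 - r) * S \<le> (LINT x|lebesgue_on \<Omega>. min (f k x) A)" for k
    proof -
      have "(LINT x|lebesgue_on \<Omega>. f k x)
          \<le> (LINT x|lebesgue_on \<Omega>. min (f k x) A + A powr (1 - r) * f k x powr r)"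
      proof (rule integral_mono[OF fD(7)])
        show "integrable (lebesgue_on \<Omega>) (\<lambda>x. min (f k x) A + A powr (1 - r) * f k x powr r)"
          using i1[OF fD(4) fD(1)] dens_powr_integrable[OF fd[of k]] by simp
        show "f k x \<le> min (f k x) A + A powr (1 - r) * f k x powr r" for x
          using le_add_powr_scaled[OF fD(1)[of k x] A, of r] r by (auto simp: min_def)
      qed
      also have "\<dots> = (LINT x|lebesgue_on \<Omega>. min (f k x) A) + A powr (1 - r) * mass (f k)"
        unfolding mass_def using i1[OF fD(4) fD(1)] dens_powr_integrable[OF fd[of k]] by simp
      also have "\<dots> \<le> (LINT x|lebesgue_on \<Omega>. min (f k x) A) + A powr (1 - r) * S"
        using S[of k] by (simp add: mult_left_mono)
      finally show ?thesis using fD(8)[of k] by simp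
    qed
    ultimately have "1 - A powr (1 - r) * S \<le> (LINT x|lebesgue_on \<Omega>. min (w' x) A)"
      by (intro LIMSEQ_le_const) auto
    also have "\<dots> \<le> (LINT x|lebesgue_on \<Omega>. w' x)"
      using i1[OF w'M w'0(1)] wi by (intro integral_mono) auto
    finally show ?thesis .
  qed
  have "((\<lambda>A. 1 - A powr (1 - r) * S) \<longlongrightarrow> 1 - 0 * S) at_top"
    using r by (intro tendsto_intros tendsto_neg_powr filterlim_ident) auto
  then have "1 - 0 * S \<le> (LINT x|lebesgue_on \<Omega>. w' x)"
    by (rule tendsto_upperbound) (auto intro!: eventually_mono[OF eventually_gt_at_top[of 0]] ge)
  moreover have "(LINT x|lebesgue_on \<Omega>. w' x) \<le> 1"
    using le1 w'0(1) wi by (subst (asm) nn_integral_eq_integral) auto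
  ultimately have "(LINT x|lebesgue_on \<Omega>. w' x) = 1" by simp
  then have one: "(\<integral>\<^sup>+x. ennreal (w' x) \<partial>lebesgue) = 1"
    using wi w'0 nn_integral_\<Omega>[of "\<lambda>x. ennreal (w' x)"] nn_integral_eq_integral[OF wi] by simp

  have root_conv: "AE x in lebesgue. (\<lambda>k. f k x powr (1 / p)) \<longlonglongrightarrow> w' x powr (1 / p)"
    using convL
  proof eventually_elim
    case (elim x)
    then show ?case using p fD(1) by (intro tendsto_powr' tendsto_const) auto
  qed
  have E: "energy s p (\<lambda>x. w' x powr (1 / p)) \<le> liminf (\<lambda>k. energy s p (\<lambda>x. f k x powr (1 / p)))"
  proof (rule energy_liminf_le[OF _ _ root_conv])
    show "(\<lambda>x. f k x powr (1 / p)) \<in> borel_measurable lebesgue" for k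
      using fD(3)[of k] by measurable
  qed (use p in simp)
  have Ms: "(\<integral>\<^sup>+x. ennreal (w' x powr r) \<partial>lebesgue_on \<Omega>) \<le> liminf (\<lambda>k. ennreal (mass (f k)))"
  proof -
    have "(\<integral>\<^sup>+x. ennreal (w' x powr r) \<partial>lebesgue_on \<Omega>)
        = (\<integral>\<^sup>+x. liminf (\<lambda>k. ennreal (f k x powr r)) \<partial>lebesgue_on \<Omega>)"
    proof (rule nn_integral_cong_AE)
      show "AE x in lebesgue_on \<Omega>. ennreal (w' x powr r) = liminf (\<lambda>k. ennreal (f k x powr r))"
        using convM
      proof eventually_elim
        case (elim x)
        then have "(\<lambda>k. f k x powr r) \<longlonglongrightarrow> w' x powr r" using r fD(1)
            by (intro tendsto_powr' tendsto_const) auto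
        then show ?case by (metis lim_imp_Liminf sequentially_bot tendsto_ennrealI)
      qed
    qed
    also have "\<dots> \<le> liminf (\<lambda>k. \<integral>\<^sup>+x. ennreal (f k x powr r) \<partial>lebesgue_on \<Omega>)"
      by (rule nn_integral_liminf) measurable
    also have "(\<lambda>k. \<integral>\<^sup>+x. ennreal (f k x powr r) \<partial>lebesgue_on \<Omega>) = (\<lambda>k. ennreal (mass (f k)))"
      unfolding mass_def using dens_powr_integrable[OF fd]
          by (intro ext nn_integral_eq_integral) auto
    finally show ?thesis .
  qed
  have wd: "w' \<in> dens"
  proof -
    have "liminf (\<lambda>k. energy s p (\<lambda>x. f k x powr (1 / p))) \<le> liminf (\<lambda>k. ennreal (2 * (m + 1)))"
    proof (intro Liminf_mono always_eventually allI)
      fix k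
      have "en (f k) \<le> m + 1" using fP1[of k] N0[of k] unfolding Phi_def N_def by linarith
      then show "energy s p (\<lambda>x. f k x powr (1 / p)) \<le> ennreal (2 * (m + 1))"
        unfolding fD(9)[of k] by (intro ennreal_leI) simp
    qed
    also have "\<dots> < \<infinity>" by (simp add: Liminf_const)
    finally have "energy s p (\<lambda>x. w' x powr (1 / p)) < \<infinity>" using E by (rule le_less_trans[rotated])
    then show ?thesis using one w'm w'0 by (simp add: dens_def)
  qed
  note wD = densD[OF wd]
  define N' where "N' = mass w' powr (1 / r)"
  have N': "N' > 0" "N' powr r = mass w'"
    using mass_pos[OF wd] r by (auto simp: N'_def powr_powr)
  \<comment> \<open>Both parts of \<open>Phi\<close> are lower semicontinuous along the sequence.\<close>
  have ev_en: "eventually (\<lambda>k. en w' - \<delta> < en (f k)) sequentially" if "\<delta> > 0" for \<delta>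
  proof -
    have "eventually (\<lambda>k. 2 * en w' - 2 * \<delta> < 2 * en (f k)) sequentially"
      using E that unfolding fD(9) wD(9) by (intro eventually_less_of_le_liminf) (auto simp: fD(10))
    then show ?thesis by eventually_elim simp
  qed
  have ev_N: "eventually (\<lambda>k. N' - \<delta> < N k) sequentially" if \<delta>: "\<delta> > 0" for \<delta>
  proof -
    define y where "y = max 0 (N' - \<delta>)"
    have y: "0 \<le> y" "y < N'" using N' \<delta> by (auto simp: y_def)
    then have "y powr r < mass w'" using r unfolding N'(2)[symmetric]
        by (intro powr_less_mono2) auto
    moreover have "ennreal (mass w') \<le> liminf (\<lambda>k. ennreal (mass (f k)))"
      using Ms unfolding mass_def
          by (subst (asm) nn_integral_eq_integral[OF dens_powr_integrable[OF wd]]) auto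
    ultimately have "eventually (\<lambda>k. mass w' - (mass w' - y powr r) < mass (f k)) sequentially"
      by (intro eventually_less_of_le_liminf) (auto simp: mass_def)
    then show ?thesis
    proof eventually_elim
      case (elim k)
      then have "y powr r < N k powr r" by (simp add: Nr)
      then have "y < N k" using r y N0[of k] powr_mono2[of r "N k" y] by (cases "y < N k") auto
      then show ?case by (simp add: y_def)
    qed
  qed
  have "Phi w' \<le> m"
  proof (rule ccontr)
    assume "\<not> Phi w' \<le> m"
    define \<delta> where "\<delta> = (Phi w' - m) / 3"
    have \<delta>: "\<delta> > 0" "Phi w' = m + 3 * \<delta>" using \<open>\<not> Phi w' \<le> m\<close> by (auto simp: \<delta>_def field_simps)
    have "(\<lambda>k. 1 / (real k + 1)) \<longlonglongrightarrow> 0"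
      using LIMSEQ_inverse_real_of_nat by (simp add: inverse_eq_divide add.commute)
    then have "eventually (\<lambda>k. 1 / (real k + 1) < \<delta>) sequentially"
      using \<delta>(1) by (rule order_tendstoD(2))
    then have "eventually (\<lambda>k. False) sequentially"
      using ev_en[OF \<delta>(1)] ev_N[OF \<delta>(1)]
    proof eventually_elim
      case (elim k)
      then have "Phi (f k) > Phi w' - 2 * \<delta>" by (simp add: Phi_def N_def N'_def)
      then show ?case using fP[of k] elim(1) \<delta>(2) by linarith
    qed
    then show False by simp
  qed
  then show ?thesis using that[OF wd] m_le by (meson order_trans)
qed

end

section \<open>The maximizing potential\<close>

lemma powr_tangent_le:
  fixes a b r :: real
  assumes "r > 1" "a \<ge> 0" "b \<ge> 0"
  shows "b powr r - a powr r \<le> r * (b powr (r - 1) * (b - a))"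
proof (cases "b = 0")
  case False
  then have b: "b > 0" using assms by simp
  have "b powr r * (1 + r * (a / b - 1)) \<le> b powr r * (a / b) powr r"
    using Bernoulli_powr(1)[of r "a / b"] assms b by (intro mult_left_mono) auto
  moreover have "b powr r * (a / b) powr r = a powr r" using assms b by (simp add: powr_divide)
  moreover have "b powr r * (1 + r * (a / b - 1)) = b powr r - r * (b powr (r - 1) * (b - a))"
    using b by (simp add: powr_diff field_simps)
  ultimately show ?thesis by simp
qed simp

context subcritical_problem
begin

text \<open>The potential \<open>V\<close> of norm \<open>1\<close> in \<open>L\<^sup>q\<close> for which \<open>\<integral> V w\<close> is the \<open>L\<^sup>r\<close> norm of \<open>w\<close>.\<close>

definition dual_potential :: "('a \<Rightarrow> real) \<Rightarrow> 'a \<Rightarrow> real" where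
  "dual_potential w x = mass w powr (1 / r - 1) * w x powr (r - 1)"

lemma dual_potential_in_ball:
  assumes w: "w \<in> dens"
  shows "dual_potential w \<in> Lp_unit_cball q \<Omega>"
proof -
  note D = densD[OF w]
  note [measurable] = D(4)
  have qr: "q * (r - 1) = r" "q * (1 / r - 1) = - 1" using q by (auto simp: r_def field_simps)
  have e: "\<bar>dual_potential w x\<bar> powr q = w x powr r / mass w" for x
  proof -
    have "\<bar>dual_potential w x\<bar> powr q
        = (mass w powr (1 / r - 1)) powr q * (w x powr (r - 1)) powr q"
      by (simp add: dual_potential_def powr_mult)
    also have "\<dots> = mass w powr (q * (1 / r - 1)) * w x powr (q * (r - 1))"
      by (simp add: powr_powr mult.commute)
    finally show ?thesis using mass_pos[OF w] by (simp only: qr) (simp add: powr_minus divide_simps)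
  qed
  have m: "dual_potential w \<in> borel_measurable (lebesgue_on \<Omega>)"
    unfolding dual_potential_def by measurable
  have "(LINT x|lebesgue_on \<Omega>. \<bar>dual_potential w x\<bar> powr q) = 1"
    using mass_pos[OF w] unfolding e by (simp add: mass_def)
  then show ?thesis using m dens_powr_integrable[OF w]
    by (simp add: Lp_unit_cball_def Lp_def Lp_norm_def e)
qed

lemma integral_dual_potential:
  assumes w: "w \<in> dens"
  shows "(LINT x|lebesgue_on \<Omega>. dual_potential w x * w x) = mass w powr (1 / r)"
proof -
  have "dual_potential w x * w x = mass w powr (1 / r - 1) * w x powr r" for x
    using densD(1)[OF w, of x] powr_mult_base[of "w x" "r - 1"]
        by (simp add: dual_potential_def mult_ac)
  then have "(LINT x|lebesgue_on \<Omega>. dual_potential w x * w x) = mass w powr (1 / r - 1) * mass w"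
    by (simp add: mass_def)
  also have "\<dots> = mass w powr (1 / r)"
    using mass_pos[OF w] by (simp add: powr_diff)
  finally show ?thesis .
qed

text \<open>The first-order condition at a minimizer of \<open>Phi\<close>, along the segment from \<open>w\<close> to \<open>z\<close>:
  the first eigenvalue for the dual potential of \<open>w\<close> is at least \<open>Phi w\<close>.\<close>

lemma Phi_le_J_dual_potential:
  assumes w: "w \<in> dens" and min: "\<And>z. z \<in> dens \<Longrightarrow> Phi w \<le> Phi z" and z: "z \<in> dens"
  shows "Phi w \<le> J (dual_potential w) z"
proof -
  note D = densD[OF w] and D' = densD[OF z]
  note [measurable] = D(4) D'(4)
  define N where "N = mass w powr (1 / r)"
  have mw: "mass w > 0" by (rule mass_pos[OF w])
  have N: "N > 0" "N powr r = mass w" using mw r by (auto simp: N_def powr_powr)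
  define t where "t k = 1 / (real k + 2)" for k
  have t: "t k > 0" "1 - t k > 0" "1 - t k + t k = 1" for k by (auto simp: t_def)
  define wt where "wt k x = (1 - t k) * w x + t k * z x" for k x
  have wt: "wt k \<in> dens" "en (wt k) \<le> (1 - t k) * en w + t k * en z" for k
    using dens_convex[OF w z t(2) t(1) t(3)] unfolding wt_def by auto
  note [measurable] = densD(4)[OF wt(1)]
  have wt0: "wt k x \<ge> 0" for k x by (rule densD(1)[OF wt(1)])
  have wt_max: "wt k x \<le> max (w x) (z x)" for k x
    unfolding wt_def using t[of k] by (intro convex_bound_le) auto
  define d where "d k x = wt k x powr (r - 1) * (z x - w x)" for k x
  have ri: "integrable (lebesgue_on \<Omega>) (\<lambda>x. w x powr r + z x powr r)"
    using dens_powr_integrable w z by simp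
  have dbound: "\<bar>a powr (r - 1) * (z x - w x)\<bar> \<le> w x powr r + z x powr r"
    if "0 \<le> a" "a \<le> max (w x) (z x)" for a x
  proof -
    define M where "M = max (w x) (z x)"
    have M0: "M \<ge> 0" using D(1)[of x] by (simp add: M_def)
    have "\<bar>a powr (r - 1) * (z x - w x)\<bar> = a powr (r - 1) * \<bar>z x - w x\<bar>" by (simp add: abs_mult)
    also have "\<dots> \<le> M powr (r - 1) * M"
      using that r D(1)[of x] D'(1)[of x] by (intro mult_mono powr_mono2) (auto simp: M_def)
    also have "\<dots> = M powr r" using powr_mult_base[OF M0, of "r - 1"] by (simp add: mult.commute)
    also have "\<dots> \<le> w x powr r + z x powr r" by (auto simp: M_def max_def)
    finally show ?thesis .
  qed
  have dm [measurable]: "d k \<in> borel_measurable (lebesgue_on \<Omega>)" for k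
    unfolding d_def by measurable
  have di: "integrable (lebesgue_on \<Omega>) (d k)" for k
    by (rule Bochner_Integration.integrable_bound[OF ri])
       (use dbound[OF wt0 wt_max] in \<open>auto simp: d_def\<close>)
  define c where "c = N / mass w"
  have c: "c > 0" "c = mass w powr (1 / r - 1)" using N mw by (auto simp: c_def N_def powr_diff)
  have step: "0 \<le> en z - en w + c * (LINT x|lebesgue_on \<Omega>. d k x)" for k
  proof -
    define A where "A = mass (wt k) powr (1 / r)"
    have A: "A > 0" "A powr r = mass (wt k)"
      using mass_pos[OF wt(1)[of k]] r by (auto simp: A_def powr_powr)
    have "A / N * 1 \<le> (A / N) powr r / r + 1 powr q / q"
      using A N q r by (intro Youngs_inequality) auto
    also have "\<dots> = mass (wt k) / mass w / r + (1 - 1 / r)"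
      using A N r by (simp add: powr_divide algebra_simps)
    finally have "A / N - 1 \<le> (mass (wt k) - mass w) / mass w / r"
      using mw r by (simp add: diff_divide_distrib)
    then have "N * (A / N - 1) \<le> N * ((mass (wt k) - mass w) / mass w / r)"
      using N by (intro mult_left_mono) auto
    then have A1: "A - N \<le> c * ((mass (wt k) - mass w) / r)"
    proof -
      have "N * (A / N - 1) = A - N" using N(1) by (simp add: right_diff_distrib)
      moreover have "N * (X / mass w / r) = c * (X / r)" for X by (simp add: c_def)
      ultimately show ?thesis using \<open>N * (A / N - 1) \<le> _\<close> by metis
    qed
    have "mass (wt k) - mass w = (LINT x|lebesgue_on \<Omega>. wt k x powr r - w x powr r)"
      unfolding mass_def
          using dens_powr_integrable[OF wt(1)[of k]] dens_powr_integrable[OF w] by simp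
    also have "\<dots> \<le> (LINT x|lebesgue_on \<Omega>. r * (t k * d k x))"
    proof (rule integral_mono)
      show "integrable (lebesgue_on \<Omega>) (\<lambda>x. wt k x powr r - w x powr r)"
        using dens_powr_integrable[OF wt(1)[of k]] dens_powr_integrable[OF w] by simp
      show "integrable (lebesgue_on \<Omega>) (\<lambda>x. r * (t k * d k x))" using di by simp
      fix x
      have "wt k x powr r - w x powr r \<le> r * (wt k x powr (r - 1) * (wt k x - w x))"
        using r D(1) wt0 by (intro powr_tangent_le) auto
      also have "wt k x - w x = t k * (z x - w x)" by (simp add: wt_def algebra_simps)
      finally show "wt k x powr r - w x powr r \<le> r * (t k * d k x)" by (simp add: d_def mult_ac)
    qed
    also have "\<dots> = r * (t k * (LINT x|lebesgue_on \<Omega>. d k x))" by simp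
    finally have "(mass (wt k) - mass w) / r \<le> t k * (LINT x|lebesgue_on \<Omega>. d k x)"
      using r by (simp add: divide_simps mult.commute)
    then have "c * ((mass (wt k) - mass w) / r) \<le> c * (t k * (LINT x|lebesgue_on \<Omega>. d k x))"
      using c by (intro mult_left_mono) auto
    then have "A - N \<le> t k * (c * (LINT x|lebesgue_on \<Omega>. d k x))" using A1 by (simp add: mult_ac)
    moreover have "en w + N \<le> en (wt k) + A" using min[OF wt(1)[of k]]
        by (simp add: Phi_def N_def A_def)
    ultimately have "0 \<le> t k * (en z - en w) + t k * (c * (LINT x|lebesgue_on \<Omega>. d k x))"
      using wt(2)[of k] by (simp add: algebra_simps)
    then have "0 \<le> t k * (en z - en w + c * (LINT x|lebesgue_on \<Omega>. d k x))"
        by (simp add: distrib_left)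
    then show ?thesis using t(1)[of k] by (simp add: zero_le_mult_iff)
  qed
  have t0: "t \<longlonglongrightarrow> 0"
    unfolding t_def using LIMSEQ_ignore_initial_segment[OF LIMSEQ_inverse_real_of_nat, of 1]
    by (simp add: inverse_eq_divide add.commute)
  have "(\<lambda>k. LINT x|lebesgue_on \<Omega>. d k x) \<longlonglongrightarrow> (LINT x|lebesgue_on \<Omega>. w x powr (r - 1) * (z x - w x))"
  proof (rule integral_dominated_convergence[OF _ dm ri])
    show "AE x in lebesgue_on \<Omega>. (\<lambda>k. d k x) \<longlonglongrightarrow> w x powr (r - 1) * (z x - w x)"
    proof (intro AE_I2)
      fix x
      have "(\<lambda>k. wt k x) \<longlonglongrightarrow> (1 - 0) * w x + 0 * z x"
        unfolding wt_def by (intro tendsto_intros t0)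
      then have "(\<lambda>k. wt k x powr (r - 1)) \<longlonglongrightarrow> w x powr (r - 1)"
        using r wt0 by (intro tendsto_powr' tendsto_const) auto
      then show "(\<lambda>k. d k x) \<longlonglongrightarrow> w x powr (r - 1) * (z x - w x)"
        unfolding d_def by (rule tendsto_mult[OF _ tendsto_const])
    qed
    show "AE x in lebesgue_on \<Omega>. norm (d k x) \<le> w x powr r + z x powr r" for k
      using dbound[OF wt0 wt_max] by (intro AE_I2) (simp add: d_def)
  qed measurable
  then have "(\<lambda>k. en z - en w + c * (LINT x|lebesgue_on \<Omega>. d k x))
      \<longlonglongrightarrow> en z - en w + c * (LINT x|lebesgue_on \<Omega>. w x powr (r - 1) * (z x - w x))"
    by (intro tendsto_intros)
  then have "0 \<le> en z - en w + c * (LINT x|lebesgue_on \<Omega>. w x powr (r - 1) * (z x - w x))"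
    by (rule LIMSEQ_le_const) (use step in auto)
  also have "c * (LINT x|lebesgue_on \<Omega>. w x powr (r - 1) * (z x - w x))
      = (LINT x|lebesgue_on \<Omega>. dual_potential w x * z x - dual_potential w x * w x)"
    unfolding integral_mult_right_zero[symmetric] c(2)
    by (intro Bochner_Integration.integral_cong) (auto simp: dual_potential_def algebra_simps)
  also have "\<dots>
      = (LINT x|lebesgue_on \<Omega>. dual_potential w x * z x) - (LINT x|lebesgue_on \<Omega>. dual_potential w
      x * w x)"
    using dual_potential_in_ball[OF w] w z
    by (intro Bochner_Integration.integral_diff dens_product_integrable) (auto simp:
        Lp_unit_cball_def)
  finally show ?thesis using integral_dual_potential[OF w] by (simp add: J_def Phi_def)
qed

text \<open>A maximizing potential attains equality in Hoelder's inequality against the minimizer of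
  \<open>Phi\<close>, which determines it.\<close>

lemma maximizing_potential:
  assumes V: "V \<in> Lp_unit_cball q \<Omega>"
    and max: "\<And>V'. V' \<in> Lp_unit_cball q \<Omega> \<Longrightarrow> first_eigenvalue s p \<Omega> V' \<le> first_eigenvalue s p \<Omega> V"
  obtains w where "w \<in> dens" "first_eigenvalue s p \<Omega> V = J V w"
    "AE x in lebesgue_on \<Omega>. 0 \<le> V x \<and> V x powr q = w x powr r / mass w"
    "Lp_norm q \<Omega> V = 1"
proof -
  obtain w where w: "w \<in> dens" and min: "\<And>z. z \<in> dens \<Longrightarrow> Phi w \<le> Phi z"
    using Phi_minimizer_exists by blast
  note D = densD[OF w]
  note [measurable] = D(4)
  have VL: "V \<in> Lp q \<Omega>" "Lp_norm q \<Omega> V \<le> 1" using V by (auto simp: Lp_unit_cball_def)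
  have Vm [measurable]: "V \<in> borel_measurable (lebesgue_on \<Omega>)"
    and Vi: "integrable (lebesgue_on \<Omega>) (\<lambda>x. \<bar>V x\<bar> powr q)" using VL by (auto simp: Lp_def)
  define I where "I = (LINT x|lebesgue_on \<Omega>. \<bar>V x\<bar> powr q)"
  have I1: "I \<le> 1"
  proof (rule ccontr)
    assume "\<not> I \<le> 1"
    then have "1 powr (1 / q) < I powr (1 / q)" using q by (intro powr_less_mono2) auto
    then show False using VL(2) by (simp add: Lp_norm_def I_def)
  qed
  define N where "N = mass w powr (1 / r)"
  have mw: "mass w > 0" by (rule mass_pos[OF w])
  have N: "N > 0" "N powr r = mass w" using mw r by (auto simp: N_def powr_powr)
  have Vwi: "integrable (lebesgue_on \<Omega>) (\<lambda>x. V x * w x)"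
      by (rule dens_product_integrable[OF VL(1) w])
  have wi: "integrable (lebesgue_on \<Omega>) (\<lambda>x. w x powr r)" by (rule dens_powr_integrable[OF w])
  have le1: "Phi w \<le> first_eigenvalue s p \<Omega> V"
    using le_first_eigenvalue[OF Phi_le_J_dual_potential[OF w min]] max[OF
        dual_potential_in_ball[OF w]]
    by (meson order_trans)
  have le2: "first_eigenvalue s p \<Omega> V \<le> J V w" by (rule first_eigenvalue_le[OF VL(1) w])
  have NV: "N \<le> (LINT x|lebesgue_on \<Omega>. V x * w x)" using le1 le2 by (simp add: J_def Phi_def N_def)
  have wN: "(w x / N) powr r = w x powr r / mass w" for x using N by (simp add: powr_divide)
  define h where "h x = \<bar>V x\<bar> powr q / q + w x powr r / mass w / r - V x * w x / N" for x
  have Y: "\<bar>V x\<bar> * (w x / N) \<le> \<bar>V x\<bar> powr q / q + w x powr r / mass w / r" for x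
    using Youngs_inequality[of q r "\<bar>V x\<bar>" "w x / N"] q r D(1)[of x] N unfolding wN by simp
  have VN: "V x * w x / N \<le> \<bar>V x\<bar> * (w x / N)" for x
    using D(1)[of x] N by (auto intro!: divide_right_mono mult_right_mono)
  have h0: "h x \<ge> 0" for x using order_trans[OF VN Y] by (simp add: h_def)
  have hi: "integrable (lebesgue_on \<Omega>) h"
    unfolding h_def by (intro Bochner_Integration.integrable_diff
        Bochner_Integration.integrable_add integrable_divide Vi wi Vwi)
  have hI: "(LINT x|lebesgue_on \<Omega>. h x) = I / q + 1 / r - (LINT x|lebesgue_on \<Omega>. V x * w x) / N"
    unfolding h_def using Vi wi Vwi mw by (simp add: I_def flip: mass_def)
  have "(LINT x|lebesgue_on \<Omega>. V x * w x) / N \<ge> 1" using NV N by simp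
  moreover have "I / q \<le> 1 / q" using I1 q by (intro divide_right_mono) auto
  moreover have "(LINT x|lebesgue_on \<Omega>. h x) \<ge> 0" using h0 by simp
  ultimately have eq0: "(LINT x|lebesgue_on \<Omega>. h x)
      = 0" and VN1: "(LINT x|lebesgue_on \<Omega>. V x * w x) / N = 1"
    and Iq: "I / q = 1 / q" using hI r(2) by linarith+
  have "AE x in lebesgue_on \<Omega>. h x = 0"
    using integral_nonneg_eq_0_iff_AE[OF hi] h0 eq0 by simp
  then have ae: "AE x in lebesgue_on \<Omega>. 0 \<le> V x \<and> V x powr q = w x powr r / mass w"
  proof eventually_elim
    case (elim x)
    then have e: "V x * w x / N = \<bar>V x\<bar> * (w x / N)" "\<bar>V x\<bar> * (w x / N)
        = \<bar>V x\<bar> powr q / q + (w x / N) powr r / r"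
    proof -
      have gen: "A = B \<and> B = C" if "A \<le> B" "B \<le> C" "C - A = 0" for A B C :: real
        using that by linarith
      show "V x * w x / N = \<bar>V x\<bar> * (w x / N)" "\<bar>V x\<bar> * (w x / N)
          = \<bar>V x\<bar> powr q / q + (w x / N) powr r / r"
        using gen[OF VN Y elim[unfolded h_def]] unfolding wN by auto
    qed
    have eq: "\<bar>V x\<bar> powr q = w x powr r / mass w"
      using Young_equality[OF q(1) r(1) r(2) _ _ e(2)] D(1)[of x] N by (simp add: wN)
    have "0 \<le> V x"
    proof (cases "w x = 0")
      case True
      then show ?thesis using eq by simp
    next
      case False
      then have "V x = \<bar>V x\<bar>" using e(1) N by simp
      then show ?thesis by linarith
    qed
    then show ?case using eq by simp
  qed
  have "I = 1" using Iq q by simp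
  then have "Lp_norm q \<Omega> V = 1" using q by (simp add: Lp_norm_def I_def)
  moreover have "J V w = Phi w" using VN1 N by (simp add: J_def Phi_def N_def field_simps)
  ultimately show ?thesis using that[OF w _ ae] le1 le2 by simp
qed

text \<open>The equality case of the hidden convexity makes the energy strictly convex on every segment that
  starts at a density positive almost everywhere in \<open>\<Omega>\<close>, so a minimizer of \<open>J V\<close> with this
  positivity is the only one.\<close>

lemma J_minimizer_unique:
  assumes V: "V \<in> Lp q \<Omega>" and w: "w \<in> dens" and z: "z \<in> dens"
    and wm: "J V w \<le> c" and zm: "J V z \<le> c" and min: "\<And>v. v \<in> dens \<Longrightarrow> c \<le> J V v"
    and pos: "AE x in lebesgue_on \<Omega>. 0 < z x"
  shows "AE x in lebesgue_on \<Omega>. w x = z x"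
proof -
  note D = densD[OF w] and D' = densD[OF z]
  note [measurable] = D(3) D'(3)
  define m where "m x = 1/2 * w x + 1/2 * z x" for x
  have m: "m \<in> dens" unfolding m_def by (rule dens_convex[OF w z]) auto
  define u v where "u x = w x powr (1 / p)" and "v x = z x powr (1 / p)" for x
  have uv0: "u x \<ge> 0" "v x \<ge> 0" for x by (auto simp: u_def v_def)
  have um [measurable]: "u \<in> borel_measurable lebesgue" "v \<in> borel_measurable lebesgue"
    unfolding u_def v_def by measurable
  have mroot: "m x powr (1 / p) = lp_mean p (1/2) (1/2) (u x) (v x)" for x
    using p D(1)[of x] D'(1)[of x] by (simp add: m_def lp_mean_def u_def v_def powr_powr)
  define Q where "Q = gagliardo_quotient s p (\<lambda>x. lp_mean p (1/2) (1/2) (u x) (v x))"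
  define g where "g y = 1/2 * gagliardo_quotient s p u y + 1/2 * gagliardo_quotient s p v y - Q y"
      for y
  have lm [measurable]: "(\<lambda>x. lp_mean p (1/2) (1/2) (u x) (v x)) \<in> borel_measurable lebesgue"
    unfolding lp_mean_def by measurable
  have quot: "integrable lebesgue (gagliardo_quotient s p f)"
      "(LINT y|lebesgue. gagliardo_quotient s p f y) = 2 * e"
    if "f \<in> borel_measurable lebesgue" "energy s p f
        = ennreal (2 * e)" "e \<ge> 0" for f :: "'a \<Rightarrow> real" and e
  proof -
    note [measurable] = that(1)
    show "integrable lebesgue (gagliardo_quotient s p f)"
      using that(2) by (subst integrable_iff_nn_integral_finite) (auto simp:
          gagliardo_quotient_nonneg simp flip: energy_def)
    show "(LINT y|lebesgue. gagliardo_quotient s p f y) = 2 * e"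
      using that by (subst integral_eq_nn_integral) (auto simp: gagliardo_quotient_nonneg simp
          flip: energy_def)
  qed
  note qu = quot[OF um(1) D(9)[folded u_def] D(10)]
  note qv = quot[OF um(2) D'(9)[folded v_def] D'(10)]
  have qm: "integrable lebesgue Q" "(LINT y|lebesgue. Q y) = 2 * en m"
    using quot[OF lm _ densD(10)[OF m]] densD(9)[OF m] unfolding mroot Q_def by auto
  have g0: "g y \<ge> 0" for y
    using gagliardo_quotient_lp_mean_le[OF p, of "1/2" "1/2" u v s y] uv0 by (simp add: g_def Q_def)
  have gi: "integrable lebesgue g" unfolding g_def using qu qv qm by simp
  have "(LINT y|lebesgue. g y) = en w + en z - 2 * en m" unfolding g_def using qu qv qm by simp
  also have "\<dots> \<le> 0"
  proof -
    have "(LINT x|lebesgue_on \<Omega>. V x * m x)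
        = (LINT x|lebesgue_on \<Omega>. 1/2 * (V x * w x) + 1/2 * (V x * z x))"
      by (intro Bochner_Integration.integral_cong) (auto simp: m_def algebra_simps)
    also have "\<dots>
        = 1/2 * (LINT x|lebesgue_on \<Omega>. V x * w x) + 1/2 * (LINT x|lebesgue_on \<Omega>. V x * z x)"
      using dens_product_integrable[OF V w] dens_product_integrable[OF V z] by simp
    finally show ?thesis using min[OF m] wm zm unfolding J_def by (simp add: field_simps)
  qed
  finally have "(LINT y|lebesgue. g y) \<le> 0" .
  moreover have "(LINT y|lebesgue. g y) \<ge> 0" by (rule integral_nonneg_AE) (simp add: g0)
  ultimately have "(LINT y|lebesgue. g y) = 0" by (rule order_antisym)
  then have "AE y in lebesgue. g y = 0" using integral_nonneg_eq_0_iff_AE[OF gi] g0 by simp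
  then have "AE y in lebesgue. u (fst y) * v (snd y) = u (snd y) * v (fst y)"
  proof eventually_elim
    case (elim y)
    show ?case
    proof (cases "fst y = snd y")
      case False
      then have d: "norm (fst y - snd y) powr (real DIM('a) + s * p) \<noteq> 0" by simp
      have "\<bar>lp_mean p (1/2) (1/2) (u (fst y)) (v (fst y)) - lp_mean p (1/2) (1/2) (u (snd y)) (v
          (snd y))\<bar> powr p
         = 1/2 * \<bar>u (fst y) - u (snd y)\<bar> powr p + 1/2 * \<bar>v (fst y) - v (snd y)\<bar> powr p"
        using elim d unfolding g_def Q_def gagliardo_quotient_alt by (simp add: divide_simps)
      then show ?thesis by (intro hidden_convexity(2)[OF p, of "1/2" "1/2"] uv0) auto
    qed simp
  qed
  then have "AE y in (lborel \<Otimes>\<^sub>M lborel). u (fst y) * v (snd y) = u (snd y) * v (fst y)"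
    by (simp only: AE_completion_iff lborel_prod)
  from lborel_pair.AE_pair[OF this]
  have pair: "AE x in lebesgue. AE y in lebesgue. u x * v y = u y * v x"
    by (simp add: AE_completion_iff)
  have posL: "AE x in lebesgue. x \<in> \<Omega> \<longrightarrow> 0 < z x" using pos by (simp add: AE_restrict_space_iff)
  \<comment> \<open>A point \<open>x\<close> of \<open>\<Omega>\<close> at which both almost-everywhere statements hold.\<close>
  have "\<exists>x\<in>\<Omega>. 0 < z x \<and> (AE y in lebesgue. u x * v y = u y * v x)"
  proof (rule ccontr)
    assume none: "\<not> ?thesis"
    have "AE x in lebesgue. x \<notin> \<Omega>"
      using pair posL
    proof eventually_elim
      case (elim x)
      then show ?case using none by blast
    qed
    then have "AE x in lebesgue. w x = 0" by eventually_elim (rule D(2))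
    then have "(\<integral>\<^sup>+x. ennreal (w x) \<partial>lebesgue) = (\<integral>\<^sup>+x. 0 \<partial>(lebesgue :: 'a measure))"
      by (intro nn_integral_cong_AE) auto
    then show False using D(5) by simp
  qed
  then obtain x where x: "0 < z x" and xy: "AE y in lebesgue. u x * v y = u y * v x" by blast
  define k where "k = (u x / v x) powr p"
  have vx: "v x > 0" using x by (simp add: v_def)
  have "AE y in lebesgue. w y = k * z y"
    using xy
  proof eventually_elim
    case (elim y)
    then have "u y = u x / v x * v y" using vx by (simp add: field_simps)
    then have "u y powr p = k * v y powr p" by (simp only: k_def powr_mult)
    then show ?case using p D(1)[of y] D'(1)[of y] by (simp add: u_def v_def powr_powr)
  qed
  then have "AE y in lebesgue. y \<in> \<Omega> \<longrightarrow> w y = k * z y" by (rule eventually_mono) simp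
  then have "AE y in lebesgue_on \<Omega>. w y = k * z y" by (simp add: AE_restrict_space_iff)
  then have "(LINT y|lebesgue_on \<Omega>. w y) = (LINT y|lebesgue_on \<Omega>. k * z y)"
    using D(4) D'(4) by (intro integral_cong_AE) auto
  then have "k = 1" using D(8) D'(8) by simp
  with \<open>AE y in lebesgue_on \<Omega>. w y = k * z y\<close> show ?thesis by simp
qed

text \<open>Testing the eigenvalue equation with the eigenfunction itself.\<close>

lemma eigenfunction_energy:
  assumes u: "eigenfunction s p \<Omega> V l u" "Lp_norm p UNIV u = 1"
  shows "(\<lambda>x. \<bar>u x\<bar> powr p) \<in> dens" "J V (\<lambda>x. \<bar>u x\<bar> powr p) \<le> l"
proof -
  have uW: "u \<in> W_tilde s p \<Omega>" using u by (simp add: eigenfunction_def)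
  show "(\<lambda>x. \<bar>u x\<bar> powr p) \<in> dens" by (rule dens_of_W_tilde(1)[OF uW u(2)])
  have um: "u \<in> borel_measurable lebesgue" using uW by (simp add: W_tilde_iff[OF \<Omega>(1)])
  have sq: "\<bar>t\<bar> powr (p - 2) * t * t = \<bar>t\<bar> powr p" for t :: real
  proof (cases "t = 0")
    case False
    have "\<bar>t\<bar> powr (p - 2) * t * t = \<bar>t\<bar> powr (p - 2) * \<bar>t\<bar> powr 2"
      using False by (simp add: power2_eq_square)
    also have "\<dots> = \<bar>t\<bar> powr (p - 2 + 2)" by (simp only: powr_add)
    finally show ?thesis by simp
  qed (use p in simp)
  have "(\<lambda>(x, y). \<bar>u x - u y\<bar> powr (p - 2) * (u x - u y) * (u x - u y) / norm (x - y) powr (real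
      DIM('a) + s * p))
     = gagliardo_quotient s p u"
    by (simp add: gagliardo_quotient_def sq)
  then have "energy_form s p u u = 1 / 2 * gagliardo s p UNIV u powr p"
    using um p by (simp add: energy_form_def gagliardo_powr integral_eq_nn_integral
        gagliardo_quotient_nonneg energy_def)
  moreover have "energy_form s p u u + (LINT x|lebesgue_on \<Omega>. V x * \<bar>u x\<bar> powr (p - 2) * u x * u x)
      = l * (LINT x|lebesgue. \<bar>u x\<bar> powr (p - 2) * u x * u x)"
    using u(1) uW unfolding eigenfunction_def by blast
  moreover have "V x * \<bar>u x\<bar> powr (p - 2) * u x * u x = V x * \<bar>u x\<bar> powr p" for x
    using sq[of "u x"] by (simp add: mult.assoc)
  moreover have "(LINT x|lebesgue. \<bar>u x\<bar> powr p) = 1"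
    using u(2) p by (simp add: Lp_norm_eq_1_iff lebesgue_on_UNIV_eq)
  ultimately show "J V (\<lambda>x. \<bar>u x\<bar> powr p) \<le> l"
    using J_le_energy_functional[OF uW u(2), of V] by (simp add: sq)
qed

end

theorem theorem5p3:
  fixes s p q :: real and \<Omega> :: "'a::euclidean_space set" and Vs :: "'a \<Rightarrow> real"
  assumes "0 < s" "s < 1" "1 < p"
    and "bounded \<Omega>" "\<Omega> \<noteq> {}" "extension_domain s p \<Omega>"
    and "1 < q" "real DIM('a) / (s * p) < q"
    and "Vs \<in> Lp_unit_cball q \<Omega>"
    and "\<And>V. V \<in> Lp_unit_cball q \<Omega> \<Longrightarrow> first_eigenvalue s p \<Omega> V \<le> first_eigenvalue s p \<Omega> Vs"
  shows "(AE x in lebesgue_on \<Omega>. 0 \<le> Vs x) \<and>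
    Vs \<in> Lp_unit_sphere q \<Omega> \<and>
    (\<forall>us. eigenfunction s p \<Omega> Vs (first_eigenvalue s p \<Omega> Vs) us \<and>
          (AE x in lebesgue_on \<Omega>. 0 < us x) \<and> Lp_norm p UNIV us = 1 \<longrightarrow>
       (\<forall>W\<in>sphere_tangent q \<Omega> Vs.
          has_bochner_integral (lebesgue_on \<Omega>) (\<lambda>x. W x * \<bar>us x\<bar> powr p) 0))"
proof -
  define r where "r = q / (q - 1)"
  have "open \<Omega>" using assms(6) by (simp add: extension_domain_def)
  then interpret subcritical_problem s p q r \<Omega>
    using assms by unfold_locales (auto simp: r_def)
  obtain w where w: "w \<in> dens" and lw: "first_eigenvalue s p \<Omega> Vs = J Vs w"
    and ae: "AE x in lebesgue_on \<Omega>. 0 \<le> Vs x \<and> Vs x powr q = w x powr r / mass w"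
    and norm: "Lp_norm q \<Omega> Vs = 1"
    by (rule maximizing_potential[OF assms(9,10)])
  have VL: "Vs \<in> Lp q \<Omega>" using assms(9) by (simp add: Lp_unit_cball_def)
  have Vm [measurable]: "Vs \<in> borel_measurable (lebesgue_on \<Omega>)" using VL by (simp add: Lp_def)
  note [measurable] = densD(4)[OF w]
  show ?thesis
  proof (intro conjI allI impI ballI)
    show "AE x in lebesgue_on \<Omega>. 0 \<le> Vs x" using ae by eventually_elim simp
    show "Vs \<in> Lp_unit_sphere q \<Omega>" using VL norm by (simp add: Lp_unit_sphere_def)
    fix us W
    assume us: "eigenfunction s p \<Omega> Vs (first_eigenvalue s p \<Omega> Vs) us \<and>
          (AE x in lebesgue_on \<Omega>. 0 < us x) \<and> Lp_norm p UNIV us = 1"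
      and W: "W \<in> sphere_tangent q \<Omega> Vs"
    define z where "z x = \<bar>us x\<bar> powr p" for x
    have z: "z \<in> dens" "J Vs z \<le> first_eigenvalue s p \<Omega> Vs"
      using eigenfunction_energy us unfolding z_def by auto
    note [measurable] = densD(4)[OF z(1)]
    have "AE x in lebesgue_on \<Omega>. 0 < us x" using us by simp
    then have zpos: "AE x in lebesgue_on \<Omega>. 0 < z x" by eventually_elim (simp add: z_def)
    have wz: "AE x in lebesgue_on \<Omega>. w x = z x"
      by (rule J_minimizer_unique[OF VL w z(1) _ z(2) first_eigenvalue_le[OF VL] zpos])
         (simp_all add: lw)
    have WL: "W \<in> Lp q \<Omega>" and W0: "(LINT x|lebesgue_on \<Omega>. \<bar>Vs x\<bar> powr (q - 2) * Vs x * W x) = 0"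
      using W by (auto simp: sphere_tangent_def)
    have Wm [measurable]: "W \<in> borel_measurable (lebesgue_on \<Omega>)" using WL by (simp add: Lp_def)
    have mw: "mass w > 0" by (rule mass_pos[OF w])
    have qr: "r * ((q - 1) / q) = 1" "(q - 1) / q = 1 / r" using assms(7)
        by (auto simp: r_def field_simps)
    have "AE x in lebesgue_on \<Omega>. \<bar>Vs x\<bar> powr (q - 2) * Vs x * W x = W x * z x / mass w powr (1 / r)"
      using ae wz
    proof eventually_elim
      case (elim x)
      then have V0: "Vs x \<ge> 0" and Vq: "Vs x powr q = z x powr r / mass w" and z0: "z x \<ge> 0"
        by (auto simp: z_def)
      have "\<bar>Vs x\<bar> powr (q - 2) * Vs x = Vs x powr (q - 1)"
        using powr_mult_base[OF V0, of "q - 2"] V0 by (simp add: mult.commute)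
      also have "\<dots> = (Vs x powr q) powr ((q - 1) / q)" using assms(7) by (simp add: powr_powr)
      also have "\<dots> = z x / mass w powr (1 / r)"
        unfolding Vq using qr z0 by (simp add: powr_divide powr_powr)
      finally show ?case by (simp add: mult.commute)
    qed
    then have "(LINT x|lebesgue_on \<Omega>. \<bar>Vs x\<bar> powr (q - 2) * Vs x * W x)
        = (LINT x|lebesgue_on \<Omega>. W x * z x / mass w powr (1 / r))"
      by (intro integral_cong_AE) measurable
    then have "(LINT x|lebesgue_on \<Omega>. W x * z x) = 0" using W0 mw by simp
    moreover have "integrable (lebesgue_on \<Omega>) (\<lambda>x. W x * z x)"
        by (rule dens_product_integrable[OF WL z(1)])
    ultimately show "has_bochner_integral (lebesgue_on \<Omega>) (\<lambda>x. W x * \<bar>us x\<bar> powr p) 0"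
      unfolding z_def by (simp add: has_bochner_integral_iff)
  qed
qed

end
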